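(* For each $N$, the support $\mathcal{S}_N$ of $\mu_N$ is given by $$\mathcal{S}_N=\{0\}\,\mathbb{I}_{c_N>1}\ \cup\ [x_{-,N},x_{1,N}^+]\cup[x_{2,N}^-,x_{2,N}^+]\cup\dots\cup[x_{q,N}^-,x_{q,N}^+]\cup[x_{q+1,N}^-,x_{+,N}],$$ where $\{0\}\,\mathbb{I}_{c_N>1}$ is $\{0\}$ if $c_N>1$ and empty otherwise, and where the union of intervals is to be read as the single interval $[x_{-,N},x_{+,N}]$ if $q=0$.
   Context: $M,N,L\ge1$ are integers, $c_N=ML/N$, and $R_N$ is an $M\times M$ Hermitian matrix with $aI_M\le R_N<bI_M$, $0<a<b$. For $z\in\mathbb{C}^+$ (open upper half plane), $t_N(z)$ is the unique solution with $t_N(z)\in\mathbb{C}^+$, $zt_N(z)\in\mathbb{C}^+$ of $t_N(z)=\frac1M\mathrm{Tr}\,R_N\left(-zI_M-\frac{zc_Nt_N(z)}{1-zc_N^2t_N(z)^2}R_N\right)^{-1}$. $t_N$ is the Stieltjes transform $\int\frac{d\mu_N(\lambda)}{\lambda-z}$ of a positive finite measure $\mu_N$ carried by $[0,\infty)$, with support $\mathcal{S}_N$. Define $$\phi_N(w)=c_Nw^2\,\tfrac1M\mathrm{Tr}R_N(R_N-wI)^{-1}\left(c_N\tfrac1M\mathrm{Tr}R_N(R_N-wI)^{-1}-1\right).$$ Let $\overline\lambda_{1}>\dots>\overline\lambda_{\overline M}$ be the distinct eigenvalues of $R_N$, and $\mu_{1}<\dots<\mu_{\overline M-1}$ the roots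 of $\frac1M\mathrm{Tr}R_N(R_N-wI)^{-1}=0$, which satisfy $\overline\lambda_{\overline M}<\mu_1<\overline\lambda_{\overline M-1}<\mu_2<\dots<\mu_{\overline M-1}<\overline\lambda_1$. The number of local extrema of $\phi_N$ in $]\overline\lambda_{\overline M},\mu_1[\,\cup\,]\overline\lambda_{\overline M-1},\mu_2[\,\cup\dots\cup\,]\overline\lambda_2,\mu_{\overline M-1}[$ is an even number $2q$ with $0\le q\le\overline M-1$; if $q\ge1$ their arguments are denoted in increasing order $w_{1,N}^+<w_{2,N}^-<w_{2,N}^+<\dots<w_{q,N}^+<w_{q+1,N}^-$, and $x_{p,N}^{\pm}=\phi_N(w_{p,N}^{\pm})$. $w_{+,N}$ is the unique point of $]\overline\lambda_1,+\infty[$ at which $\phi_N'$ vanishes, and $x_{+,N}=\phi_N(w_{+,N})$. If $c_N\le1$, $x_{-,N}=0$. If $c_N>1$, the smallest root $\omega_{1,N}$ of $\frac1M\mathrm{Tr}R_N(R_N-wI)^{-1}=\frac1{c_N}$ is strictly negative, $w_{-,N}$ is the unique point of $]\omega_{1,N},0[$ at which $\phi_N'$ vanishes, and $x_{-,N}=\phi_N(w_{-,N})$. *)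

theory Defs
  imports
    "HOL-Analysis.Analysis"
    "Jordan_Normal_Form.Schur_Decomposition"
    "Jordan_Normal_Form.Gauss_Jordan_Elimination"
begin

definition mat_trace :: "complex mat \<Rightarrow> complex" where
  "mat_trace A = (\<Sum>i<dim_row A. A $$ (i, i))"

text \<open>Unspecified when \<open>A\<close> is not invertible.\<close>

definition mat_inv :: "complex mat \<Rightarrow> complex mat" where
  "mat_inv A = the (mat_inverse A)"

definition hermitian_mat :: "complex mat \<Rightarrow> bool" where
  "hermitian_mat A \<longleftrightarrow> mat_adjoint A = A"

text \<open>The two definitions below are meant for Hermitian \<open>A\<close>, for which the quadratic form
  \<open>v\<^sup>* A v\<close> is real.\<close>

definition pos_semidef_mat :: "complex mat \<Rightarrow> bool" where
  "pos_semidef_mat A \<longleftrightarrow> (\<forall>v \<in> carrier_vec (dim_row A). Re ((A *\<^sub>v v) \<bullet>c v) \<ge> 0)"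

definition pos_def_mat :: "complex mat \<Rightarrow> bool" where
  "pos_def_mat A \<longleftrightarrow>
     (\<forall>v \<in> carrier_vec (dim_row A). v \<noteq> 0\<^sub>v (dim_row A) \<longrightarrow> Re ((A *\<^sub>v v) \<bullet>c v) > 0)"

definition ratio_c :: "nat \<Rightarrow> nat \<Rightarrow> nat \<Rightarrow> real" where
  "ratio_c M N L = real M * real L / real N"

definition solves_t_equation :: "real \<Rightarrow> complex mat \<Rightarrow> complex \<Rightarrow> complex \<Rightarrow> bool" where
  "solves_t_equation c R z s \<longleftrightarrow>
     s = (1 / of_nat (dim_row R)) *
         mat_trace (R * mat_inv ((- z) \<cdot>\<^sub>m 1\<^sub>m (dim_row R)
           - ((z * of_real c * s) / (1 - z * (of_real c)\<^sup>2 * s\<^sup>2)) \<cdot>\<^sub>m R))"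

definition is_t_solution :: "real \<Rightarrow> complex mat \<Rightarrow> (complex \<Rightarrow> complex) \<Rightarrow> bool" where
  "is_t_solution c R t \<longleftrightarrow>
     (\<forall>z. Im z > 0 \<longrightarrow> Im (t z) > 0 \<and> Im (z * t z) > 0 \<and> solves_t_equation c R z (t z))"

definition is_stieltjes_transform :: "real measure \<Rightarrow> (complex \<Rightarrow> complex) \<Rightarrow> bool" where
  "is_stieltjes_transform \<mu> t \<longleftrightarrow>
     (\<forall>z. Im z > 0 \<longrightarrow> t z = (\<integral>x. 1 / (complex_of_real x - z) \<partial>\<mu>))"

definition measure_support :: "real measure \<Rightarrow> real set" where
  "measure_support \<mu> = {x. \<forall>e>0. emeasure \<mu> (ball x e) > 0}"

definition resolvent_trace :: "complex mat \<Rightarrow> complex \<Rightarrow> complex" where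
  "resolvent_trace R w =
     (1 / of_nat (dim_row R)) * mat_trace (R * mat_inv (R - w \<cdot>\<^sub>m 1\<^sub>m (dim_row R)))"

definition phi_complex :: "real \<Rightarrow> complex mat \<Rightarrow> complex \<Rightarrow> complex" where
  "phi_complex c R w =
     of_real c * w\<^sup>2 * resolvent_trace R w * (of_real c * resolvent_trace R w - 1)"

text \<open>For Hermitian \<open>R\<close>, \<open>phi_complex\<close> is real at every real \<open>w\<close> that is not an eigenvalue,
  so that taking the real part loses nothing.\<close>

definition phi :: "real \<Rightarrow> complex mat \<Rightarrow> real \<Rightarrow> real" where
  "phi c R w = Re (phi_complex c R (of_real w))"

definition real_eigenvalues :: "complex mat \<Rightarrow> real set" where
  "real_eigenvalues R = {x. eigenvalue R (complex_of_real x)}"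

text \<open>At an eigenvalue \<open>resolvent_trace\<close> has an arbitrary value, so eigenvalues have to be
  excluded explicitly from the roots.\<close>

definition resolvent_roots :: "complex mat \<Rightarrow> real \<Rightarrow> real set" where
  "resolvent_roots R y =
     {w. w \<notin> real_eigenvalues R \<and> resolvent_trace R (of_real w) = of_real y}"

definition num_eig :: "complex mat \<Rightarrow> nat" where
  "num_eig R = card (real_eigenvalues R)"

text \<open>Indices start at 1; the eigenvalues are in decreasing order, the roots in increasing order.\<close>

definition eig :: "complex mat \<Rightarrow> nat \<Rightarrow> real" where
  "eig R k = rev (sorted_list_of_set (real_eigenvalues R)) ! (k - 1)"

definition mu_root :: "complex mat \<Rightarrow> nat \<Rightarrow> real" where
  "mu_root R k = sorted_list_of_set (resolvent_roots R 0) ! (k - 1)"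

definition extrema_domain :: "complex mat \<Rightarrow> real set" where
  "extrema_domain R = (\<Union>k\<in>{1..<num_eig R}. {eig R (num_eig R + 1 - k)<..<mu_root R k})"

definition local_extremum :: "(real \<Rightarrow> real) \<Rightarrow> real \<Rightarrow> bool" where
  "local_extremum g x \<longleftrightarrow>
     (\<forall>\<^sub>F y in nhds x. g y \<le> g x) \<or> (\<forall>\<^sub>F y in nhds x. g x \<le> g y)"

definition extrema :: "real \<Rightarrow> complex mat \<Rightarrow> real set" where
  "extrema c R = {w \<in> extrema_domain R. local_extremum (phi c R) w}"

definition num_gaps :: "real \<Rightarrow> complex mat \<Rightarrow> nat" where
  "num_gaps c R = card (extrema c R) div 2"

text \<open>The increasing enumeration of the extrema is
  \<open>w\<^sub>1\<^sup>+, w\<^sub>2\<^sup>-, w\<^sub>2\<^sup>+, \<dots>, w\<^sub>q\<^sup>+, w\<^sub>q\<^sub>+\<^sub>1\<^sup>-\<close>: \<open>w\<^sub>p\<^sup>+\<close> is defined for \<open>1 \<le> p \<le> q\<close> and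
  \<open>w\<^sub>p\<^sup>-\<close> for \<open>2 \<le> p \<le> q + 1\<close>.\<close>

definition w_plus :: "real \<Rightarrow> complex mat \<Rightarrow> nat \<Rightarrow> real" where
  "w_plus c R p = sorted_list_of_set (extrema c R) ! (2 * p - 2)"

definition w_minus :: "real \<Rightarrow> complex mat \<Rightarrow> nat \<Rightarrow> real" where
  "w_minus c R p = sorted_list_of_set (extrema c R) ! (2 * p - 3)"

definition x_plus :: "real \<Rightarrow> complex mat \<Rightarrow> nat \<Rightarrow> real" where
  "x_plus c R p = phi c R (w_plus c R p)"

definition x_minus :: "real \<Rightarrow> complex mat \<Rightarrow> nat \<Rightarrow> real" where
  "x_minus c R p = phi c R (w_minus c R p)"

definition w_right :: "real \<Rightarrow> complex mat \<Rightarrow> real" where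
  "w_right c R = (THE w. eig R 1 < w \<and> deriv (phi c R) w = 0)"

definition x_right :: "real \<Rightarrow> complex mat \<Rightarrow> real" where
  "x_right c R = phi c R (w_right c R)"

definition omega_min :: "real \<Rightarrow> complex mat \<Rightarrow> real" where
  "omega_min c R = Min (resolvent_roots R (1 / c))"

definition w_left :: "real \<Rightarrow> complex mat \<Rightarrow> real" where
  "w_left c R = (THE w. omega_min c R < w \<and> w < 0 \<and> deriv (phi c R) w = 0)"

definition x_left :: "real \<Rightarrow> complex mat \<Rightarrow> real" where
  "x_left c R = (if c \<le> 1 then 0 else phi c R (w_left c R))"

end

theory Submission
  imports Defs "HOL-Complex_Analysis.Complex_Analysis"
begin

text \<open>Let \<open>e 0, \<dots>, e (n - 1)\<close> be the eigenvalues of \<open>R\<close>, repeated according to multiplicity.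
All traces in the statement are averages over them; with \<open>F w\<close> the average of \<open>e i / (e i -
w)\<close>, \<open>A w = - w F w\<close> and \<open>B w = w + c A w\<close>, the function \<open>phi\<close> becomes
\<open>Phi = c A B\<close>. The substitution \<open>w = z c t - 1 / (c t)\<close> turns the equation for
\<open>t\<close> into \<open>Phi w = z\<close>, with \<open>A w = - z t\<close> and \<open>B w = - 1 / (c t)\<close>:
solving for \<open>t\<close> means inverting \<open>Phi\<close>.

The whole proof rests on one identity for the difference of two values of \<open>Phi\<close> (\<open>Phi_diff\<close>)
and on the Cauchy-Schwarz inequality. With \<open>S w\<close> the average of \<open>e\<^sup>2 / \<bar>e -
w\<bar>\<^sup>2\<close>, they show that \<open>Phi\<close> is injective on the open set \<open>Omega\<close> where
\<open>S (\<bar>B\<bar> + c \<bar>A\<bar>) < \<bar>A\<bar>\<close> (\<open>Phi_inj_on_Omega\<close>). The point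
\<open>w\<close> that belongs to \<open>t z\<close> lies in \<open>Omega\<close> for every \<open>z\<close> in the
upper half plane (\<open>upper_half_plane_in_Omega\<close>). On the real axis, inside the region \<open>D\<close>
where \<open>A\<close> and \<open>B\<close> are positive, \<open>Omega\<close> is exactly the set where
\<open>Phi\<close> has positive derivative.

Hence \<open>x > 0\<close> lies outside the support if and only if \<open>x = Phi w\<close> for some \<open>w\<close>
in \<open>D\<close> with \<open>Phi' w > 0\<close>. If such a \<open>w\<close> exists, the inverse of
\<open>Phi\<close> on \<open>Omega\<close> continues \<open>t\<close> across the real axis near \<open>x\<close> with
real values there, and Stieltjes inversion shows that the measure vanishes near \<open>x\<close>
(\<open>support_gap_from_Phi\<close>). Conversely, if the measure vanishes near \<open>x\<close>, then
\<open>t\<close> has a real boundary value with linear rate, and the limit of the points \<open>w\<close> has the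
required properties; the same argument leads to a contradiction for \<open>x = 0\<close>, so that \<open>0\<close>
always belongs to the support (\<open>boundary_preimage\<close>).

It remains to describe the image of the increasing branches. The region \<open>D\<close> consists of the intervals
between an eigenvalue and the next zero of \<open>F\<close>, of the half line to the right of all eigenvalues and, if
\<open>c > 1\<close>, of an interval to the left of \<open>0\<close>. A real version of the injectivity argument
(\<open>Phi_strict_mono_on_increasing\<close>) says that among points of \<open>D\<close> where \<open>Phi' \<ge>
0\<close>, a larger point has a larger value, even across different components. Together with a third-derivative
computation (\<open>degenerate_critical_point\<close>) it follows that in each component the set where \<open>Phi' >
0\<close> is an interval, and that \<open>Phi'\<close> changes sign exactly at those of its end points that lie inside
the component. So every bounded component to the right of \<open>0\<close> contains no local extremum or exactly two,
a minimum followed by a maximum; they are the two edges of one gap of the support, and the gaps are ordered like their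
arguments.\<close>

section \<open>Spectral data of a Hermitian matrix\<close>

lemma times_mat_entry:
  fixes U V :: "'a::semiring_0 mat"
  assumes "U \<in> carrier_mat n n" "V \<in> carrier_mat n n" "i < n" "j < n"
  shows "(U * V) $$ (i, j) = (\<Sum>k<n. U $$ (i, k) * V $$ (k, j))"
  using assms by (simp add: scalar_prod_def lessThan_atLeast0)

lemma mat_trace_commute:
  assumes "U \<in> carrier_mat n n" "V \<in> carrier_mat n n"
  shows "mat_trace (U * V) = mat_trace (V * U)"
proof -
  have "mat_trace (U * V) = (\<Sum>i<n. \<Sum>k<n. U $$ (i, k) * V $$ (k, i))"
    unfolding mat_trace_def using assms by (auto intro!: sum.cong simp: times_mat_entry[OF assms] simp del: index_mult_mat(1))
  also have "\<dots> = (\<Sum>k<n. \<Sum>i<n. V $$ (k, i) * U $$ (i, k))"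
    by (subst sum.swap) (simp add: mult.commute)
  also have "\<dots> = mat_trace (V * U)"
    unfolding mat_trace_def using assms by (auto intro!: sum.cong simp: times_mat_entry[OF assms(2,1)] simp del: index_mult_mat(1))
  finally show ?thesis .
qed

text \<open>Entries of the product below the diagonal involve only entries of \<open>C\<close> in the same row or further down, so
that \<open>C\<close> can be computed from the last row upwards.\<close>

lemma upper_triangular_mult_right_inverse:
  fixes Y C :: "'a::field mat"
  assumes Y: "Y \<in> carrier_mat n n" and C: "C \<in> carrier_mat n n" and ut: "upper_triangular Y"
    and diag: "\<And>i. i < n \<Longrightarrow> Y $$ (i, i) \<noteq> 0" and inv: "Y * C = 1\<^sub>m n"
  shows "j < i \<Longrightarrow> i < n \<Longrightarrow> C $$ (i, j) = 0" and "i < n \<Longrightarrow> C $$ (i, i) = 1 / Y $$ (i, i)"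
proof -
  have entry: "Y $$ (i, i) * C $$ (i, j) + (\<Sum>k\<in>{i<..<n}. Y $$ (i, k) * C $$ (k, j)) = (if i = j then 1 else 0)"
    if "i < n" "j < n" for i j
  proof -
    have "(\<Sum>k<n. Y $$ (i, k) * C $$ (k, j)) = (\<Sum>k\<in>{i..<n}. Y $$ (i, k) * C $$ (k, j))"
      using ut Y that by (intro sum.mono_neutral_right) auto
    also have "{i..<n} = insert i {i<..<n}" using that by auto
    finally have "(\<Sum>k<n. Y $$ (i, k) * C $$ (k, j)) = Y $$ (i, i) * C $$ (i, j) + (\<Sum>k\<in>{i<..<n}. Y $$ (i, k) * C $$ (k, j))"
      by simp
    moreover have "(\<Sum>k<n. Y $$ (i, k) * C $$ (k, j)) = (if i = j then 1 else 0)"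
      using times_mat_entry[OF Y C that] inv that by simp
    ultimately show ?thesis by simp
  qed
  have low: "C $$ (i, j) = 0" if "j < i" "i < n" for i j
    using that
  proof (induction "n - i" arbitrary: i rule: less_induct)
    case less
    have "(\<Sum>k\<in>{i<..<n}. Y $$ (i, k) * C $$ (k, j)) = 0"
      using less by (intro sum.neutral) auto
    then show ?case using entry[of i j] diag[of i] less by auto
  qed
  then show "j < i \<Longrightarrow> i < n \<Longrightarrow> C $$ (i, j) = 0" .
  assume i: "i < n"
  have "(\<Sum>k\<in>{i<..<n}. Y $$ (i, k) * C $$ (k, i)) = 0"
    using low by (intro sum.neutral) auto
  then show "C $$ (i, i) = 1 / Y $$ (i, i)"
    using entry[OF i i] diag[OF i] by (simp add: field_simps)
qed

text \<open>Conjugation by \<open>P\<close> turns \<open>X\<close> and its inverse into triangular matrices, whose diagonals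
multiply entrywise; the trace does not see the conjugation.\<close>

lemma mat_trace_resolvent:
  assumes R: "R \<in> carrier_mat n n" and wit: "similar_mat_wit R Tr P Q" and ut: "upper_triangular Tr"
    and nz: "\<And>i. i < n \<Longrightarrow> \<alpha> + \<beta> * Tr $$ (i, i) \<noteq> 0"
    and X: "X = \<alpha> \<cdot>\<^sub>m 1\<^sub>m n + \<beta> \<cdot>\<^sub>m R"
  shows "mat_trace (R * mat_inv X) = (\<Sum>i<n. Tr $$ (i, i) / (\<alpha> + \<beta> * Tr $$ (i, i)))"
proof -
  note w = similar_mat_witD2[OF R wit]
  note [simp] = w(5-7)
  define Y where "Y = \<alpha> \<cdot>\<^sub>m 1\<^sub>m n + \<beta> \<cdot>\<^sub>m Tr"
  have Y: "Y \<in> carrier_mat n n" by (simp add: Y_def)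
  have Xc: "X \<in> carrier_mat n n" using R by (simp add: X)
  have Yd: "Y $$ (i, i) = \<alpha> + \<beta> * Tr $$ (i, i)" if "i < n" for i
    using that carrier_matD[OF w(5)] by (simp add: Y_def)
  have Yut: "upper_triangular Y"
    using upper_triangularD[OF ut] carrier_matD[OF w(5)] by (intro upper_triangularI) (simp add: Y_def)
  have [simp]: "U * V \<in> carrier_mat n n"
    if "U \<in> carrier_mat n n" "V \<in> carrier_mat n n" for U V :: "complex mat"
    using that by (rule mult_carrier_mat)
  have XPY: "X = P * Y * Q"
  proof -
    have "P * Y * Q = (\<alpha> \<cdot>\<^sub>m P + \<beta> \<cdot>\<^sub>m (P * Tr)) * Q"
      unfolding Y_def by (subst mult_add_distrib_mat[of P n n]) (auto simp: mult_smult_distrib[of P n n _ n] right_mult_one_mat[of P n n])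
    also have "\<dots> = \<alpha> \<cdot>\<^sub>m (P * Q) + \<beta> \<cdot>\<^sub>m (P * Tr * Q)"
      by (subst add_mult_distrib_mat[of _ n n _ Q n])
        (auto simp: mult_smult_assoc_mat[of P n n Q n] mult_smult_assoc_mat[of "P * Tr" n n Q n])
    finally show ?thesis using w(1,3) by (simp add: X)
  qed
  have "similar_mat_wit X Y P Q"
    by (rule similar_mat_witI[OF w(1,2) XPY Xc Y w(6,7)])
  then have "similar_mat X Y" by (auto simp: similar_mat_def)
  then have "det X = det Y" by (rule det_similar)
  also have "\<dots> \<noteq> 0"
    using nz Yd Y by (auto simp: det_upper_triangular[OF Yut Y] prod_list_zero_iff diag_mat_def)
  finally have "X \<in> Units (ring_mat TYPE(complex) n ())"
    by (rule det_non_zero_imp_unit[OF Xc])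
  then obtain C where C: "mat_inverse X = Some C"
    using mat_inverse(1)[OF Xc, where b = "()"] by (cases "mat_inverse X") auto
  then have XC: "X * C = 1\<^sub>m n" and Cc: "C \<in> carrier_mat n n"
    using mat_inverse(2)[OF Xc C] by auto
  have inv: "mat_inv X = C" by (simp add: mat_inv_def C)
  note [simp] = Cc Y Xc
  define C' where "C' = Q * (C * P)"
  have C': "C' \<in> carrier_mat n n" by (simp add: C'_def)
  have "Y = Q * X * P"
  proof -
    have "Q * X * P = Q * (P * Y * Q) * P" by (simp only: XPY)
    also have "\<dots> = (Q * P) * Y * (Q * P)" by (simp add: assoc_mult_mat[of _ n n _ n _ n])
    finally show ?thesis by (simp add: w(2) left_mult_one_mat[of _ n n] right_mult_one_mat[of _ n n])
  qed
  then have "Y * C' = Q * X * P * (Q * (C * P))" by (simp add: C'_def)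
  also have "\<dots> = Q * (X * ((P * Q) * (C * P)))" by (simp add: assoc_mult_mat[of _ n n _ n _ n])
  also have "(P * Q) * (C * P) = C * P" by (simp add: w(1) left_mult_one_mat[of _ n n])
  also have "Q * (X * (C * P)) = Q * ((X * C) * P)" by (simp add: assoc_mult_mat[of _ n n _ n _ n])
  also have "\<dots> = 1\<^sub>m n" by (simp add: XC w(2) left_mult_one_mat[of _ n n])
  finally have YC': "Y * C' = 1\<^sub>m n" .
  have Ynz: "Y $$ (i, i) \<noteq> 0" if "i < n" for i using nz[OF that] Yd[OF that] by simp
  have C'_low: "C' $$ (i, j) = 0" if "j < i" "i < n" for i j
    by (rule upper_triangular_mult_right_inverse(1)[OF Y C' Yut _ YC' that]) (rule Ynz)
  have C'_diag: "C' $$ (i, i) = 1 / Y $$ (i, i)" if "i < n" for i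
    by (rule upper_triangular_mult_right_inverse(2)[OF Y C' Yut _ YC' that]) (rule Ynz)
  have "R * C = P * (Tr * (Q * C))"
    by (subst w(3)) (simp add: assoc_mult_mat[of _ n n _ n _ n])
  then have "mat_trace (R * C) = mat_trace (P * (Tr * (Q * C)))" by simp
  also have "\<dots> = mat_trace ((Tr * (Q * C)) * P)" by (rule mat_trace_commute[of _ n]) auto
  also have "(Tr * (Q * C)) * P = Tr * C'"
    by (simp add: C'_def assoc_mult_mat[of _ n n _ n _ n])
  also have "mat_trace (Tr * C') = (\<Sum>i<n. Tr $$ (i, i) / (\<alpha> + \<beta> * Tr $$ (i, i)))"
  proof -
    have "(Tr * C') $$ (i, i) = Tr $$ (i, i) / (\<alpha> + \<beta> * Tr $$ (i, i))" if i: "i < n" for i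
    proof -
      have "(Tr * C') $$ (i, i) = (\<Sum>k<n. Tr $$ (i, k) * C' $$ (k, i))"
        using times_mat_entry[OF w(5) C' i i] .
      also have "\<dots> = (\<Sum>k<n. if k = i then Tr $$ (i, i) * C' $$ (i, i) else 0)"
      proof (intro sum.cong refl)
        fix k assume "k \<in> {..<n}"
        then show "Tr $$ (i, k) * C' $$ (k, i) = (if k = i then Tr $$ (i, i) * C' $$ (i, i) else 0)"
          using upper_triangularD[OF ut, of k i] C'_low[of i k] i w(5)
          by (cases k i rule: linorder_cases) auto
      qed
      also have "\<dots> = Tr $$ (i, i) * C' $$ (i, i)" using i by simp
      finally show ?thesis using C'_diag[OF i] Yd[OF i] by simp
    qed
    then show ?thesis
      unfolding mat_trace_def using carrier_matD[OF w(5)] by (auto intro!: sum.cong simp del: index_mult_mat(1))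
  qed
  finally show ?thesis by (simp add: inv)
qed

lemma mult_mat_vec_entry:
  assumes "R \<in> carrier_mat n n" "v \<in> carrier_vec n" "i < n"
  shows "(R *\<^sub>v v) $ i = (\<Sum>j<n. R $$ (i, j) * v $ j)"
  using assms by (simp add: scalar_prod_def lessThan_atLeast0)

lemma cscalar_prod_self:
  fixes v :: "complex vec"
  assumes "v \<in> carrier_vec n"
  shows "v \<bullet>c v = of_real (\<Sum>i<n. (cmod (v $ i))\<^sup>2)"
  using assms by (simp add: scalar_prod_def lessThan_atLeast0 complex_norm_square[symmetric])

lemma hermitian_entry:
  assumes "R \<in> carrier_mat n n" "hermitian_mat R" "i < n" "j < n"
  shows "R $$ (i, j) = cnj (R $$ (j, i))"
proof -
  have "mat_adjoint R $$ (i, j) = cnj (R $$ (j, i))"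
    using assms by (simp add: mat_adjoint_def mat_of_rows_index)
  then show ?thesis using assms(2) by (simp add: hermitian_mat_def)
qed

lemma hermitian_quadratic_form_real:
  assumes R: "R \<in> carrier_mat n n" and herm: "hermitian_mat R" and v: "v \<in> carrier_vec n"
  shows "cnj ((R *\<^sub>v v) \<bullet>c v) = (R *\<^sub>v v) \<bullet>c v"
proof -
  have eq: "(R *\<^sub>v v) \<bullet>c v = (\<Sum>i<n. \<Sum>j<n. R $$ (i, j) * v $ j * cnj (v $ i))"
  proof -
    have "(R *\<^sub>v v) \<bullet>c v = (\<Sum>i<n. (R *\<^sub>v v) $ i * cnj (v $ i))"
      using v by (simp add: scalar_prod_def lessThan_atLeast0 del: index_mult_mat_vec)
    also have "\<dots> = (\<Sum>i<n. (\<Sum>j<n. R $$ (i, j) * v $ j) * cnj (v $ i))"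
      by (intro sum.cong refl) (subst mult_mat_vec_entry[OF R v], auto)
    finally show ?thesis by (simp add: sum_distrib_right)
  qed
  have "cnj (\<Sum>i<n. \<Sum>j<n. R $$ (i, j) * v $ j * cnj (v $ i)) = (\<Sum>i<n. \<Sum>j<n. R $$ (j, i) * v $ i * cnj (v $ j))"
    unfolding cnj_sum
  proof (intro sum.cong refl)
    fix i j assume "i \<in> {..<n}" "j \<in> {..<n}"
    then have "cnj (R $$ (i, j)) = R $$ (j, i)" using hermitian_entry[OF R herm, of j i] by simp
    then show "cnj (R $$ (i, j) * v $ j * cnj (v $ i)) = R $$ (j, i) * v $ i * cnj (v $ j)" by simp
  qed
  also have "\<dots> = (\<Sum>i<n. \<Sum>j<n. R $$ (i, j) * v $ j * cnj (v $ i))" by (rule sum.swap)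
  finally show ?thesis by (simp add: eq)
qed

lemma hermitian_eigenvalue_bound:
  assumes R: "R \<in> carrier_mat n n" and herm: "hermitian_mat R"
    and pos: "pos_semidef_mat (R - complex_of_real a \<cdot>\<^sub>m 1\<^sub>m n)" and k: "eigenvalue R k"
  shows "Im k = 0" and "a \<le> Re k"
proof -
  obtain v where v: "v \<in> carrier_vec n" "v \<noteq> 0\<^sub>v n" "R *\<^sub>v v = k \<cdot>\<^sub>v v"
    using k R by (auto simp: eigenvalue_def eigenvector_def)
  define N where "N = (\<Sum>i<n. (cmod (v $ i))\<^sup>2)"
  have vv: "v \<bullet>c v = of_real N" using cscalar_prod_self[OF v(1)] by (simp add: N_def)
  have N: "0 < N"
  proof -
    obtain i where i: "i < n" "v $ i \<noteq> 0" using v(1,2) by (metis carrier_vecD eq_vecI index_zero_vec)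
    then show ?thesis unfolding N_def by (intro sum_pos2[of _ i]) auto
  qed
  have Rv: "(R *\<^sub>v v) \<bullet>c v = k * of_real N" using v vv by simp
  have "cnj k * of_real N = k * of_real N"
    using hermitian_quadratic_form_real[OF R herm v(1)] by (simp add: Rv)
  then have "cnj k = k" using N by simp
  then show "Im k = 0" by (metis cnj.simps(2) equal_neg_zero)
  have "(R - complex_of_real a \<cdot>\<^sub>m 1\<^sub>m n) *\<^sub>v v = (k - of_real a) \<cdot>\<^sub>v v"
  proof -
    have "(R - complex_of_real a \<cdot>\<^sub>m 1\<^sub>m n) *\<^sub>v v = R *\<^sub>v v - (complex_of_real a \<cdot>\<^sub>m 1\<^sub>m n) *\<^sub>v v"
      using R v by (intro minus_mult_distrib_mat_vec) auto
    also have "(complex_of_real a \<cdot>\<^sub>m 1\<^sub>m n) *\<^sub>v v = complex_of_real a \<cdot>\<^sub>v v"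
      using v(1) by (intro eq_vecI) auto
    also have "R *\<^sub>v v - complex_of_real a \<cdot>\<^sub>v v = (k - of_real a) \<cdot>\<^sub>v v"
      unfolding v(3) using v(1) by (intro eq_vecI) (auto simp: left_diff_distrib)
    finally show ?thesis .
  qed
  then have "((R - complex_of_real a \<cdot>\<^sub>m 1\<^sub>m n) *\<^sub>v v) \<bullet>c v = (k - of_real a) * of_real N"
    using v vv by simp
  moreover have "0 \<le> Re (((R - complex_of_real a \<cdot>\<^sub>m 1\<^sub>m n) *\<^sub>v v) \<bullet>c v)"
    using pos v(1) R by (simp add: pos_semidef_mat_def)
  ultimately have "0 \<le> (Re k - a) * N" by simp
  then show "a \<le> Re k" using N by (simp add: zero_le_mult_iff)
qed

text \<open>This is all that the rest of the proof knows about \<open>R\<close>. The list \<open>e\<close> repeats each eigenvalue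
according to its multiplicity, so that the weights in the normalised traces are all equal.\<close>

lemma hermitian_spectral_data:
  assumes R: "R \<in> carrier_mat n n" and herm: "hermitian_mat R"
    and pos: "pos_semidef_mat (R - complex_of_real a \<cdot>\<^sub>m 1\<^sub>m n)"
  obtains e :: "nat \<Rightarrow> real" where "\<And>i. i < n \<Longrightarrow> a \<le> e i" "real_eigenvalues R = e ` {..<n}"
    "\<And>\<alpha> \<beta>. (\<And>i. i < n \<Longrightarrow> \<alpha> + \<beta> * of_real (e i) \<noteq> 0) \<Longrightarrow>
       mat_trace (R * mat_inv (\<alpha> \<cdot>\<^sub>m 1\<^sub>m n + \<beta> \<cdot>\<^sub>m R)) = (\<Sum>i<n. of_real (e i) / (\<alpha> + \<beta> * of_real (e i)))"
proof -
  obtain es where es: "char_poly R = (\<Prod>a\<leftarrow>es. [:- a, 1:])" "length es = n"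
    using char_poly_factorized[OF R] by blast
  obtain Tr P Q where dec: "schur_decomposition R es = (Tr, P, Q)" by (metis prod_cases3)
  have wit: "similar_mat_wit R Tr P Q" and ut: "upper_triangular Tr" and diag: "diag_mat Tr = es"
    using schur_decomposition[OF R es(1) dec] by auto
  have Tr: "Tr \<in> carrier_mat n n" using similar_mat_witD2[OF R wit] by simp
  have d: "Tr $$ (i, i) = es ! i" if "i < n" for i
    using diag[symmetric] that Tr by (simp add: diag_mat_def)
  have ev: "eigenvalue R k \<longleftrightarrow> k \<in> set es" for k
    by (simp add: eigenvalue_root_char_poly[OF R] es(1) poly_prod_list prod_list_zero_iff o_def image_iff)
  define e where "e i = Re (es ! i)" for i
  have e: "es ! i = of_real (e i)" if "i < n" for i
    using hermitian_eigenvalue_bound(1)[OF R herm pos, of "es ! i"] ev that es(2)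
    by (simp add: e_def complex_eq_iff)
  show thesis
  proof (rule that[of e])
    show "a \<le> e i" if "i < n" for i
      using hermitian_eigenvalue_bound(2)[OF R herm pos, of "es ! i"] ev that es(2) by (simp add: e_def)
    show "real_eigenvalues R = e ` {..<n}"
    proof (intro subset_antisym subsetI)
      fix x assume "x \<in> real_eigenvalues R"
      then obtain i where "i < n" "complex_of_real x = es ! i"
        using ev es(2) by (auto simp: real_eigenvalues_def in_set_conv_nth)
      then show "x \<in> e ` {..<n}" using e by auto
    next
      fix x assume "x \<in> e ` {..<n}"
      then obtain i where "i < n" "x = e i" by auto
      then have "complex_of_real x \<in> set es" using e[of i] es(2) by (metis nth_mem)
      then show "x \<in> real_eigenvalues R" using ev by (simp add: real_eigenvalues_def)
    qed
    show "mat_trace (R * mat_inv (\<alpha> \<cdot>\<^sub>m 1\<^sub>m n + \<beta> \<cdot>\<^sub>m R)) = (\<Sum>i<n. of_real (e i) / (\<alpha> + \<beta> * of_real (e i)))"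
      if nz: "\<And>i. i < n \<Longrightarrow> \<alpha> + \<beta> * of_real (e i) \<noteq> 0" for \<alpha> \<beta>
    proof -
      have "\<alpha> + \<beta> * Tr $$ (i, i) \<noteq> 0" if "i < n" for i using nz[OF that] d[OF that] e[OF that] by simp
      from mat_trace_resolvent[OF R wit ut this refl]
      have "mat_trace (R * mat_inv (\<alpha> \<cdot>\<^sub>m 1\<^sub>m n + \<beta> \<cdot>\<^sub>m R)) = (\<Sum>i<n. Tr $$ (i, i) / (\<alpha> + \<beta> * Tr $$ (i, i)))" .
      also have "\<dots> = (\<Sum>i<n. of_real (e i) / (\<alpha> + \<beta> * of_real (e i)))"
        using d e by (intro sum.cong) auto
      finally show ?thesis .
    qed
  qed
qed

section \<open>The function \<open>phi\<close> in terms of the eigenvalues, and its injectivity\<close>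

text \<open>The index \<open>i\<close> runs over eigenvalues with multiplicity, so that values of \<open>e\<close> may repeat. The
functions below are generic in the field, since real and complex arguments are both needed and the algebra is the
same.\<close>

locale positive_spectrum =
  fixes n :: nat and e :: "nat \<Rightarrow> real" and c :: real
  assumes n_pos: "0 < n" and e_pos: "i < n \<Longrightarrow> 0 < e i" and c_pos: "0 < c"
begin

definition poles :: "'a::real_normed_field set" where
  "poles = (\<lambda>i. of_real (e i)) ` {..<n}"

definition F :: "'a::real_normed_field \<Rightarrow> 'a" where
  "F w = (\<Sum>i<n. of_real (e i) / (of_real (e i) - w)) / of_nat n"

text \<open>If \<open>w = z c t - 1 / (c t)\<close> solves the canonical equation for \<open>t\<close>, then \<open>A w = - z
t\<close> and \<open>B w = - 1 / (c t)\<close>, and \<open>Phi w = z\<close>.\<close>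

definition A :: "'a::real_normed_field \<Rightarrow> 'a" where
  "A w = - (w * F w)"

definition B :: "'a::real_normed_field \<Rightarrow> 'a" where
  "B w = w + of_real c * A w"

definition Phi :: "'a::real_normed_field \<Rightarrow> 'a" where
  "Phi w = of_real c * A w * B w"

text \<open>\<open>S\<close> is minus the derivative of \<open>A\<close> at a real point and minus the ratio of the imaginary
parts of \<open>A w\<close> and \<open>w\<close> at a nonreal one; \<open>- T v w\<close> is the difference quotient
of \<open>A\<close>.\<close>

definition S :: "'a::real_normed_field \<Rightarrow> real" where
  "S w = (\<Sum>i<n. (e i)\<^sup>2 / (norm (of_real (e i) - w))\<^sup>2) / n"

definition T :: "'a::real_normed_field \<Rightarrow> 'a \<Rightarrow> 'a" where
  "T v w = (\<Sum>i<n. of_real ((e i)\<^sup>2) / ((of_real (e i) - v) * (of_real (e i) - w))) / of_nat n"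

text \<open>For real \<open>w\<close> with \<open>A w\<close> and \<open>B w\<close> positive, the inequality says that
\<open>Phi\<close> has positive derivative at \<open>w\<close>. Stated with norms it is an open condition that makes
sense in the complex plane.\<close>

definition Omega :: "'a::real_normed_field set" where
  "Omega = {w. w \<notin> poles \<and> S w * (norm (B w) + c * norm (A w)) < norm (A w)}"

lemma finite_poles [simp]: "finite poles"
  by (simp add: poles_def)

lemma poles_iff: "w \<in> poles \<longleftrightarrow> (\<exists>i<n. w = of_real (e i))"
  by (auto simp: poles_def)

lemma of_real_in_poles [simp]:
  "(of_real x :: 'a::real_normed_field) \<in> poles \<longleftrightarrow> x \<in> poles"
  by (simp add: poles_iff)

lemma Im_in_poles: "Im w \<noteq> 0 \<Longrightarrow> w \<notin> poles"
  by (auto simp: poles_iff)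

lemma F_of_real [simp]: "F (of_real x) = (of_real (F x) :: 'a::real_normed_field)"
  by (simp add: F_def)

lemma A_of_real [simp]: "A (of_real x) = (of_real (A x) :: 'a::real_normed_field)"
  by (simp add: A_def)

lemma B_of_real [simp]: "B (of_real x) = (of_real (B x) :: 'a::real_normed_field)"
  by (simp add: B_def)

lemma Phi_of_real [simp]: "Phi (of_real x) = (of_real (Phi x) :: 'a::real_normed_field)"
  by (simp add: Phi_def)

lemma S_of_real [simp]: "S (of_real x :: 'a::real_normed_field) = S x"
proof -
  have "norm (of_real (e i) - of_real x :: 'a) = norm (e i - x)" for i
    by (metis norm_of_real of_real_diff real_norm_def)
  then show ?thesis by (simp add: S_def)
qed

lemma A_diff:
  assumes "v \<notin> poles" "w \<notin> poles"
  shows "A w - A v = - ((w - v) * T v w)"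
proof -
  have "v * (of_real (e i) / (of_real (e i) - v)) - w * (of_real (e i) / (of_real (e i) - w))
      = - ((w - v) * (of_real ((e i)\<^sup>2) / ((of_real (e i) - v) * (of_real (e i) - w))))" if "i < n" for i
  proof -
    have "of_real (e i) - v \<noteq> 0" "of_real (e i) - w \<noteq> 0"
      using assms that by (auto simp: poles_iff)
    then show ?thesis
      by (simp add: divide_simps power2_eq_square) (simp add: algebra_simps)
  qed
  note summand = this
  have "A w - A v = (\<Sum>i<n. v * (of_real (e i) / (of_real (e i) - v)) - w * (of_real (e i) / (of_real (e i) - w))) / of_nat n"
    by (simp add: A_def F_def sum_subtractf sum_distrib_left diff_divide_distrib)
  also have "\<dots> = (\<Sum>i<n. - ((w - v) * (of_real ((e i)\<^sup>2) / ((of_real (e i) - v) * (of_real (e i) - w))))) / of_nat n"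
    by (rule arg_cong[where f = "\<lambda>x. x / of_nat n"], rule sum.cong) (use summand in auto)
  also have "\<dots> = - ((w - v) * T v w)"
    by (simp only: T_def sum_negf flip: sum_distrib_left) simp
  finally show ?thesis .
qed

text \<open>\<open>B\<close> is an affine function of \<open>w\<close> and \<open>A w\<close>, so the difference quotient of
\<open>Phi\<close> only involves the one of \<open>A\<close>. Both ways of splitting the difference of the products
are used below.\<close>

lemma Phi_diff:
  assumes "v \<notin> poles" "w \<notin> poles"
  shows "Phi w - Phi v = of_real c * (w - v) * (A w - T v w * (of_real c * A w + B v))"
proof -
  have *: "A w = A v - (w - v) * T v w" using A_diff[OF assms] by (simp add: algebra_simps)
  show ?thesis unfolding Phi_def B_def * by (simp add: algebra_simps)
qed

lemma Phi_diff':
  assumes "v \<notin> poles" "w \<notin> poles"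
  shows "Phi w - Phi v = of_real c * (w - v) * (A v - T v w * (of_real c * A v + B w))"
proof -
  have *: "A w = A v - (w - v) * T v w" using A_diff[OF assms] by (simp add: algebra_simps)
  show ?thesis unfolding Phi_def B_def * by (simp add: algebra_simps)
qed

lemma S_nonneg: "0 \<le> S w"
  by (simp add: S_def sum_nonneg)

lemma S_pos: "w \<notin> poles \<Longrightarrow> 0 < S w"
proof -
  assume w: "w \<notin> poles"
  have "0 < (\<Sum>i<n. (e i)\<^sup>2 / (norm (of_real (e i) - w))\<^sup>2)"
  proof (rule sum_pos)
    show "0 < (e i)\<^sup>2 / (norm (of_real (e i) - w))\<^sup>2" if "i \<in> {..<n}" for i
      using w e_pos[of i] that by (auto simp: poles_iff)
  qed (use n_pos in auto)
  then show ?thesis using n_pos by (simp add: S_def)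
qed

lemma norm_T_le: "(norm (T v w))\<^sup>2 \<le> S v * S w"
proof -
  define a where "a v i = e i / norm (of_real (e i) - v)" for v :: 'a and i
  have "norm (T v w) \<le> (\<Sum>i<n. a v i * a w i) / n"
  proof -
    have "norm (\<Sum>i<n. of_real ((e i)\<^sup>2) / ((of_real (e i) - v) * (of_real (e i) - w)))
       \<le> (\<Sum>i<n. norm (of_real ((e i)\<^sup>2) / ((of_real (e i) - v) * (of_real (e i) - w))))"
      by (rule norm_sum)
    also have "\<dots> = (\<Sum>i<n. a v i * a w i)"
      by (intro sum.cong refl) (simp add: a_def norm_divide norm_mult power2_eq_square)
    finally show ?thesis
      using n_pos by (simp add: T_def norm_divide divide_right_mono)
  qed
  then have "(norm (T v w))\<^sup>2 \<le> ((\<Sum>i<n. a v i * a w i) / n)\<^sup>2"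
    by (intro power_mono) auto
  also have "\<dots> = (\<Sum>i<n. a v i * a w i)\<^sup>2 / (real n)\<^sup>2"
    by (simp add: power_divide)
  also have "\<dots> \<le> ((\<Sum>i<n. (a v i)\<^sup>2) * (\<Sum>i<n. (a w i)\<^sup>2)) / (real n)\<^sup>2"
    by (intro divide_right_mono Cauchy_Schwarz_ineq_sum) auto
  also have "\<dots> = S v * S w"
    by (simp add: S_def a_def power_divide power2_eq_square)
  finally show ?thesis .
qed

text \<open>If \<open>Phi v = Phi w\<close> with \<open>v \<noteq> w\<close>, the two difference formulas express \<open>A
v\<close> and \<open>A w\<close> through \<open>T v w\<close>. Multiplying the resulting bounds and using
\<open>\<bar>T\<bar>\<^sup>2 \<le> S v S w\<close> almost contradicts the product of the two inequalities that define
\<open>Omega\<close>. The mixed terms are in the right order because \<open>\<bar>A\<bar> \<bar>B\<bar>\<close> has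
the same value at both points, so that \<open>\<bar>A\<bar>\<close> and \<open>\<bar>B\<bar>\<close> are ordered
oppositely.\<close>

lemma Phi_inj_on_Omega: "inj_on Phi Omega"
proof (rule inj_onI, rule ccontr)
  fix v w :: 'a
  assume v: "v \<in> Omega" and w: "w \<in> Omega" and eq: "Phi v = Phi w" and ne: "v \<noteq> w"
  have sp: "v \<notin> poles" "w \<notin> poles" using v w by (auto simp: Omega_def)
  define a b where "a = norm (A v)" and "b = norm (B v)"
  define a' b' where "a' = norm (A w)" and "b' = norm (B w)"
  define \<tau> where "\<tau> = norm (T v w)"
  have nn: "0 \<le> a" "0 \<le> b" "0 \<le> a'" "0 \<le> b'" "0 \<le> \<tau>"
    by (auto simp: a_def b_def a'_def b'_def \<tau>_def)
  have v': "S v * (b + c * a) < a" and w': "S w * (b' + c * a') < a'"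
    using v w by (auto simp: Omega_def a_def b_def a'_def b'_def)
  have q: "0 \<le> b + c * a" "0 \<le> b' + c * a'" using nn c_pos by auto
  have ap: "0 < a" using v' q S_nonneg[of v] by (meson le_less_trans mult_nonneg_nonneg)
  have ap': "0 < a'" using w' q S_nonneg[of w] by (meson le_less_trans mult_nonneg_nonneg)
  have "A w = T v w * (of_real c * A w + B v)"
    using Phi_diff[OF sp] eq ne c_pos by simp
  then have "a' = \<tau> * norm (of_real c * A w + B v)"
    unfolding a'_def \<tau>_def by (metis norm_mult)
  also have "\<dots> \<le> \<tau> * (c * a' + b)"
    unfolding a'_def b_def using c_pos nn
    by (intro mult_left_mono order_trans[OF norm_triangle_ineq]) (auto simp: norm_mult)
  finally have 1: "a' \<le> \<tau> * (c * a' + b)" .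
  have "A v = T v w * (of_real c * A v + B w)"
    using Phi_diff'[OF sp] eq ne c_pos by simp
  then have "a = \<tau> * norm (of_real c * A v + B w)"
    unfolding a_def \<tau>_def by (metis norm_mult)
  also have "\<dots> \<le> \<tau> * (c * a + b')"
    unfolding a_def b'_def using c_pos nn
    by (intro mult_left_mono order_trans[OF norm_triangle_ineq]) (auto simp: norm_mult)
  finally have 2: "a \<le> \<tau> * (c * a + b')" .
  have "norm (Phi v) = norm (Phi w)" using eq by simp
  then have ab: "a * b = a' * b'" using c_pos
    by (simp add: Phi_def norm_mult a_def b_def a'_def b'_def)
  have cross: "(c * a' + b) * (c * a + b') \<le> (b + c * a) * (b' + c * a')"
  proof -
    have "(a' - a) * (b' - b) \<le> 0"
    proof (cases "a \<le> a'")
      case True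
      then have "a * b' \<le> a * b" using ab nn by (simp add: mult_right_mono)
      then have "b' \<le> b" using ap by simp
      with True show ?thesis by (simp add: mult_nonneg_nonpos)
    next
      case False
      then have "a' * b \<le> a' * b'" using ab nn
        by (metis linear mult_right_mono)
      then have "b \<le> b'" using ap' by simp
      with False show ?thesis by (simp add: mult_nonpos_nonneg)
    qed
    then have "c * ((a' - a) * (b' - b)) \<le> 0" using c_pos by (simp add: mult_nonneg_nonpos)
    then show ?thesis by (simp add: algebra_simps)
  qed
  have "a * a' \<le> \<tau>\<^sup>2 * ((c * a' + b) * (c * a + b'))"
    using mult_mono[OF 2 1] nn c_pos by (simp add: power2_eq_square mult_ac)
  also have "\<dots> \<le> (S v * S w) * ((b + c * a) * (b' + c * a'))"
    using norm_T_le[of v w] cross nn c_pos S_nonneg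
    by (intro mult_mono[OF _ cross] mult_nonneg_nonneg add_nonneg_nonneg) (auto simp: \<tau>_def)
  also have "\<dots> = (S v * (b + c * a)) * (S w * (b' + c * a'))" by simp
  also have "\<dots> < a * a'"
    using v' w' q S_nonneg ap ap' by (intro mult_strict_mono mult_nonneg_nonneg) auto
  finally show False by simp
qed

text \<open>The same argument as for injectivity, with inequalities: now the mixed terms are in the right order since \<open>0 < c
T v w < 1\<close> forces \<open>A\<close> to decrease and \<open>B\<close> to increase from \<open>v\<close> to
\<open>w\<close>. Only the two end points are compared, so they may lie in different components of the region where
\<open>A\<close> and \<open>B\<close> are positive.\<close>

lemma Phi_strict_mono_on_increasing:
  fixes v w :: real
  assumes vw: "v < w" and sp: "v \<notin> poles" "w \<notin> poles"
    and pos: "0 < A v" "0 < B v" "0 < A w" "0 < B w"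
    and hv: "S v * (B v + c * A v) \<le> A v" and hw: "S w * (B w + c * A w) \<le> A w"
  shows "Phi v < Phi w"
proof (rule ccontr)
  assume "\<not> Phi v < Phi w"
  then have le: "Phi w - Phi v \<le> 0" by simp
  have cw: "0 < c * (w - v)" using c_pos vw by simp
  define \<tau> where "\<tau> = T v w"
  have 1: "A w \<le> \<tau> * (c * A w + B v)"
  proof -
    have "c * (w - v) * (A w - T v w * (c * A w + B v)) \<le> 0"
      using le Phi_diff[OF sp] by simp
    then have "A w - T v w * (c * A w + B v) \<le> 0"
      using cw by (meson linorder_not_less mult_pos_pos)
    then show ?thesis by (simp add: \<tau>_def)
  qed
  have 2: "A v \<le> \<tau> * (c * A v + B w)"
  proof -
    have "c * (w - v) * (A v - T v w * (c * A v + B w)) \<le> 0"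
      using le Phi_diff'[OF sp] by simp
    then have "A v - T v w * (c * A v + B w) \<le> 0"
      using cw by (meson linorder_not_less mult_pos_pos)
    then show ?thesis by (simp add: \<tau>_def)
  qed
  have cA: "0 < c * A v" "0 < c * A w" using pos c_pos by auto
  have \<tau>: "0 < \<tau>"
  proof (rule ccontr)
    assume "\<not> 0 < \<tau>"
    then have "\<tau> * (c * A w + B v) \<le> 0" using cA pos by (simp add: mult_nonpos_nonneg)
    then show False using 1 pos by simp
  qed
  have lt1: "c * S v < 1"
  proof -
    have "S v * (c * A v) < S v * (B v + c * A v)" using S_pos[OF sp(1)] pos by simp
    then have "(c * S v) * A v < 1 * A v" using hv by (simp add: mult_ac)
    then show ?thesis using pos by simp
  qed
  have lt2: "c * S w < 1"
  proof -
    have "S w * (c * A w) < S w * (B w + c * A w)" using S_pos[OF sp(2)] pos by simp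
    then have "(c * S w) * A w < 1 * A w" using hw by (simp add: mult_ac)
    then show ?thesis using pos by simp
  qed
  have \<tau>2: "\<tau>\<^sup>2 \<le> S v * S w" using norm_T_le[of v w] by (simp add: \<tau>_def)
  have c\<tau>: "c * \<tau> < 1"
  proof -
    have "(c * \<tau>)\<^sup>2 \<le> (c * S v) * (c * S w)"
      using mult_left_mono[OF \<tau>2, of "c\<^sup>2"] by (simp add: power2_eq_square mult_ac)
    also have "\<dots> < 1 * 1"
      using lt1 lt2 S_nonneg c_pos by (intro mult_strict_mono mult_nonneg_nonneg) auto
    finally show ?thesis by (simp add: power2_eq_square abs_square_less_1 flip: power2_eq_square)
  qed
  have dA: "A w - A v = - ((w - v) * \<tau>)" using A_diff[OF sp] by (simp add: \<tau>_def)
  have dB: "B w - B v = (w - v) * (1 - c * \<tau>)"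
  proof -
    have Aw: "A w = A v - (w - v) * \<tau>" using dA by simp
    show ?thesis unfolding B_def Aw by (simp add: algebra_simps)
  qed
  have cross: "(c * A w + B v) * (c * A v + B w) < (B v + c * A v) * (B w + c * A w)"
  proof -
    have "c * ((A w - A v) * (B w - B v)) < 0"
      unfolding dA dB using c_pos vw \<tau> c\<tau> by (simp add: mult_pos_pos)
    then show ?thesis by (simp add: algebra_simps)
  qed
  have "A v * A w \<le> \<tau>\<^sup>2 * ((c * A w + B v) * (c * A v + B w))"
    using mult_mono[OF 2 1] pos cA \<tau> by (simp add: power2_eq_square mult_ac)
  also have "\<dots> < \<tau>\<^sup>2 * ((B v + c * A v) * (B w + c * A w))"
    using cross \<tau> by simp
  also have "\<dots> \<le> (S v * S w) * ((B v + c * A v) * (B w + c * A w))"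
    using \<tau>2 pos cA by (intro mult_right_mono) auto
  also have "\<dots> = (S v * (B v + c * A v)) * (S w * (B w + c * A w))" by simp
  also have "\<dots> \<le> A v * A w"
    using hv hw pos cA S_nonneg c_pos by (intro mult_mono mult_nonneg_nonneg add_nonneg_nonneg) auto
  finally show False by simp
qed

end

section \<open>Critical points on the real line\<close>

context positive_spectrum begin

definition moment :: "nat \<Rightarrow> real \<Rightarrow> real" where
  "moment j w = (\<Sum>i<n. (e i)\<^sup>2 / (e i - w) ^ j) / n"

text \<open>\<open>c h\<close> is the derivative of \<open>Phi\<close>.\<close>

definition h :: "real \<Rightarrow> real" where
  "h w = A w - S w * (B w + c * A w)"

text \<open>Increasing branches of \<open>Phi\<close> outside \<open>D\<close> do exist, for instance immediately to the left of
an eigenvalue; they do not come from solutions of the canonical equation.\<close>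

definition D :: "real set" where
  "D = {w. w \<notin> poles \<and> 0 < A w \<and> 0 < B w}"

lemma S_eq_moment: "S w = moment 2 w"
  by (simp add: S_def moment_def)

lemma D_Omega_iff: "w \<in> D \<Longrightarrow> w \<in> Omega \<longleftrightarrow> 0 < h w"
  by (simp add: D_def Omega_def h_def)

lemma DERIV_moment:
  assumes "w \<notin> poles"
  shows "(moment j has_real_derivative real j * moment (Suc j) w) (at w)"
proof -
  have ne: "e i - w \<noteq> 0" if "i < n" for i
    using assms that by (auto simp: poles_iff)
  have "((\<lambda>w. (e i)\<^sup>2 / (e i - w) ^ j) has_real_derivative real j * ((e i)\<^sup>2 / (e i - w) ^ Suc j)) (at w)"
    if "i < n" for i
  proof (cases j)
    case 0
    then show ?thesis by simp
  next
    case (Suc k)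
    define x where "x = e i - w"
    have x: "x \<noteq> 0" using ne[OF that] by (simp add: x_def)
    have "((\<lambda>w. e i - w) has_real_derivative 0 - 1) (at w)"
      by (intro DERIV_diff DERIV_const DERIV_ident)
    from DERIV_power[OF this, of j]
    have "((\<lambda>w. (e i - w) ^ j) has_real_derivative - (real (Suc k) * x ^ k)) (at w)"
      by (simp add: Suc x_def)
    from DERIV_divide[OF DERIV_const[of "(e i)\<^sup>2"] this] x
    have "((\<lambda>w. (e i)\<^sup>2 / (e i - w) ^ j) has_real_derivative
       (0 * x ^ j - (e i)\<^sup>2 * - (real (Suc k) * x ^ k)) / (x ^ j * x ^ j)) (at w)"
      by (simp add: x_def)
    moreover have "(0 * x ^ j - (e i)\<^sup>2 * - (real (Suc k) * x ^ k)) / (x ^ j * x ^ j)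
       = real j * ((e i)\<^sup>2 / x ^ Suc j)"
      using x by (simp add: Suc field_simps)
    ultimately show ?thesis by (simp add: x_def)
  qed
  then have "((\<lambda>w. \<Sum>i<n. (e i)\<^sup>2 / (e i - w) ^ j) has_real_derivative
      (\<Sum>i<n. real j * ((e i)\<^sup>2 / (e i - w) ^ Suc j))) (at w)"
    by (intro DERIV_sum) auto
  from DERIV_cdivide[OF this, of "real n"] show ?thesis
    unfolding moment_def by (simp add: sum_distrib_left)
qed

lemma DERIV_S:
  fixes w :: real
  assumes "w \<notin> poles"
  shows "(S has_real_derivative 2 * moment 3 w) (at w)"
  using DERIV_moment[OF assms, of 2]
  by (simp add: S_eq_moment[abs_def] eval_nat_numeral)

lemma DERIV_A:
  fixes w :: real
  assumes "w \<notin> poles"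
  shows "(A has_real_derivative - S w) (at w)"
proof -
  have ne: "e i - w \<noteq> 0" if "i < n" for i
    using assms that by (auto simp: poles_iff)
  have "((\<lambda>w. w * (e i / (e i - w))) has_real_derivative (e i)\<^sup>2 / (e i - w)\<^sup>2) (at w)" if "i < n" for i
  proof -
    have "((\<lambda>w. w * (e i / (e i - w))) has_real_derivative
        1 * (e i / (e i - w)) + ((0 * (e i - w) - e i * (0 - 1)) / ((e i - w) * (e i - w))) * w) (at w)"
      by (intro DERIV_mult DERIV_divide DERIV_ident DERIV_const DERIV_diff ne that)
    moreover have "1 * (e i / (e i - w)) + ((0 * (e i - w) - e i * (0 - 1)) / ((e i - w) * (e i - w))) * w
        = (e i)\<^sup>2 / (e i - w)\<^sup>2"
    proof -
      define x where "x = e i - w"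
      have w: "w = e i - x" and "x \<noteq> 0" using ne[OF that] by (auto simp: x_def)
      then show ?thesis
        unfolding x_def[symmetric] by (simp add: w divide_simps power2_eq_square) (simp add: algebra_simps)
    qed
    ultimately show ?thesis by simp
  qed
  then have "((\<lambda>w. \<Sum>i<n. w * (e i / (e i - w))) has_real_derivative
      (\<Sum>i<n. (e i)\<^sup>2 / (e i - w)\<^sup>2)) (at w)"
    by (intro DERIV_sum) auto
  from DERIV_minus[OF DERIV_cdivide[OF this, of "real n"]] show ?thesis
    by (simp add: A_def[abs_def] F_def S_def sum_distrib_left)
qed

lemma DERIV_B:
  fixes w :: real
  assumes "w \<notin> poles"
  shows "(B has_real_derivative 1 - c * S w) (at w)"
proof -
  have "((\<lambda>w. w + c * A w) has_real_derivative 1 + c * - S w) (at w)"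
    by (intro DERIV_add DERIV_ident DERIV_cmult DERIV_A assms)
  then show ?thesis by (simp add: B_def[abs_def])
qed

lemma DERIV_Phi:
  fixes w :: real
  assumes "w \<notin> poles"
  shows "(Phi has_real_derivative c * h w) (at w)"
proof -
  have "((\<lambda>w. (c * A w) * B w) has_real_derivative (c * - S w) * B w + (1 - c * S w) * (c * A w)) (at w)"
    by (rule DERIV_mult) (intro DERIV_A DERIV_B DERIV_cmult assms)+
  moreover have "(c * - S w) * B w + (1 - c * S w) * (c * A w) = c * h w"
    by (simp add: h_def algebra_simps)
  ultimately show ?thesis by (simp add: Phi_def[abs_def])
qed

text \<open>The derivative of \<open>h\<close>; the factor \<open>B w + c * A w\<close> equals \<open>w + 2 c A w\<close> and has
derivative \<open>1 - 2 c S w\<close>.\<close>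

definition h' :: "real \<Rightarrow> real" where
  "h' w = - 2 * S w - 2 * moment 3 w * (B w + c * A w) + 2 * c * (S w)\<^sup>2"

lemma DERIV_h:
  assumes w: "w \<notin> poles"
  shows "(h has_real_derivative h' w) (at w)"
proof -
  have "((\<lambda>w. A w - S w * (B w + c * A w)) has_real_derivative
     - S w - (2 * moment 3 w * (B w + c * A w) + ((1 - c * S w) + c * - S w) * S w)) (at w)"
    by (intro DERIV_diff DERIV_mult DERIV_add DERIV_A DERIV_B DERIV_S DERIV_cmult w)
  moreover have "- S w - (2 * moment 3 w * (B w + c * A w) + ((1 - c * S w) + c * - S w) * S w) = h' w"
    by (simp add: h'_def algebra_simps power2_eq_square)
  ultimately show ?thesis by (simp add: h_def[abs_def])
qed

lemma DERIV_h':
  assumes w: "w \<notin> poles"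
  shows "(h' has_real_derivative
     - 6 * moment 3 w - 6 * moment 4 w * (B w + c * A w) + 12 * c * S w * moment 3 w) (at w)"
proof -
  have m: "(moment 3 has_real_derivative 3 * moment 4 w) (at w)"
    using DERIV_moment[OF w, of 3] by (simp add: eval_nat_numeral)
  have "((\<lambda>w. (- 2) * S w - (2 * moment 3 w) * (B w + c * A w) + (2 * c) * (S w)\<^sup>2) has_real_derivative
     (- 2) * (2 * moment 3 w) - ((2 * (3 * moment 4 w)) * (B w + c * A w)
        + ((1 - c * S w) + c * - S w) * (2 * moment 3 w))
      + (2 * c) * (real 2 * (2 * moment 3 w * S w ^ (2 - Suc 0)))) (at w)"
    by (intro DERIV_diff DERIV_mult DERIV_add DERIV_A DERIV_B DERIV_S DERIV_cmult DERIV_power w m)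
  then show ?thesis by (simp add: h'_def[abs_def] algebra_simps)
qed

lemma moment_Cauchy_Schwarz: "(moment 3 w)\<^sup>2 \<le> S w * moment 4 w"
proof -
  have "(\<Sum>i<n. (e i / (e i - w)) * (e i / (e i - w)\<^sup>2))\<^sup>2
     \<le> (\<Sum>i<n. (e i / (e i - w))\<^sup>2) * (\<Sum>i<n. (e i / (e i - w)\<^sup>2)\<^sup>2)"
    by (rule Cauchy_Schwarz_ineq_sum)
  then have "(\<Sum>i<n. (e i)\<^sup>2 / (e i - w) ^ 3)\<^sup>2
     \<le> (\<Sum>i<n. (e i)\<^sup>2 / (e i - w)\<^sup>2) * (\<Sum>i<n. (e i)\<^sup>2 / (e i - w) ^ 4)"
    by (simp add: power2_eq_square eval_nat_numeral mult_ac)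
  from divide_right_mono[OF this, of "(real n)\<^sup>2"] show ?thesis
    by (simp add: S_eq_moment moment_def power_divide power2_eq_square)
qed

text \<open>The left-hand side is the second derivative of \<open>h\<close>. So at a point of \<open>D\<close> where the first two
derivatives of \<open>Phi\<close> vanish, the third one is negative: a degenerate critical point is an inflection
point of a decreasing branch and never interrupts an increasing one. The vanishing of \<open>h\<close> and
\<open>h'\<close> determines \<open>A\<close> and the third moment, and Cauchy-Schwarz bounds the fourth moment.\<close>

lemma degenerate_critical_point:
  assumes w: "w \<in> D" and h0: "h w = 0" and h1: "h' w = 0"
  shows "- 6 * moment 3 w - 6 * moment 4 w * (B w + c * A w) + 12 * c * S w * moment 3 w < 0"
proof -
  define G where "G = B w + c * A w"
  define s r q where "s = S w" and "r = moment 3 w" and "q = moment 4 w"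
  have pos: "0 < A w" "0 < B w" "0 < G" and s: "0 < s"
    using w c_pos S_pos[of w] by (auto simp: D_def G_def s_def add_pos_pos)
  have AsG: "A w = s * G" using h0 by (simp add: h_def G_def s_def)
  have rG: "r * G = s * (c * s - 1)"
    using h1 by (simp add: h'_def G_def s_def r_def algebra_simps power2_eq_square)
  have "c * s < 1"
  proof -
    have "c * A w < G" using pos by (simp add: G_def)
    then have "s * (c * A w) < A w" using s AsG by simp
    then have "(c * s) * A w < 1 * A w" by (simp add: mult_ac)
    then show ?thesis using pos by simp
  qed
  then have "r * G < 0" using rG s by (simp add: mult_pos_neg)
  then have r: "r < 0" using pos by (simp add: mult_less_0_iff)
  have "r\<^sup>2 \<le> s * q" using moment_Cauchy_Schwarz[of w] by (simp add: r_def s_def q_def)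
  then have "r\<^sup>2 * G \<le> s * q * G" using pos by simp
  then have "s * (r * (c * s - 1)) \<le> s * (q * G)"
  proof -
    have "s * (r * (c * s - 1)) = r * (r * G)" unfolding rG by simp
    also have "\<dots> = r\<^sup>2 * G" by (simp add: power2_eq_square)
    also have "\<dots> \<le> s * (q * G)" using \<open>r\<^sup>2 * G \<le> s * q * G\<close> by (simp add: mult.assoc)
    finally show ?thesis .
  qed
  then have "r * (c * s - 1) \<le> q * G" using s by simp
  moreover have "c * s * r < 0" using r s c_pos by (simp add: mult_pos_neg)
  ultimately show ?thesis
    unfolding G_def[symmetric] s_def[symmetric] r_def[symmetric] q_def[symmetric]
    by (simp add: algebra_simps)
qed

lemma continuous_on_Phi: "I \<inter> poles = {} \<Longrightarrow> continuous_on I (Phi :: real \<Rightarrow> real)"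
  by (rule continuous_at_imp_continuous_on) (auto intro!: DERIV_isCont DERIV_Phi)

lemma continuous_on_h: "I \<inter> poles = {} \<Longrightarrow> continuous_on I h"
  by (rule continuous_at_imp_continuous_on) (auto intro!: DERIV_isCont DERIV_h)

text \<open>If \<open>Phi\<close> decreased somewhere in between, a maximum to the left of that point and a minimum to the right
of it would be points with \<open>h \<ge> 0\<close> whose values are in the wrong order.\<close>

lemma h_nonneg_between:
  assumes sub: "{v..w} \<subseteq> D" and x: "v < x" "x < w" and hv: "0 \<le> h v" and hw: "0 \<le> h w"
  shows "0 \<le> h x"
proof (rule ccontr)
  assume "\<not> 0 \<le> h x"
  then have neg: "c * h x < 0" using c_pos by (simp add: mult_pos_neg)
  have np: "y \<notin> poles" if "v \<le> y" "y \<le> w" for y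
    using sub that by (auto simp: D_def)
  have cont: "continuous_on {a..b} (Phi :: real \<Rightarrow> real)" if "v \<le> a" "b \<le> w" for a b
    using np that by (intro continuous_on_Phi) fastforce
  have dx: "(Phi has_real_derivative c * h x) (at x)" using np x by (intro DERIV_Phi) auto
  obtain m where m: "v \<le> m" "m \<le> x" and mmax: "\<And>y. v \<le> y \<Longrightarrow> y \<le> x \<Longrightarrow> Phi y \<le> Phi m"
    using continuous_attains_sup[of "{v..x}" Phi] cont[of v x] x by fastforce
  have mx: "m \<noteq> x"
  proof
    assume "m = x"
    obtain d where d: "d > 0" "\<And>k. 0 < k \<Longrightarrow> k < d \<Longrightarrow> Phi x < Phi (x - k)"
      using DERIV_neg_dec_left[OF dx neg] by blast
    have "Phi x < Phi (x - min (d / 2) (x - v))"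
      using d x by (intro d(2)) auto
    moreover have "Phi (x - min (d / 2) (x - v)) \<le> Phi m"
      using d x by (intro mmax) auto
    ultimately show False using \<open>m = x\<close> by simp
  qed
  have hm: "0 \<le> h m"
  proof (cases "m = v")
    case False
    have "c * h m = 0"
    proof (rule DERIV_local_max[OF DERIV_Phi[of m], of "min (m - v) (x - m)"])
      show "\<forall>y. \<bar>m - y\<bar> < min (m - v) (x - m) \<longrightarrow> Phi y \<le> Phi m"
        using mmax by (auto simp: abs_if split: if_splits)
    qed (use m mx False np x in auto)
    then show ?thesis using c_pos by simp
  qed (use hv in simp)
  obtain p where p: "x \<le> p" "p \<le> w" and pmin: "\<And>y. x \<le> y \<Longrightarrow> y \<le> w \<Longrightarrow> Phi p \<le> Phi y"
    using continuous_attains_inf[of "{x..w}" Phi] cont[of x w] x by fastforce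
  have px: "p \<noteq> x"
  proof
    assume "p = x"
    obtain d where d: "d > 0" "\<And>k. 0 < k \<Longrightarrow> k < d \<Longrightarrow> Phi x > Phi (x + k)"
      using DERIV_neg_dec_right[OF dx neg] by blast
    have "Phi x > Phi (x + min (d / 2) (w - x))"
      using d x by (intro d(2)) auto
    moreover have "Phi (x + min (d / 2) (w - x)) \<ge> Phi p"
      using d x by (intro pmin) auto
    ultimately show False using \<open>p = x\<close> by simp
  qed
  have hp: "0 \<le> h p"
  proof (cases "p = w")
    case False
    have "c * h p = 0"
    proof (rule DERIV_local_min[OF DERIV_Phi[of p], of "min (p - x) (w - p)"])
      show "\<forall>y. \<bar>p - y\<bar> < min (p - x) (w - p) \<longrightarrow> Phi p \<le> Phi y"
        using pmin by (auto simp: abs_if split: if_splits)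
    qed (use p px False np x in auto)
    then show ?thesis using c_pos by simp
  qed (use hw in simp)
  have "m \<in> D" "p \<in> D" using sub m p x by auto
  then have "Phi m < Phi p"
    using hm hp m p mx px x by (intro Phi_strict_mono_on_increasing) (auto simp: D_def h_def)
  moreover have "Phi x \<le> Phi m" using x by (intro mmax) auto
  moreover have "Phi p \<le> Phi x" using x by (intro pmin) auto
  ultimately show False by simp
qed

text \<open>An interior zero of \<open>h\<close> would be a minimum of \<open>h\<close>, which is excluded at a degenerate
critical point.\<close>

lemma h_pos_between:
  assumes sub: "{v..w} \<subseteq> D" and x: "v < x" "x < w" and hv: "0 \<le> h v" and hw: "0 \<le> h w"
  shows "0 < h x"
proof (rule ccontr)
  have nonneg: "0 \<le> h y" if "v \<le> y" "y \<le> w" for y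
    using h_nonneg_between[OF sub _ _ hv hw, of y] hv hw that by (cases "y = v \<or> y = w") auto
  assume "\<not> 0 < h x"
  then have h0: "h x = 0" using nonneg[of x] x by simp
  have np: "y \<notin> poles" if "v \<le> y" "y \<le> w" for y
    using sub that by (auto simp: D_def)
  have h1: "h' x = 0"
  proof (rule DERIV_local_min[OF DERIV_h[of x], of "min (x - v) (w - x)"])
    show "\<forall>y. \<bar>x - y\<bar> < min (x - v) (w - x) \<longrightarrow> h x \<le> h y"
      using nonneg h0 by (auto simp: abs_if split: if_splits)
  qed (use x np in auto)
  have "x \<in> D" using sub x by auto
  then obtain d where d: "d > 0" "\<And>k. 0 < k \<Longrightarrow> k < d \<Longrightarrow> h' (x + k) < h' x"
    using DERIV_neg_dec_right[OF DERIV_h' degenerate_critical_point[OF _ h0 h1]] np[of x] x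
    by (auto simp: D_def)
  define y where "y = x + min (d / 2) (w - x)"
  have y: "x < y" "y \<le> w" using d x by (auto simp: y_def)
  obtain z where z: "x < z" "z < y" "h y - h x = (y - x) * h' z"
    using MVT2[of x y h h'] y DERIV_h np x by (smt (verit))
  have "h' z < 0" using d(2)[of "z - x"] z h1 by (auto simp: y_def)
  then have "h y < 0" using z h0 y by (simp add: mult_pos_neg)
  then show False using nonneg[of y] y x by simp
qed

text \<open>In a component of \<open>D\<close> the sign of \<open>h\<close> changes from negative to positive at most once, and it
is strict on both sides of the change. The next lemma is the mirror image.\<close>

lemma h_root_entering:
  assumes sub: "{m..p} \<subseteq> D" and mp: "m < p" and hm: "h m < 0" and hp: "0 < h p"
  obtains \<alpha> where "m < \<alpha>" "\<alpha> < p" "h \<alpha> = 0"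
    "\<And>w. w < \<alpha> \<Longrightarrow> {w..p} \<subseteq> D \<Longrightarrow> h w < 0" "\<And>w. \<alpha> < w \<Longrightarrow> w \<le> p \<Longrightarrow> 0 < h w"
proof -
  have "continuous_on {m..p} h" using sub by (intro continuous_on_h) (auto simp: D_def)
  then obtain \<alpha> where \<alpha>: "m \<le> \<alpha>" "\<alpha> \<le> p" "h \<alpha> = 0"
    using IVT'[of h m 0 p] hm hp mp by auto
  then have \<alpha>': "m < \<alpha>" "\<alpha> < p" using hm hp by (auto simp: less_le)
  show thesis
  proof
    show "h w < 0" if "w < \<alpha>" "{w..p} \<subseteq> D" for w
      using h_pos_between[OF that(2), of \<alpha>] that \<alpha> \<alpha>' hp by force
    show "0 < h w" if "\<alpha> < w" "w \<le> p" for w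
    proof (cases "w = p")
      case False
      have "{\<alpha>..p} \<subseteq> D" using \<alpha> by (intro subset_trans[OF _ sub]) simp
      then show ?thesis using h_pos_between[of \<alpha> p w] that \<alpha> \<alpha>' hp False by simp
    qed (use hp in simp)
  qed (use \<alpha> \<alpha>' in auto)
qed

lemma h_root_leaving:
  assumes sub: "{p..m} \<subseteq> D" and pm: "p < m" and hm: "h m < 0" and hp: "0 < h p"
  obtains \<beta> where "p < \<beta>" "\<beta> < m" "h \<beta> = 0"
    "\<And>w. \<beta> < w \<Longrightarrow> {p..w} \<subseteq> D \<Longrightarrow> h w < 0" "\<And>w. p \<le> w \<Longrightarrow> w < \<beta> \<Longrightarrow> 0 < h w"
proof -
  have "continuous_on {p..m} h" using sub by (intro continuous_on_h) (auto simp: D_def)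
  then obtain \<beta> where \<beta>: "p \<le> \<beta>" "\<beta> \<le> m" "h \<beta> = 0"
    using IVT2'[of h m 0 p] hm hp pm by auto
  then have \<beta>': "p < \<beta>" "\<beta> < m" using hm hp by (auto simp: less_le)
  show thesis
  proof
    show "h w < 0" if "\<beta> < w" "{p..w} \<subseteq> D" for w
      using h_pos_between[OF that(2), of \<beta>] that \<beta> \<beta>' hp by force
    show "0 < h w" if "p \<le> w" "w < \<beta>" for w
    proof (cases "w = p")
      case False
      have "{p..\<beta>} \<subseteq> D" using \<beta> by (intro subset_trans[OF _ sub]) simp
      then show ?thesis using h_pos_between[of p \<beta> w] that \<beta> \<beta>' hp False by simp
    qed (use hp in simp)
  qed (use \<beta> \<beta>' in auto)
qed

lemma Phi_MVT:
  fixes v w :: real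
  assumes "v < w" and "{v..w} \<inter> poles = {}"
  obtains x where "v < x" "x < w" "Phi w - Phi v = (w - v) * (c * h x)"
proof -
  have "(Phi has_real_derivative c * h x) (at x)" if "v \<le> x" "x \<le> w" for x
    using assms that by (intro DERIV_Phi) auto
  from MVT2[OF assms(1) this] that show thesis by blast
qed

lemma ex_h_pos:
  fixes v w :: real
  assumes "v < w" and "{v..w} \<inter> poles = {}" and "Phi v < Phi w"
  obtains x where "v < x" "x < w" "0 < h x"
proof -
  obtain x where x: "v < x" "x < w" "Phi w - Phi v = (w - v) * (c * h x)"
    using Phi_MVT assms by blast
  then have "0 < (w - v) * (c * h x)" using assms by simp
  then have "0 < h x" using assms c_pos by (simp add: zero_less_mult_iff)
  with x that show thesis by blast
qed

lemma ex_h_neg: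
  fixes v w :: real
  assumes "v < w" and "{v..w} \<inter> poles = {}" and "Phi w < Phi v"
  obtains x where "v < x" "x < w" "h x < 0"
proof -
  obtain x where x: "v < x" "x < w" "Phi w - Phi v = (w - v) * (c * h x)"
    using Phi_MVT assms by blast
  then have "(w - v) * (c * h x) < 0" using assms by simp
  then have "h x < 0" using assms c_pos by (simp add: mult_less_0_iff)
  with x that show thesis by blast
qed

end

section \<open>The components of the region \<open>D\<close>\<close>

context positive_spectrum begin

lemma of_real_e_in_poles [simp]: "i < n \<Longrightarrow> of_real (e i) \<in> poles"
  by (auto simp: poles_iff)

lemma e_in_poles [simp]: "i < n \<Longrightarrow> e i \<in> poles"
  by (auto simp: poles_iff)

lemma poles_pos: "(w::real) \<in> poles \<Longrightarrow> 0 < w"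
  using e_pos by (auto simp: poles_iff)

lemma F_strict_mono:
  fixes v w :: real
  assumes vw: "v < w" and np: "{v..w} \<inter> poles = {}"
  shows "F v < F w"
proof -
  have "e i / (e i - v) < e i / (e i - w)" if "i < n" for i
  proof -
    have "e i \<notin> {v..w}" using np e_in_poles[OF that] by blast
    then have "e i < v \<or> w < e i" by auto
    then show ?thesis using vw e_pos[OF that] by (auto simp: divide_simps)
  qed
  then have "(\<Sum>i<n. e i / (e i - v)) < (\<Sum>i<n. e i / (e i - w))"
    using n_pos by (intro sum_strict_mono) auto
  then show ?thesis using n_pos by (simp add: F_def divide_strict_right_mono)
qed

text \<open>Every eigenvalue is a genuine pole of \<open>F\<close>, since the contributions of equal eigenvalues cannot cancel.\<close>

lemma F_residue:
  assumes "l \<in> poles"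
  obtains \<kappa> :: real where "0 < \<kappa>"
    "((\<lambda>w. (of_real l - w) * F w) \<longlongrightarrow> (of_real \<kappa> :: 'a::real_normed_field)) (at (of_real l))"
proof -
  define t where "t i = (if e i = l then e i else 0)" for i
  define \<kappa> where "\<kappa> = (\<Sum>i<n. t i) / n"
  have summand: "((\<lambda>w. (of_real l - w) * (of_real (e i) / (of_real (e i) - w))) \<longlongrightarrow> (of_real (t i) :: 'a)) (at (of_real l))" for i
  proof (cases "e i = l")
    case True
    have "\<forall>\<^sub>F w in at (of_real l :: 'a). (of_real l - w) * (of_real (e i) / (of_real (e i) - w)) = of_real (t i)"
      unfolding eventually_at_filter by (rule always_eventually) (auto simp: True t_def)
    then show ?thesis by (rule tendsto_eventually)
  next
    case False
    then have "(of_real (e i) :: 'a) - of_real l \<noteq> 0" by simp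
    then have "((\<lambda>w. (of_real l - w) * (of_real (e i) / (of_real (e i) - w))) \<longlongrightarrow>
         ((of_real l - of_real l) * (of_real (e i) / (of_real (e i) - of_real l)) :: 'a)) (at (of_real l))"
      by (intro tendsto_intros)
    then show ?thesis using False by (simp add: t_def)
  qed
  have "((\<lambda>w. (\<Sum>i<n. (of_real l - w) * (of_real (e i) / (of_real (e i) - w))) / of_nat n) \<longlongrightarrow>
      ((\<Sum>i<n. of_real (t i)) / of_nat n :: 'a)) (at (of_real l))"
    using n_pos by (intro tendsto_intros summand) simp
  then have "((\<lambda>w. (of_real l - w) * F w) \<longlongrightarrow> (of_real \<kappa> :: 'a)) (at (of_real l))"
    by (simp add: F_def \<kappa>_def sum_distrib_left)
  moreover have "0 < \<kappa>"
  proof -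
    obtain j where j: "j < n" "e j = l" using assms by (auto simp: poles_iff)
    have "0 < (\<Sum>i<n. t i)"
      using j e_pos by (intro sum_pos2[of _ j]) (auto simp: t_def less_imp_le)
    then show ?thesis using n_pos by (simp add: \<kappa>_def)
  qed
  ultimately show thesis using that by blast
qed

lemma F_at_right_pole:
  assumes "l \<in> poles"
  shows "filterlim F at_bot (at_right (l::real))"
proof -
  obtain \<kappa> where \<kappa>: "0 < \<kappa>" "((\<lambda>w::real. (l - w) * F w) \<longlongrightarrow> \<kappa>) (at l)"
    using F_residue[OF assms, where 'a = real] by auto
  have 1: "((\<lambda>w::real. (l - w) * F w) \<longlongrightarrow> \<kappa>) (at_right l)"
    using \<kappa>(2) by (rule filterlim_mono[OF _ order_refl at_le]) simp
  have "filterlim (\<lambda>w. w - l) (at_right 0) (at_right l)"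
    by (auto simp: filterlim_at eventually_at_filter intro!: tendsto_eq_intros)
  then have "filterlim (\<lambda>w. inverse (w - l)) at_top (at_right l)"
    by (rule filterlim_compose[OF filterlim_inverse_at_top_right])
  from filterlim_tendsto_pos_mult_at_top[OF 1 \<kappa>(1) this]
  have "filterlim (\<lambda>w. ((l - w) * F w) * inverse (w - l)) at_top (at_right l)" .
  then have "filterlim (\<lambda>w. - F w) at_top (at_right l)"
    by (rule filterlim_cong[THEN iffD1, OF refl refl, rotated])
       (auto simp: eventually_at_filter field_simps intro!: always_eventually)
  then show ?thesis by (simp add: filterlim_uminus_at_bot)
qed

lemma F_at_left_pole:
  assumes "l \<in> poles"
  shows "filterlim F at_top (at_left (l::real))"
proof -
  obtain \<kappa> where \<kappa>: "0 < \<kappa>" "((\<lambda>w::real. (l - w) * F w) \<longlongrightarrow> \<kappa>) (at l)"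
    using F_residue[OF assms, where 'a = real] by auto
  have 1: "((\<lambda>w::real. (l - w) * F w) \<longlongrightarrow> \<kappa>) (at_left l)"
    using \<kappa>(2) by (rule filterlim_mono[OF _ order_refl at_le]) simp
  have "filterlim (\<lambda>w. l - w) (at_right 0) (at_left l)"
    by (auto simp: filterlim_at eventually_at_filter intro!: tendsto_eq_intros)
  then have "filterlim (\<lambda>w. inverse (l - w)) at_top (at_left l)"
    by (rule filterlim_compose[OF filterlim_inverse_at_top_right])
  from filterlim_tendsto_pos_mult_at_top[OF 1 \<kappa>(1) this]
  have "filterlim (\<lambda>w. ((l - w) * F w) * inverse (l - w)) at_top (at_left l)" .
  then show ?thesis
    by (rule filterlim_cong[THEN iffD1, OF refl refl, rotated])
       (auto simp: eventually_at_filter field_simps intro!: always_eventually)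
qed

lemma continuous_on_F: "I \<inter> poles = {} \<Longrightarrow> continuous_on I (F :: 'a::real_normed_field \<Rightarrow> 'a)"
  unfolding F_def using n_pos of_real_e_in_poles by (intro continuous_intros) (auto simp: disjoint_iff)

lemma gap_root:
  fixes l r :: real
  assumes l: "l \<in> poles" and r: "r \<in> poles" and lr: "l < r" and gap: "{l<..<r} \<inter> poles = {}"
  obtains m where "l < m" "m < r" "F m = 0" "\<And>w. l < w \<Longrightarrow> w < m \<Longrightarrow> F w < 0"
    "\<And>w. m < w \<Longrightarrow> w < r \<Longrightarrow> 0 < F w"
proof -
  have "\<forall>\<^sub>F w in at_right l. F w < 0"
    using F_at_right_pole[OF l] by (rule filterlim_at_bot_dense[THEN iffD1, rule_format])
  then obtain b where b: "l < b" "\<And>w. l < w \<Longrightarrow> w < b \<Longrightarrow> F w < 0"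
    unfolding eventually_at_right_field by auto
  have "\<forall>\<^sub>F w in at_left r. 0 < F w"
    using F_at_left_pole[OF r] by (rule filterlim_at_top_dense[THEN iffD1, rule_format])
  then obtain a where a: "a < r" "\<And>w. a < w \<Longrightarrow> w < r \<Longrightarrow> 0 < F w"
    unfolding eventually_at_left_field by auto
  define v where "v = (l + min b r) / 2"
  define u where "u = (r + max a v) / 2"
  have v: "l < v" "v < b" "v < r" using b lr by (auto simp: v_def min_def)
  have u: "v < u" "a < u" "u < r" using a v by (auto simp: u_def max_def)
  have "F v < 0" using b v by auto
  moreover have "0 < F u" using a u by auto
  moreover have "continuous_on {v..u} (F :: real \<Rightarrow> real)"
    using gap v u by (intro continuous_on_F) (auto simp: disjoint_iff)
  ultimately obtain m where m: "v \<le> m" "m \<le> u" "F m = 0"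
    using IVT'[of F v 0 u] u by auto
  have mono: "F x < F y" if "l < x" "x < y" "y < r" for x y
    using F_strict_mono[OF that(2)] gap that by (auto simp: disjoint_iff)
  show thesis
  proof
    show "F w < 0" if "l < w" "w < m" for w using mono[of w m] that m u by auto
    show "0 < F w" if "m < w" "w < r" for w using mono[of m w] that m v by auto
  qed (use m v u in auto)
qed

lemma Phi_pos: "w \<in> D \<Longrightarrow> 0 < Phi w"
  using c_pos by (simp add: D_def Phi_def)

lemma D_pos_iff:
  assumes "0 < w" "w \<notin> poles"
  shows "w \<in> D \<longleftrightarrow> F w < 0"
proof -
  have "0 < A w \<longleftrightarrow> F w < 0"
    using assms by (simp add: A_def mult_less_0_iff)
  moreover have "0 < A w \<Longrightarrow> 0 < B w" using assms c_pos by (simp add: B_def add_pos_pos)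
  ultimately show ?thesis using assms by (auto simp: D_def)
qed

lemma F_pos_left:
  assumes "\<And>l. l \<in> poles \<Longrightarrow> w < (l::real)"
  shows "0 < F w"
proof -
  have "0 < (\<Sum>i<n. e i / (e i - w))"
    using n_pos e_pos assms[OF e_in_poles] by (intro sum_pos) auto
  then show ?thesis using n_pos by (simp add: F_def)
qed

lemma F_neg_right:
  assumes "\<And>l. l \<in> poles \<Longrightarrow> l < (w::real)"
  shows "F w < 0"
proof -
  have "0 < (\<Sum>i<n. - (e i / (e i - w)))"
    using n_pos e_pos assms[OF e_in_poles] by (intro sum_pos) (auto simp: divide_pos_neg)
  then show ?thesis using n_pos by (simp add: F_def sum_negf divide_neg_pos)
qed

lemma nonpos_not_pole: "w \<le> 0 \<Longrightarrow> (w::real) \<notin> poles"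
  using poles_pos by fastforce

lemma D_neg_iff:
  assumes "w < 0"
  shows "w \<in> D \<longleftrightarrow> 1 < c * F w"
proof -
  have F: "0 < F w" using assms poles_pos by (intro F_pos_left) fastforce
  have "0 < A w" using F assms by (simp add: A_def mult_neg_pos)
  moreover have "B w = w * (1 - c * F w)" by (simp add: A_def B_def algebra_simps)
  moreover have "0 < w * (1 - c * F w) \<longleftrightarrow> 1 < c * F w"
    using assms by (simp add: zero_less_mult_iff)
  ultimately show ?thesis using nonpos_not_pole[of w] assms by (simp add: D_def)
qed

lemma F_0 [simp]: "F (0::real) = 1"
proof -
  have "(\<Sum>i<n. e i / (e i - 0)) = (\<Sum>i<n. 1)"
    using e_pos by (intro sum.cong) (auto simp: order_less_imp_not_eq2)
  then show ?thesis using n_pos by (simp add: F_def)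
qed

lemma zero_not_D: "0 \<notin> D"
  by (simp add: D_def A_def)

lemma D_neg_empty:
  assumes "c \<le> 1" "w < 0"
  shows "w \<notin> D"
proof -
  have "F w < F 0" using assms nonpos_not_pole by (intro F_strict_mono) auto
  then have "F w < 1" by simp
  moreover have "0 < F w" using assms poles_pos by (intro F_pos_left) fastforce
  ultimately have "c * F w < 1 * 1" using assms c_pos by (intro mult_le_less_imp_less) auto
  then show ?thesis using D_neg_iff[OF assms(2)] by simp
qed

text \<open>To the left of \<open>0\<close>, \<open>F\<close> increases from \<open>0\<close> at infinity to \<open>1\<close> at
\<open>0\<close>, so it takes the value \<open>1 / c\<close> once.\<close>

lemma left_root:
  assumes c: "1 < c"
  obtains om where "om < 0" "F om = 1 / c" "{om<..<0} \<subseteq> D" "\<And>w. w < 0 \<Longrightarrow> w \<in> D \<Longrightarrow> om < w"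
    "Phi om = 0"
proof -
  have np: "{v..w} \<inter> poles = {}" if "w \<le> 0" for v w :: real
    using nonpos_not_pole that by fastforce
  \<comment> \<open>at \<open>- c E\<close> every summand of \<open>F\<close> is below \<open>1 / c\<close>\<close>
  define E where "E = Max (e ` {..<n})"
  have E: "e i \<le> E" if "i < n" for i using that by (simp add: E_def)
  have E0: "0 < E" using E[of 0] e_pos[of 0] n_pos by linarith
  have "F (- (c * E)) < 1 / c"
  proof -
    have "e i / (e i + c * E) < 1 / c" if "i < n" for i
    proof -
      have "c * e i \<le> c * E" using E[OF that] c_pos by simp
      then have "c * e i < e i + c * E" using e_pos[OF that] by simp
      then show ?thesis using e_pos[OF that] E0 c_pos
        by (simp add: divide_simps add_pos_pos mult_ac)
    qed
    then have "(\<Sum>i<n. e i / (e i + c * E)) < (\<Sum>i<n. 1 / c)"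
      using n_pos by (intro sum_strict_mono) auto
    then have "(\<Sum>i<n. e i / (e i + c * E)) / n < (\<Sum>i<n. 1 / c) / n"
      using n_pos by (intro divide_strict_right_mono) auto
    then show ?thesis using n_pos by (simp add: F_def)
  qed
  moreover have "1 / c < F 0" using c by simp
  moreover have "continuous_on {- (c * E)..0} (F :: real \<Rightarrow> real)"
    using np[of 0] by (intro continuous_on_F) auto
  ultimately obtain om where om: "- (c * E) \<le> om" "om \<le> 0" "F om = 1 / c"
    using IVT'[of F "- (c * E)" "1 / c" 0] E0 c_pos by auto
  have om0: "om < 0" using om c by (cases "om = 0") auto
  show thesis
  proof
    show "{om<..<0} \<subseteq> D"
    proof
      fix w assume w: "w \<in> {om<..<0}"
      then have "F om < F w" using np[of w om] by (intro F_strict_mono) auto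
      then have "1 < c * F w" using om c_pos by (simp add: field_simps)
      then show "w \<in> D" using D_neg_iff w by simp
    qed
    show "om < w" if "w < 0" "w \<in> D" for w
    proof (rule ccontr)
      assume "\<not> om < w"
      then have "F w \<le> F om"
        using F_strict_mono[of w om] np[of om w] om0 by (cases "w = om") auto
      then have "c * F w \<le> 1" using om c_pos by (simp add: field_simps)
      then show False using D_neg_iff that by simp
    qed
    show "Phi om = 0" using om c_pos by (simp add: Phi_def B_def A_def)
  qed (use om om0 in auto)
qed

lemma Phi_increasing:
  fixes v w :: real
  assumes "v < w" and "{v..w} \<inter> poles = {}" and "\<And>x. v < x \<Longrightarrow> x < w \<Longrightarrow> 0 < h x"
  shows "Phi v < Phi w"
proof -
  obtain x where x: "v < x" "x < w" "Phi w - Phi v = (w - v) * (c * h x)"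
    using Phi_MVT assms(1,2) by blast
  then have "0 < Phi w - Phi v" using assms c_pos by simp
  then show ?thesis by simp
qed

lemma Phi_decreasing:
  fixes v w :: real
  assumes "v < w" and "{v..w} \<inter> poles = {}" and "\<And>x. v < x \<Longrightarrow> x < w \<Longrightarrow> h x < 0"
  shows "Phi w < Phi v"
proof -
  obtain x where x: "v < x" "x < w" "Phi w - Phi v = (w - v) * (c * h x)"
    using Phi_MVT assms(1,2) by blast
  then have "Phi w - Phi v < 0" using assms c_pos by (simp add: mult_pos_neg)
  then show ?thesis by simp
qed

lemma Phi_at_right_pole:
  assumes "l \<in> poles"
  shows "filterlim Phi at_top (at_right (l::real))"
proof -
  have l: "0 < l" using assms by (rule poles_pos)
  have id: "((\<lambda>w. w) \<longlongrightarrow> l) (at_right l)" by (rule tendsto_ident_at)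
  have A: "filterlim (\<lambda>w. w * - F w) at_top (at_right l)"
    using F_at_right_pole[OF assms]
    by (intro filterlim_tendsto_pos_mult_at_top[OF id l]) (simp add: filterlim_uminus_at_bot)
  then have A: "filterlim A at_top (at_right l)" by (simp add: A_def[abs_def])
  have cA: "filterlim (\<lambda>w. c * A w) at_top (at_right l)"
    by (rule filterlim_tendsto_pos_mult_at_top[OF tendsto_const c_pos A])
  have B: "filterlim (\<lambda>w. w + c * A w) at_top (at_right l)"
    by (rule filterlim_tendsto_add_at_top[OF id cA])
  show ?thesis
    using filterlim_at_top_mult_at_top[OF cA B] by (simp add: Phi_def[abs_def] B_def)
qed

lemma local_extremum_imp_h_zero:
  assumes "local_extremum Phi w" and "w \<notin> poles"
  shows "h w = 0"
proof -
  have "c * h w = 0"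
    using assms(1) unfolding local_extremum_def
  proof
    assume "\<forall>\<^sub>F y in nhds w. Phi y \<le> Phi w"
    then obtain d where "0 < d" "\<And>y. dist y w < d \<Longrightarrow> Phi y \<le> Phi w"
      unfolding eventually_nhds_metric by blast
    then show "c * h w = 0"
      by (intro DERIV_local_max[OF DERIV_Phi[OF assms(2)], of d]) (auto simp: dist_real_def abs_minus_commute)
  next
    assume "\<forall>\<^sub>F y in nhds w. Phi w \<le> Phi y"
    then obtain d where "0 < d" "\<And>y. dist y w < d \<Longrightarrow> Phi w \<le> Phi y"
      unfolding eventually_nhds_metric by blast
    then show "c * h w = 0"
      by (intro DERIV_local_min[OF DERIV_Phi[OF assms(2)], of d]) (auto simp: dist_real_def abs_minus_commute)
  qed
  then show ?thesis using c_pos by simp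
qed

text \<open>\<open>Phi\<close> tends to infinity at the left end and vanishes at the right end, so \<open>h < 0\<close> at points
arbitrarily close to both. Hence the set where \<open>h > 0\<close>, which is an interval, stays away from the ends,
and its end points are a local minimum and a local maximum. In the flat case \<open>h\<close> may still vanish at one
point, which is then an inflection point.\<close>

lemma gap_structure:
  fixes l m :: real
  assumes l: "l \<in> poles" and lm: "l < m" and sub: "{l<..<m} \<subseteq> D" and m: "m \<notin> poles" and Fm: "F m = 0"
  obtains
    (flat) "\<And>w. l < w \<Longrightarrow> w < m \<Longrightarrow> h w \<le> 0" "\<And>w. l < w \<Longrightarrow> w < m \<Longrightarrow> \<not> local_extremum Phi w"
  | (bump) \<alpha> \<beta> where "l < \<alpha>" "\<alpha> < \<beta>" "\<beta> < m" "h \<alpha> = 0" "h \<beta> = 0"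
      "\<And>w. l < w \<Longrightarrow> w < m \<Longrightarrow> 0 < h w \<longleftrightarrow> \<alpha> < w \<and> w < \<beta>"
      "\<And>w. l < w \<Longrightarrow> w < m \<Longrightarrow> local_extremum Phi w \<longleftrightarrow> w = \<alpha> \<or> w = \<beta>"
proof -
  have np: "{v..w} \<inter> poles = {}" if "l < v" "w \<le> m" for v w
  proof -
    have "x \<notin> poles" if "l < x" "x \<le> m" for x
      using sub m that by (cases "x = m") (auto simp: D_def subset_iff)
    then show ?thesis using that by force
  qed
  have subD: "{v..w} \<subseteq> D" if "l < v" "w < m" for v w
    using that by (intro subset_trans[OF _ sub]) auto
  have neg_left: "\<exists>x. l < x \<and> x < p \<and> h x < 0" if p: "l < p" "p < m" for p
  proof -
    have "\<forall>\<^sub>F w in at_right l. Phi p < Phi w"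
      using Phi_at_right_pole[OF l] by (rule filterlim_at_top_dense[THEN iffD1, rule_format])
    then obtain b where b: "l < b" "\<And>w. l < w \<Longrightarrow> w < b \<Longrightarrow> Phi p < Phi w"
      unfolding eventually_at_right_field by auto
    define v where "v = (l + min b p) / 2"
    have v: "l < v" "v < b" "v < p" using b p by (auto simp: v_def min_def)
    then show ?thesis using ex_h_neg[of v p] np[of v p] b(2)[of v] p
      by (metis less_imp_le order.strict_trans)
  qed
  have neg_right: "\<exists>x. p < x \<and> x < m \<and> h x < 0" if p: "l < p" "p < m" for p
  proof -
    have "Phi m = 0" using Fm by (simp add: Phi_def A_def)
    moreover have "0 < Phi p" using sub p by (intro Phi_pos) auto
    ultimately show ?thesis using ex_h_neg[of p m] np[of p m] p by auto
  qed
  show thesis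
  proof (cases "\<exists>p. l < p \<and> p < m \<and> 0 < h p")
    case False
    then have le: "h w \<le> 0" if "l < w" "w < m" for w using that by force
    have "\<not> local_extremum Phi w" if w: "l < w" "w < m" for w
    proof
      assume ext: "local_extremum Phi w"
      have h0: "h w = 0" using local_extremum_imp_h_zero[OF ext] np[of w w] w by auto
      have neg: "h y < 0" if y: "l < y" "y < m" "y \<noteq> w" for y
      proof (rule ccontr)
        assume "\<not> h y < 0"
        then have hy: "0 \<le> h y" by simp
        have "0 < h ((y + w) / 2)"
        proof (cases "y < w")
          case True
          then show ?thesis using h_pos_between[OF subD, of y w] hy h0 w y by simp
        next
          case False
          then show ?thesis using h_pos_between[OF subD, of w y] hy h0 w y by simp
        qed
        then show False using le[of "(y + w) / 2"] w y by auto
      qed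
      have L: "Phi w < Phi y" if "l < y" "y < w" for y
        using Phi_decreasing[of y w] np[of y w] neg that w by auto
      have R: "Phi y < Phi w" if "w < y" "y < m" for y
        using Phi_decreasing[of w y] np[of w y] neg that w by auto
      from ext show False
        unfolding local_extremum_def
      proof
        assume "\<forall>\<^sub>F y in nhds w. Phi y \<le> Phi w"
        then obtain d where d: "0 < d" "\<And>y. dist y w < d \<Longrightarrow> Phi y \<le> Phi w"
          unfolding eventually_nhds_metric by blast
        obtain y where "max l (w - d) < y" "y < w"
          using dense[of "max l (w - d)" w] d w by auto
        then have "l < y" "y < w" "dist y w < d" by (auto simp: dist_real_def)
        then show False using L[of y] d(2)[of y] by auto
      next
        assume "\<forall>\<^sub>F y in nhds w. Phi w \<le> Phi y"
        then obtain d where d: "0 < d" "\<And>y. dist y w < d \<Longrightarrow> Phi w \<le> Phi y"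
          unfolding eventually_nhds_metric by blast
        obtain y where "w < y" "y < min m (w + d)"
          using dense[of w "min m (w + d)"] d w by auto
        then have "w < y" "y < m" "dist y w < d" by (auto simp: dist_real_def)
        then show False using R[of y] d(2)[of y] by auto
      qed
    qed
    with le show thesis using flat by blast
  next
    case True
    then obtain p where p: "l < p" "p < m" "0 < h p" by blast
    obtain x where x: "l < x" "x < p" "h x < 0" using neg_left p by blast
    obtain y where y: "p < y" "y < m" "h y < 0" using neg_right p by blast
    obtain \<alpha> where \<alpha>: "x < \<alpha>" "\<alpha> < p" "h \<alpha> = 0"
      "\<And>w. w < \<alpha> \<Longrightarrow> {w..p} \<subseteq> D \<Longrightarrow> h w < 0" "\<And>w. \<alpha> < w \<Longrightarrow> w \<le> p \<Longrightarrow> 0 < h w"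
      using h_root_entering[OF subD[of x p] x(2) x(3) p(3)] x p by blast
    obtain \<beta> where \<beta>: "p < \<beta>" "\<beta> < y" "h \<beta> = 0"
      "\<And>w. \<beta> < w \<Longrightarrow> {p..w} \<subseteq> D \<Longrightarrow> h w < 0" "\<And>w. p \<le> w \<Longrightarrow> w < \<beta> \<Longrightarrow> 0 < h w"
      using h_root_leaving[OF subD[of p y] y(1) y(3) p(3)] y p by blast
    have lo: "h w < 0" if "l < w" "w < \<alpha>" for w using \<alpha>(4)[of w] subD[of w p] that p by simp
    have hi: "h w < 0" if "\<beta> < w" "w < m" for w using \<beta>(4)[of w] subD[of p w] that p by simp
    have mid: "0 < h w" if "\<alpha> < w" "w < \<beta>" for w
      using \<alpha>(5)[of w] \<beta>(5)[of w] that by linarith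
    have ord: "l < \<alpha>" "\<alpha> < \<beta>" "\<beta> < m" using x \<alpha> \<beta> y by auto
    have "\<forall>\<^sub>F y in nhds \<alpha>. Phi \<alpha> \<le> Phi y"
    proof -
      have "Phi \<alpha> \<le> Phi y" if y: "y \<in> {l<..<\<beta>}" for y
      proof (cases y \<alpha> rule: linorder_cases)
        case less
        then show ?thesis using Phi_decreasing[of y \<alpha>] np[of y \<alpha>] lo y ord by fastforce
      next
        case greater
        then show ?thesis using Phi_increasing[of \<alpha> y] np[of \<alpha> y] mid y ord by fastforce
      qed simp
      then show ?thesis using ord by (intro eventually_nhds[THEN iffD2] exI[of _ "{l<..<\<beta>}"]) auto
    qed
    then have ext\<alpha>: "local_extremum Phi \<alpha>" by (simp add: local_extremum_def)
    have "\<forall>\<^sub>F y in nhds \<beta>. Phi y \<le> Phi \<beta>"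
    proof -
      have "Phi y \<le> Phi \<beta>" if y: "y \<in> {\<alpha><..<m}" for y
      proof (cases y \<beta> rule: linorder_cases)
        case less
        then show ?thesis using Phi_increasing[of y \<beta>] np[of y \<beta>] mid y ord by fastforce
      next
        case greater
        then show ?thesis using Phi_decreasing[of \<beta> y] np[of \<beta> y] hi y ord by fastforce
      qed simp
      then show ?thesis using ord by (intro eventually_nhds[THEN iffD2] exI[of _ "{\<alpha><..<m}"]) auto
    qed
    then have ext\<beta>: "local_extremum Phi \<beta>" by (simp add: local_extremum_def)
    show thesis
    proof (rule bump[OF ord \<alpha>(3) \<beta>(3)])
      show "0 < h w \<longleftrightarrow> \<alpha> < w \<and> w < \<beta>" if w: "l < w" "w < m" for w
        using lo[of w] hi[of w] mid[of w] w \<alpha>(3) \<beta>(3)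
        by (cases w \<alpha> rule: linorder_cases; cases w \<beta> rule: linorder_cases) auto
      show "local_extremum Phi w \<longleftrightarrow> w = \<alpha> \<or> w = \<beta>" if w: "l < w" "w < m" for w
      proof
        assume "local_extremum Phi w"
        then have "h w = 0" using local_extremum_imp_h_zero np[of w w] w by auto
        then show "w = \<alpha> \<or> w = \<beta>"
          using lo[of w] hi[of w] mid[of w] w
          by (cases w \<alpha> rule: linorder_cases; cases w \<beta> rule: linorder_cases) auto
      qed (use ext\<alpha> ext\<beta> in auto)
    qed
  qed
qed

lemma right_of_poles_in_D:
  assumes "\<And>l. l \<in> poles \<Longrightarrow> l < w"
  shows "w \<in> D"
proof -
  obtain l :: real where "l \<in> poles" using n_pos by (auto simp: poles_def)
  then have "0 < w" using assms[of l] poles_pos[of l] by simp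
  then show ?thesis using D_pos_iff[of w] F_neg_right[of w] assms by fastforce
qed

lemma Phi_at_top: "filterlim Phi at_top (at_top :: real filter)"
proof -
  define a where "a = (\<Sum>i<n. e i) / n"
  have a: "0 < a" using n_pos e_pos by (auto simp: a_def intro!: sum_pos divide_pos_pos)
  define E where "E = Max (e ` {..<n})"
  have E: "e i \<le> E" if "i < n" for i using that by (simp add: E_def)
  have E0: "0 < E" using E[of 0] e_pos[of 0] n_pos by linarith
  have "c * a * w \<le> Phi w" if w: "E < w" for w
  proof -
    have "e i \<le> - (w * (e i / (e i - w)))" if "i < n" for i
      using E[OF that] e_pos[OF that] w by (simp add: field_simps)
    then have "(\<Sum>i<n. e i) \<le> (\<Sum>i<n. - (w * (e i / (e i - w))))" by (intro sum_mono) auto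
    also have "\<dots> = n * A w"
      using n_pos by (simp only: A_def F_def sum_negf flip: sum_distrib_left) simp
    finally have "a \<le> A w" using n_pos by (simp add: a_def field_simps)
    moreover then have "w \<le> B w" using a c_pos by (simp add: B_def)
    ultimately have "a * w \<le> A w * B w" using a w E0 by (intro mult_mono) auto
    then show ?thesis using c_pos by (simp add: Phi_def mult_ac)
  qed
  moreover have "filterlim (\<lambda>w. c * a * w) at_top at_top"
    using a c_pos by (intro filterlim_tendsto_pos_mult_at_top[OF tendsto_const _ filterlim_ident]) simp
  ultimately show ?thesis
    by (rule_tac filterlim_at_top_mono) (auto intro!: eventually_mono[OF eventually_gt_at_top[of E]])
qed

text \<open>\<open>Phi\<close> is infinite at both ends of this component, so it decreases first and increases from some point on.\<close>

lemma right_structure: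
  fixes l :: real
  assumes l: "l \<in> poles" and max: "\<And>x. x \<in> poles \<Longrightarrow> x \<le> l"
  obtains w0 where "l < w0" "h w0 = 0" "\<And>w. l < w \<Longrightarrow> 0 < h w \<longleftrightarrow> w0 < w"
    "\<And>w. l < w \<Longrightarrow> h w = 0 \<longleftrightarrow> w = w0"
proof -
  have inD: "w \<in> D" if "l < w" for w
    using max that by (intro right_of_poles_in_D) force
  then have subD: "{v..w} \<subseteq> D" if "l < v" for v w using that by auto
  have np: "{v..w} \<inter> poles = {}" if "l < v" for v w
    using max that by force
  have pos: "\<exists>x. p < x \<and> 0 < h x" if p: "l < p" for p
  proof -
    have "\<forall>\<^sub>F w in at_top. Phi p < Phi w"
      using Phi_at_top by (rule filterlim_at_top_dense[THEN iffD1, rule_format])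
    then have "\<forall>\<^sub>F w in at_top. Phi p < Phi w \<and> p < w"
      using eventually_gt_at_top by (rule eventually_conj)
    then obtain w where "Phi p < Phi w" "p < w"
      using eventually_happens'[OF trivial_limit_at_top_linorder] by blast
    then show ?thesis using ex_h_pos[of p w] np[OF p] by metis
  qed
  obtain p where "l + 1 < p" and hp: "0 < h p" using pos[of "l + 1"] by auto
  then have p: "l < p" "0 < h p" by simp_all
  have "\<forall>\<^sub>F w in at_right l. Phi p < Phi w"
    using Phi_at_right_pole[OF l] by (rule filterlim_at_top_dense[THEN iffD1, rule_format])
  then obtain b where b: "l < b" "\<And>w. l < w \<Longrightarrow> w < b \<Longrightarrow> Phi p < Phi w"
    unfolding eventually_at_right_field by auto
  define v where "v = (l + min b p) / 2"
  have v: "l < v" "v < b" "v < p" using b p by (auto simp: v_def min_def)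
  obtain x where x: "v < x" "x < p" "h x < 0"
    using ex_h_neg[of v p] np[of v p] b(2)[of v] v by metis
  have lx: "l < x" using v x by simp
  obtain \<alpha> where \<alpha>: "x < \<alpha>" "\<alpha> < p" "h \<alpha> = 0"
    "\<And>w. w < \<alpha> \<Longrightarrow> {w..p} \<subseteq> D \<Longrightarrow> h w < 0" "\<And>w. \<alpha> < w \<Longrightarrow> w \<le> p \<Longrightarrow> 0 < h w"
    using h_root_entering[OF subD[OF lx] x(2) x(3) p(2)] by blast
  have lo: "h w < 0" if "l < w" "w < \<alpha>" for w using \<alpha>(4)[of w] subD[of w p] that by simp
  have hi: "0 < h w" if w: "\<alpha> < w" for w
  proof -
    have "l < w" using w lx \<alpha> by simp
    then obtain y where y: "w < y" "0 < h y" using pos[of w] by blast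
    then show ?thesis using h_pos_between[OF subD, of \<alpha> w y] w lx \<alpha> by simp
  qed
  show thesis
  proof (rule that[of \<alpha>])
    show "0 < h w \<longleftrightarrow> \<alpha> < w" if "l < w" for w
      using lo[of w] hi[of w] that \<alpha>(3) by (cases w \<alpha> rule: linorder_cases) auto
    show "h w = 0 \<longleftrightarrow> w = \<alpha>" if "l < w" for w
      using lo[of w] hi[of w] that \<alpha>(3) by (cases w \<alpha> rule: linorder_cases) auto
  qed (use lx \<alpha> in auto)
qed

text \<open>\<open>Phi\<close> vanishes at both ends of this component and is positive inside, so it increases first.\<close>

lemma left_structure:
  assumes om: "om < 0" and sub: "{om<..<0} \<subseteq> D" and Phi_om: "Phi om = 0"
  obtains w0 where "om < w0" "w0 < 0" "h w0 = 0"
    "\<And>w. om < w \<Longrightarrow> w < 0 \<Longrightarrow> 0 < h w \<longleftrightarrow> w < w0" "\<And>w. om < w \<Longrightarrow> w < 0 \<Longrightarrow> h w = 0 \<longleftrightarrow> w = w0"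
proof -
  have subD: "{v..w} \<subseteq> D" if "om < v" "w < 0" for v w
    using that by (intro subset_trans[OF _ sub]) auto
  have np: "{v..w} \<inter> poles = {}" if "w \<le> 0" for v w :: real
    using nonpos_not_pole that by fastforce
  have pos: "\<exists>x. om < x \<and> x < p \<and> 0 < h x" if p: "om < p" "p < 0" for p
  proof -
    have "0 < Phi p" using sub p by (intro Phi_pos) auto
    then show ?thesis using ex_h_pos[of om p] np[of p om] Phi_om p by (metis less_imp_le)
  qed
  have neg: "\<exists>x. p < x \<and> x < 0 \<and> h x < 0" if p: "om < p" "p < 0" for p
  proof -
    have "0 < Phi p" using sub p by (intro Phi_pos) auto
    moreover have "Phi (0::real) = 0" by (simp add: Phi_def A_def)
    ultimately show ?thesis using ex_h_neg[of p 0] np[of 0 p] p by auto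
  qed
  obtain p where p: "om < p" "p < 0" "0 < h p" using pos[of "om / 2"] om by auto
  obtain x where x: "p < x" "x < 0" "h x < 0" using neg p by blast
  obtain \<beta> where \<beta>: "p < \<beta>" "\<beta> < x" "h \<beta> = 0"
    "\<And>w. \<beta> < w \<Longrightarrow> {p..w} \<subseteq> D \<Longrightarrow> h w < 0" "\<And>w. p \<le> w \<Longrightarrow> w < \<beta> \<Longrightarrow> 0 < h w"
    using h_root_leaving[OF subD[OF p(1) x(2)] x(1) x(3) p(3)] by blast
  have hi: "h w < 0" if "\<beta> < w" "w < 0" for w using \<beta>(4)[of w] subD[of p w] that p by simp
  have lo: "0 < h w" if w: "om < w" "w < \<beta>" for w
  proof -
    have "w < 0" using w x \<beta> by simp
    then obtain y where y: "om < y" "y < w" "0 < h y" using pos[of w] w(1) by blast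
    then show ?thesis using h_pos_between[OF subD, of y \<beta> w] w x \<beta> by simp
  qed
  show thesis
  proof (rule that[of \<beta>])
    show "0 < h w \<longleftrightarrow> w < \<beta>" if "om < w" "w < 0" for w
      using lo[of w] hi[of w] that \<beta>(3) by (cases w \<beta> rule: linorder_cases) auto
    show "h w = 0 \<longleftrightarrow> w = \<beta>" if "om < w" "w < 0" for w
      using lo[of w] hi[of w] that \<beta>(3) by (cases w \<beta> rule: linorder_cases) auto
  qed (use p x \<beta> in auto)
qed

lemma Phi_image_increasing:
  fixes v w :: real
  assumes vw: "v < w" and np: "{v..w} \<inter> poles = {}" and h: "\<And>x. v < x \<Longrightarrow> x < w \<Longrightarrow> 0 < h x"
  shows "Phi ` {v<..<w} = {Phi v<..<Phi w}"
proof
  show "Phi ` {v<..<w} \<subseteq> {Phi v<..<Phi w}"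
  proof
    fix y assume "y \<in> Phi ` {v<..<w}"
    then obtain x where x: "v < x" "x < w" "y = Phi x" by auto
    have "{v..x} \<inter> poles = {}" "{x..w} \<inter> poles = {}"
      using np x by (auto simp: disjoint_iff)
    then show "y \<in> {Phi v<..<Phi w}"
      using Phi_increasing[of v x] Phi_increasing[of x w] x h by auto
  qed
  show "{Phi v<..<Phi w} \<subseteq> Phi ` {v<..<w}"
  proof
    fix y assume y: "y \<in> {Phi v<..<Phi w}"
    then obtain x where x: "v \<le> x" "x \<le> w" "Phi x = y"
      using IVT'[of Phi v y w] continuous_on_Phi[OF np] vw by auto
    then have "x \<noteq> v" "x \<noteq> w" using y by auto
    then show "y \<in> Phi ` {v<..<w}" using x by auto
  qed
qed

end

section \<open>The solution of the canonical equation in the upper half plane\<close>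

context positive_spectrum begin

lemma not_poleD: "w \<notin> poles \<Longrightarrow> i < n \<Longrightarrow> of_real (e i) - w \<noteq> 0"
  by (auto simp: poles_iff)

lemma tendsto_F:
  assumes "(f \<longlongrightarrow> w) G" "w \<notin> poles"
  shows "((\<lambda>x. F (f x)) \<longlongrightarrow> F w) G"
  unfolding F_def using n_pos not_poleD[OF assms(2)]
  by (intro tendsto_intros assms) auto

lemma tendsto_A: "(f \<longlongrightarrow> w) G \<Longrightarrow> w \<notin> poles \<Longrightarrow> ((\<lambda>x. A (f x)) \<longlongrightarrow> A w) G"
  unfolding A_def by (intro tendsto_intros tendsto_F)

lemma tendsto_B: "(f \<longlongrightarrow> w) G \<Longrightarrow> w \<notin> poles \<Longrightarrow> ((\<lambda>x. B (f x)) \<longlongrightarrow> B w) G"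
  unfolding B_def by (intro tendsto_intros tendsto_A)

lemma tendsto_S:
  assumes "(f \<longlongrightarrow> w) G" "w \<notin> poles"
  shows "((\<lambda>x. S (f x)) \<longlongrightarrow> S w) G"
  unfolding S_def using n_pos not_poleD[OF assms(2)]
  by (intro tendsto_intros assms) auto

lemma tendsto_T:
  assumes "(f \<longlongrightarrow> w) G" "w \<notin> poles" "v \<notin> poles"
  shows "((\<lambda>x. T v (f x)) \<longlongrightarrow> T v w) G"
  unfolding T_def using n_pos not_poleD[OF assms(2)] not_poleD[OF assms(3)]
  by (intro tendsto_intros assms) auto

lemma holomorphic_on_F: "X \<inter> poles = {} \<Longrightarrow> F holomorphic_on X"
  unfolding F_def[abs_def] using n_pos not_poleD by (intro holomorphic_intros) (auto simp: disjoint_iff)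

lemma holomorphic_on_A: "X \<inter> poles = {} \<Longrightarrow> A holomorphic_on X"
  unfolding A_def[abs_def] by (intro holomorphic_intros holomorphic_on_F)

lemma holomorphic_on_Phi: "X \<inter> poles = {} \<Longrightarrow> Phi holomorphic_on X"
  unfolding Phi_def[abs_def] B_def[abs_def] by (intro holomorphic_intros holomorphic_on_A)

lemma open_Omega: "open (Omega :: complex set)"
proof -
  define f where "f w = norm (A w) - S w * (norm (B w) + c * norm (A w))" for w :: complex
  have "open (- poles :: complex set)" by (simp add: finite_imp_closed open_Compl)
  moreover have "continuous_on (- poles) f"
    unfolding continuous_on_def f_def
    by (intro ballI tendsto_intros tendsto_A tendsto_B tendsto_S tendsto_ident_at) auto
  ultimately have "open (f -` {0<..} \<inter> - poles)" by (simp add: continuous_on_open_vimage)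
  also have "f -` {0<..} \<inter> - poles = Omega" by (auto simp: Omega_def f_def)
  finally show ?thesis .
qed

lemma F_cnj: "F (cnj w) = cnj (F w)"
  by (simp add: F_def)

lemma A_cnj: "A (cnj w) = cnj (A w)"
  by (simp add: A_def F_cnj)

lemma T_cnj: "T (cnj w) w = of_real (S w)"
proof -
  have "(of_real (e i) - cnj w) * (of_real (e i) - w) = of_real ((norm (of_real (e i) - w))\<^sup>2)" for i
    using complex_norm_square[of "of_real (e i) - w"] by (simp add: mult.commute)
  then show ?thesis by (simp add: T_def S_def)
qed

lemma Im_A:
  assumes "w \<notin> poles"
  shows "Im (A w) = - (S w * Im w)"
proof -
  have "cnj w \<notin> poles" using assms by (auto simp: poles_iff complex_eq_iff)
  from A_diff[OF this assms] have "A w - cnj (A w) = - ((w - cnj w) * of_real (S w))"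
    by (simp add: A_cnj T_cnj)
  then have "Im (A w - cnj (A w)) = Im (- ((w - cnj w) * of_real (S w)))" by simp
  then show ?thesis by simp
qed

lemma Im_F_pos:
  assumes "0 < Im w"
  shows "0 < Im (F w)"
proof -
  have "0 < Im (of_real (e i) / (of_real (e i) - w))" if "i < n" for i
  proof -
    have "of_real (e i) - w \<noteq> 0" using assms by (auto simp: complex_eq_iff)
    then have "0 < (Re (of_real (e i) - w))\<^sup>2 + (Im (of_real (e i) - w))\<^sup>2"
      using assms by (simp add: add_nonneg_pos)
    then show ?thesis using e_pos[OF that] assms
      by (simp add: Im_divide)
  qed
  then have "0 < (\<Sum>i<n. Im (of_real (e i) / (of_real (e i) - w)))"
    using n_pos by (intro sum_pos) auto
  then show ?thesis using n_pos by (simp add: F_def flip: Im_sum)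
qed

text \<open>The inequality of \<open>Omega\<close> reads \<open>Im B / \<bar>B\<bar> > \<bar>Im A\<bar> / \<bar>A\<bar>\<close>,
because the imaginary parts of \<open>A\<close> and \<open>B\<close> are multiples of the one of \<open>w\<close>. It
follows from two facts about arguments: \<open>A B\<close> is a multiple of \<open>Phi w\<close> and lies in the upper
half plane, whereas \<open>A\<close> times the conjugate of \<open>B\<close> lies in the lower one since
\<open>F\<close> maps the upper half plane to itself.\<close>

lemma
  assumes w: "0 < Im w" and B: "0 < Im (B w)" and Phi: "0 < Im (Phi w)"
  shows upper_half_plane_in_Omega: "w \<in> Omega" and Re_A_pos: "0 < Re (A w)"
proof -
  have np: "w \<notin> poles" using w by (intro Im_in_poles) simp
  define x y p q where "x = Re (A w)" and "y = Im (A w)" and "p = Re (B w)" and "q = Im (B w)"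
  have y: "y = - (S w * Im w)" using Im_A[OF np] by (simp add: y_def)
  have q: "q = (1 - c * S w) * Im w"
    unfolding q_def B_def using Im_A[OF np] by (simp add: algebra_simps)
  have y0: "y < 0" using S_pos[OF np] w by (simp add: y)
  have q0: "0 < q" using B by (simp add: q_def)
  have Sv: "0 < 1 - c * S w" using q0 w by (simp add: q zero_less_mult_iff)
  have "Im (Phi w) = c * (x * q + y * p)"
    by (simp add: Phi_def x_def y_def p_def q_def algebra_simps)
  then have 1: "0 < x * q + y * p" using Phi c_pos by (simp add: zero_less_mult_iff)
  have 2: "y * p - x * q < 0"
  proof -
    have wB: "w = B w - of_real c * A w" by (simp add: B_def)
    have "Im (F w * (w * cnj w)) = Im (F w) * (norm w)\<^sup>2"
      unfolding complex_norm_square[symmetric] by simp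
    then have "0 < Im (F w * (w * cnj w))"
      using Im_F_pos[OF w] w by (auto simp: complex_eq_iff)
    also have "F w * (w * cnj w) = - (A w * cnj w)" by (simp add: A_def)
    also have "Im \<dots> = - (Im (A w) * Re w - Re (A w) * Im w)" by simp
    also have "\<dots> = x * q - y * p"
      by (subst (1 2) wB) (simp add: x_def y_def p_def q_def algebra_simps)
    finally show ?thesis by simp
  qed
  have xq: "\<bar>y * p\<bar> < x * q" using 1 2 by linarith
  then have "0 < x * q" by linarith
  then show "0 < Re (A w)" using q0 by (simp add: x_def zero_less_mult_iff)
  have "(y * p)\<^sup>2 < (x * q)\<^sup>2" using xq by (metis abs_ge_zero power2_abs power_strict_mono zero_less_numeral)
  then have "y\<^sup>2 * (p\<^sup>2 + q\<^sup>2) < (x\<^sup>2 + y\<^sup>2) * q\<^sup>2" by (simp add: algebra_simps power_mult_distrib)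
  then have "(y * norm (B w))\<^sup>2 < (norm (A w) * q)\<^sup>2"
    by (simp add: cmod_power2 power_mult_distrib x_def y_def p_def q_def)
  then have "\<bar>y * norm (B w)\<bar> < \<bar>norm (A w) * q\<bar>" 
    by (intro power2_less_imp_less[of "\<bar>y * norm (B w)\<bar>"]) simp_all
  then have "S w * Im w * norm (B w) < norm (A w) * ((1 - c * S w) * Im w)"
    using y0 q0 w Sv S_nonneg[of w] unfolding y q by (simp add: abs_mult)
  then have "Im w * (S w * norm (B w)) < Im w * (norm (A w) * (1 - c * S w))"
    by (simp add: mult_ac)
  then have "S w * norm (B w) < norm (A w) * (1 - c * S w)" using w by simp
  then show "w \<in> Omega" using np by (simp add: Omega_def algebra_simps)
qed

lemma Omega_of_real_iff: "(of_real w :: complex) \<in> Omega \<longleftrightarrow> w \<in> Omega"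
  by (simp add: Omega_def)

end

locale stieltjes_solution = positive_spectrum n e c + finite_measure \<mu>
  for n :: nat and e :: "nat \<Rightarrow> real" and c :: real and \<mu> :: "real measure" +
  fixes t :: "complex \<Rightarrow> complex"
  assumes sets_\<mu>: "sets \<mu> = sets borel"
    and \<mu>_neg: "emeasure \<mu> {..<0} = 0"
    and stieltjes: "is_stieltjes_transform \<mu> t"
    and Im_t: "0 < Im z \<Longrightarrow> 0 < Im (t z)"
    and Im_zt: "0 < Im z \<Longrightarrow> 0 < Im (z * t z)"
    and canonical: "0 < Im z \<Longrightarrow> z * t z = (z * of_real c * t z - 1 / (of_real c * t z)) * F (z * of_real c * t z - 1 / (of_real c * t z))"
begin

definition W :: "complex \<Rightarrow> complex" where
  "W z = z * of_real c * t z - 1 / (of_real c * t z)"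

context
  fixes z :: complex
  assumes z: "0 < Im z"
begin

lemma t_nz: "t z \<noteq> 0"
  using Im_t[OF z] by auto

lemma A_W: "A (W z) = - (z * t z)"
  using canonical[OF z] by (simp add: A_def W_def)

lemma B_W: "B (W z) = - (1 / (of_real c * t z))"
  using A_W by (simp add: B_def W_def)

lemma Phi_W: "Phi (W z) = z"
  using t_nz c_pos by (simp add: Phi_def A_W B_W)

lemma Im_B_W: "0 < Im (B (W z))"
proof -
  have "0 < (Re (t z))\<^sup>2 + (Im (t z))\<^sup>2" using Im_t[OF z] by (simp add: add_nonneg_pos)
  then show ?thesis unfolding B_W using Im_t[OF z] c_pos t_nz
    by (simp add: Im_divide power_mult_distrib flip: distrib_left)
qed

lemma Im_W: "0 < Im (W z)"
proof -
  have "W z = B (W z) + of_real c * (z * t z)" by (simp add: B_def A_W)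
  moreover have "0 < Im (B (W z) + of_real c * (z * t z))"
    using Im_B_W Im_zt[OF z] c_pos by (simp add: add_pos_pos)
  ultimately show ?thesis by simp
qed

lemma W_in_Omega: "W z \<in> Omega"
  using upper_half_plane_in_Omega[OF Im_W Im_B_W] z by (simp add: Phi_W)

lemma Re_A_W: "0 < Re (A (W z))"
  using Re_A_pos[OF Im_W Im_B_W] z by (simp add: Phi_W)

end

lemma borel_\<mu>: "f \<in> borel_measurable borel \<Longrightarrow> f \<in> borel_measurable \<mu>"
  using measurable_cong_sets[OF sets_\<mu> refl] by blast

lemma integrable_kernel:
  assumes z: "0 < Im z"
  shows "integrable \<mu> (\<lambda>x. 1 / (complex_of_real x - z))"
proof (rule integrable_const_bound)
  show "AE x in \<mu>. norm (1 / (complex_of_real x - z)) \<le> 1 / Im z"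
  proof (rule AE_I2)
    fix x
    have "Im z \<le> norm (complex_of_real x - z)"
      using abs_Im_le_cmod[of "complex_of_real x - z"] z by simp
    then show "norm (1 / (complex_of_real x - z)) \<le> 1 / Im z"
      using z by (simp add: norm_divide frac_le)
  qed
  show "(\<lambda>x. 1 / (complex_of_real x - z)) \<in> borel_measurable \<mu>"
    by (rule borel_\<mu>) measurable
qed

lemma t_eq: "0 < Im z \<Longrightarrow> t z = (\<integral>x. 1 / (complex_of_real x - z) \<partial>\<mu>)"
  using stieltjes by (simp add: is_stieltjes_transform_def)

text \<open>The Poisson kernel is at least \<open>1 / (2 y)\<close> on the interval.\<close>

lemma measure_interval_le:
  assumes y: "0 < y"
  shows "measure \<mu> {x - y..x + y} \<le> 2 * y * Im (t (Complex x y))"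
proof -
  have Imk: "Im (1 / (complex_of_real u - Complex x y)) = y / ((u - x)\<^sup>2 + y\<^sup>2)" for u
    by (simp add: Im_divide)
  have int: "integrable \<mu> (\<lambda>u. y / ((u - x)\<^sup>2 + y\<^sup>2))"
    using integrable_Im[OF integrable_kernel[of "Complex x y"]] y by (simp only: Imk complex.sel)
  have Imt: "Im (t (Complex x y)) = (\<integral>u. y / ((u - x)\<^sup>2 + y\<^sup>2) \<partial>\<mu>)"
    using integral_Im[OF integrable_kernel[of "Complex x y"]] y t_eq[of "Complex x y"]
    by (simp only: Imk complex.sel)
  have meas: "{x - y..x + y} \<in> sets \<mu>" by (simp add: sets_\<mu>)
  have "measure \<mu> {x - y..x + y} / (2 * y) = (\<integral>u. indicator {x - y..x + y} u / (2 * y) \<partial>\<mu>)"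
    using meas by (simp add: sets.Int_space_eq2)
  also have "\<dots> \<le> (\<integral>u. y / ((u - x)\<^sup>2 + y\<^sup>2) \<partial>\<mu>)"
  proof (rule integral_mono[OF _ int])
    show "integrable \<mu> (\<lambda>u. indicator {x - y..x + y} u / (2 * y))"
      using meas by (intro integrable_divide) (auto simp: less_top[symmetric])
    fix u assume "u \<in> space \<mu>"
    show "indicator {x - y..x + y} u / (2 * y) \<le> y / ((u - x)\<^sup>2 + y\<^sup>2)"
    proof (cases "u \<in> {x - y..x + y}")
      case True
      then have "\<bar>u - x\<bar> \<le> \<bar>y\<bar>" by auto
      then have "(u - x)\<^sup>2 \<le> y\<^sup>2" by (simp add: abs_le_square_iff)
      moreover have "0 < (u - x)\<^sup>2 + y\<^sup>2" using y by (simp add: add_nonneg_pos)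
      ultimately show ?thesis using True y by (simp add: field_simps power2_eq_square)
    qed (use y in simp)
  qed
  also have "\<dots> = Im (t (Complex x y))" by (simp add: Imt)
  finally show ?thesis using y by (simp add: field_simps)
qed

text \<open>Stieltjes inversion by counting: covering the interval by \<open>N\<close> intervals of radius \<open>\<epsilon> /
N\<close> bounds its measure by \<open>2 \<epsilon>\<close> times the supremum of \<open>Im t\<close> at height
\<open>\<epsilon> / N\<close>.\<close>

lemma measure_zero_if_Im_vanishes:
  assumes "0 < \<epsilon>"
    and lim: "\<And>\<eta>. 0 < \<eta> \<Longrightarrow> \<exists>\<delta>>0. \<forall>x y. \<bar>x - x0\<bar> \<le> \<epsilon> \<longrightarrow> 0 < y \<longrightarrow> y < \<delta> \<longrightarrow> Im (t (Complex x y)) \<le> \<eta>"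
  shows "measure \<mu> {x0 - \<epsilon>..x0 + \<epsilon>} = 0"
proof -
  have "measure \<mu> {x0 - \<epsilon>..x0 + \<epsilon>} \<le> 2 * \<epsilon> * \<eta>" if \<eta>: "0 < \<eta>" for \<eta>
  proof -
    obtain \<delta> where \<delta>: "0 < \<delta>"
      "\<And>x y. \<bar>x - x0\<bar> \<le> \<epsilon> \<Longrightarrow> 0 < y \<Longrightarrow> y < \<delta> \<Longrightarrow> Im (t (Complex x y)) \<le> \<eta>"
      using lim[OF \<eta>] by blast
    obtain N :: nat where N': "\<epsilon> / \<delta> < N" using reals_Archimedean2 by blast
    have "0 < \<epsilon> / \<delta>" using assms(1) \<delta>(1) by simp
    then have "0 < real N" using N' by (rule less_trans)
    then have N: "0 < N" "\<epsilon> / \<delta> < N" using N' by auto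
    define y where "y = \<epsilon> / N"
    have y: "0 < y" "y < \<delta>" "N * y = \<epsilon>"
      using N assms(1) \<delta>(1) by (auto simp: y_def field_simps)
    define u where "u j = x0 - \<epsilon> + (2 * real j + 1) * y" for j :: nat
    have cover: "{x0 - \<epsilon>..x0 + \<epsilon>} \<subseteq> (\<Union>j<N. {u j - y..u j + y})"
    proof
      fix x assume x: "x \<in> {x0 - \<epsilon>..x0 + \<epsilon>}"
      define k where "k = nat \<lfloor>(x - (x0 - \<epsilon>)) / (2 * y)\<rfloor>"
      \<comment> \<open>the minimum only matters at the right end point, where \<open>k = N\<close>\<close>
      define j where "j = min k (N - 1)"
      have q: "0 \<le> (x - (x0 - \<epsilon>)) / (2 * y)" using x y by simp
      have k1: "real k \<le> (x - (x0 - \<epsilon>)) / (2 * y)" using q by (simp add: k_def)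
      have k2: "(x - (x0 - \<epsilon>)) / (2 * y) < real k + 1" using q unfolding k_def by linarith
      have k1': "2 * real k * y \<le> x - (x0 - \<epsilon>)" using k1 y by (simp add: field_simps)
      have k2': "x - (x0 - \<epsilon>) < 2 * (real k + 1) * y" using k2 y by (simp add: field_simps)
      have jN: "j < N" using N(1) by (auto simp: j_def min_def)
      moreover have "x \<in> {u j - y..u j + y}"
      proof (cases "k < N")
        case True
        then have "j = k" by (simp add: j_def min_def)
        then show ?thesis using k1' k2' by (simp add: u_def algebra_simps)
      next
        case False
        then have j: "real j = real N - 1" using N by (simp add: j_def min_def of_nat_diff)
        have "2 * real N * y \<le> 2 * real k * y" using False y by (intro mult_right_mono) auto
        moreover have "2 * real N * y = 2 * \<epsilon>" using y by simp
        ultimately have "x = x0 + \<epsilon>" using k1' x by simp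
        moreover have "real j * y + y = \<epsilon>" using y(3) unfolding j by (simp add: algebra_simps)
        moreover have "u j = x0 - \<epsilon> + 2 * (real j * y) + y" by (simp add: u_def algebra_simps)
        ultimately show ?thesis using y by simp
      qed
      ultimately show "x \<in> (\<Union>j<N. {u j - y..u j + y})" by blast
    qed
    have "measure \<mu> {x0 - \<epsilon>..x0 + \<epsilon>} \<le> measure \<mu> (\<Union>j<N. {u j - y..u j + y})"
      using cover by (intro finite_measure_mono) (auto simp: sets_\<mu>)
    also have "\<dots> \<le> (\<Sum>j<N. measure \<mu> {u j - y..u j + y})"
      by (intro finite_measure_subadditive_finite) (auto simp: sets_\<mu>)
    also have "\<dots> \<le> (\<Sum>j<N. 2 * y * \<eta>)"
    proof (rule sum_mono)
      fix j assume "j \<in> {..<N}"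
      then have "real j \<le> real N - 1" by auto
      then have "real j * y \<le> (real N - 1) * y" using y by (intro mult_right_mono) auto
      then have 1: "real j * y \<le> \<epsilon> - y" using y by (simp add: algebra_simps)
      have 2: "0 \<le> real j * y" using y by simp
      have 3: "u j = x0 - \<epsilon> + 2 * (real j * y) + y" by (simp add: u_def algebra_simps)
      have "\<bar>u j - x0\<bar> \<le> \<epsilon>" using 1 2 3 y by linarith
      then have "Im (t (Complex (u j) y)) \<le> \<eta>" using \<delta> y by blast
      then have "2 * y * Im (t (Complex (u j) y)) \<le> 2 * y * \<eta>" using y by simp
      then show "measure \<mu> {u j - y..u j + y} \<le> 2 * y * \<eta>"
        using measure_interval_le[OF y(1), of "u j"] by linarith
    qed
    also have "\<dots> = 2 * (N * y) * \<eta>" by simp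
    finally show ?thesis using y by simp
  qed
  note le = this
  have "measure \<mu> {x0 - \<epsilon>..x0 + \<epsilon>} \<le> 0"
  proof (rule field_le_epsilon)
    fix \<zeta> :: real assume "0 < \<zeta>"
    then show "measure \<mu> {x0 - \<epsilon>..x0 + \<epsilon>} \<le> 0 + \<zeta>"
      using le[of "\<zeta> / (2 * \<epsilon>)"] assms(1) by simp
  qed
  then show ?thesis by (simp add: measure_le_0_iff)
qed

end

section \<open>The support as the complement of the increasing branches\<close>

context positive_spectrum begin

text \<open>The points \<open>w\<close> attached to \<open>t z\<close> cannot escape to infinity: there \<open>A\<close> tends to
the average of the \<open>e i\<close>, while \<open>A w = - z t\<close> would tend to \<open>0\<close>.\<close>

lemma tendsto_A_at_infinity:
  fixes f :: "'b \<Rightarrow> 'a::real_normed_field"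
  assumes "((\<lambda>x. inverse (f x)) \<longlongrightarrow> 0) G" and nz: "\<And>x. f x \<noteq> 0"
  shows "((\<lambda>x. A (f x)) \<longlongrightarrow> of_real ((\<Sum>i<n. e i) / n)) G"
proof -
  have eq: "A w = (\<Sum>i<n. of_real (e i) / (1 - of_real (e i) * inverse w)) / of_nat n" if "w \<noteq> 0" for w :: 'a
  proof -
    have "- (w * (of_real (e i) / (of_real (e i) - w))) = of_real (e i) / (1 - of_real (e i) * inverse w)" for i
    proof -
      have "1 - of_real (e i) * inverse w = - ((of_real (e i) - w) * inverse w)"
        using that by (simp add: field_simps)
      then show ?thesis by (simp add: divide_inverse)
    qed
    then have "- (w * (\<Sum>i<n. of_real (e i) / (of_real (e i) - w))) = (\<Sum>i<n. of_real (e i) / (1 - of_real (e i) * inverse w))"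
      by (simp add: sum_distrib_left flip: sum_negf)
    then show ?thesis by (simp add: A_def F_def minus_divide_left)
  qed
  have "((\<lambda>x. (\<Sum>i<n. of_real (e i) / (1 - of_real (e i) * inverse (f x))) / of_nat n) \<longlongrightarrow>
      (\<Sum>i<n. of_real (e i) / (1 - of_real (e i) * 0)) / of_nat n) G"
    using n_pos by (intro tendsto_intros assms) auto
  then show ?thesis using nz by (simp add: eq)
qed

end

context stieltjes_solution begin

text \<open>Injectivity of \<open>Phi\<close> on \<open>Omega\<close> identifies the point \<open>W z\<close> with the value at
\<open>z\<close> of the inverse function \<open>g\<close>, which is holomorphic near \<open>Phi w0\<close>. So
\<open>t\<close> extends continuously to a neighbourhood of \<open>Phi w0\<close>, and on the real axis the extension
is real because \<open>Phi\<close> maps a real neighbourhood of \<open>w0\<close> onto one of \<open>Phi w0\<close>.\<close>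

lemma support_gap_from_Phi:
  assumes w0: "w0 \<in> D" "0 < h w0"
  shows "\<exists>\<epsilon>>0. emeasure \<mu> (ball (Phi w0) \<epsilon>) = 0"
proof -
  define x0 where "x0 = Phi w0"
  define \<Omega> where "\<Omega> = (Omega :: complex set)"
  have x0: "0 < x0" using w0 c_pos by (simp add: x0_def Phi_def D_def)
  have np: "w0 \<notin> poles" using w0 by (simp add: D_def)
  have \<Omega>_np: "\<Omega> \<inter> poles = {}" by (auto simp: \<Omega>_def Omega_def)
  have inj: "inj_on Phi \<Omega>" unfolding \<Omega>_def by (rule Phi_inj_on_Omega)
  have op: "open \<Omega>" unfolding \<Omega>_def by (rule open_Omega)
  have hol: "Phi holomorphic_on \<Omega>" using \<Omega>_np by (rule holomorphic_on_Phi)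
  obtain g where g: "g holomorphic_on (Phi ` \<Omega>)" "\<And>w. w \<in> \<Omega> \<Longrightarrow> g (Phi w) = w"
    using holomorphic_has_inverse[OF hol op inj] by metis
  define U where "U = Phi ` \<Omega> - {0}"
  have "open (Phi ` \<Omega>)" using open_mapping_thm3[OF hol op inj] .
  then have opU: "open U" unfolding U_def by auto
  define \<tau> where "\<tau> z = - A (g z) / z" for z
  have "(\<lambda>z. - A (g z) / z) holomorphic_on U"
  proof -
    have "g holomorphic_on U" using g(1) by (rule holomorphic_on_subset) (auto simp: U_def)
    moreover have "g ` U \<subseteq> \<Omega>" using g(2) by (auto simp: U_def)
    ultimately have "(A \<circ> g) holomorphic_on U"
      using holomorphic_on_A[OF \<Omega>_np] by (intro holomorphic_on_compose_gen)
    then have "(\<lambda>z. A (g z)) holomorphic_on U" by (simp add: o_def)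
    then show ?thesis by (intro holomorphic_intros) (auto simp: U_def)
  qed
  then have cont: "continuous_on U \<tau>" unfolding \<tau>_def by (rule holomorphic_on_imp_continuous_on)
  have t\<tau>: "t z = \<tau> z" if z: "0 < Im z" for z
  proof -
    have "g z = W z" using g(2)[of "W z"] W_in_Omega[OF z] Phi_W[OF z] by (simp add: \<Omega>_def)
    moreover have "z \<noteq> 0" using z by auto
    ultimately show ?thesis by (simp add: \<tau>_def A_W[OF z])
  qed
  have w0\<Omega>: "of_real w0 \<in> \<Omega>"
    using w0 by (simp add: \<Omega>_def Omega_of_real_iff D_Omega_iff)
  obtain r where r: "0 < r" "ball (of_real w0) r \<subseteq> \<Omega>"
    using op w0\<Omega> open_contains_ball by blast
  have in\<Omega>: "of_real w \<in> \<Omega>" if "\<bar>w - w0\<bar> < r" for w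
  proof -
    have "dist (complex_of_real w0) (of_real w) = \<bar>w - w0\<bar>"
      by (simp add: dist_of_real dist_real_def abs_minus_commute)
    then show ?thesis using that r(2) by auto
  qed
  have dpos: "0 < c * h w0" using w0 c_pos by simp
  obtain d1 where d1: "0 < d1" "\<And>k. 0 < k \<Longrightarrow> k < d1 \<Longrightarrow> Phi w0 < Phi (w0 + k)"
    using DERIV_pos_inc_right[OF DERIV_Phi[OF np] dpos] by blast
  obtain d2 where d2: "0 < d2" "\<And>k. 0 < k \<Longrightarrow> k < d2 \<Longrightarrow> Phi (w0 - k) < Phi w0"
    using DERIV_pos_inc_left[OF DERIV_Phi[OF np] dpos] by blast
  \<comment> \<open>radius small enough for both one-sided monotonicity statements and for the ball inside \<open>\<Omega>\<close>\<close>
  define k where "k = Min {d1, d2, r} / 2"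
  have k: "0 < k" "k < d1" "k < d2" "k < r" using d1(1) d2(1) r(1) by (auto simp: k_def)
  have lo: "Phi (w0 - k) < x0" and hi: "x0 < Phi (w0 + k)"
    using d1(2)[of k] d2(2)[of k] k by (auto simp: x0_def)
  have real_image: "of_real x \<in> U \<and> Im (\<tau> (of_real x)) = 0"
    if x: "Phi (w0 - k) \<le> x" "x \<le> Phi (w0 + k)" "0 < x" for x
  proof -
    have np': "w \<notin> poles" if "w0 - k \<le> w" "w \<le> w0 + k" for w
    proof -
      have "of_real w \<in> \<Omega>" using that k by (intro in\<Omega>) auto
      then have "(of_real w :: complex) \<notin> poles" using \<Omega>_np by auto
      then show ?thesis by simp
    qed
    have "continuous_on {w0 - k..w0 + k} (Phi :: real \<Rightarrow> real)"
      using np' by (intro continuous_on_Phi) auto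
    then obtain w where w: "w0 - k \<le> w" "w \<le> w0 + k" "Phi w = x"
      using IVT'[of Phi "w0 - k" x "w0 + k"] x k by auto
    have w\<Omega>: "of_real w \<in> \<Omega>" using w k by (intro in\<Omega>) auto
    have Px: "Phi (of_real w) = (of_real x :: complex)" using w by simp
    have "of_real x \<in> U" using w\<Omega> x Px[symmetric] by (auto simp: U_def simp del: Phi_of_real)
    moreover have "g (of_real x) = of_real w" using g(2)[OF w\<Omega>] Px by simp
    then have "\<tau> (of_real x) = of_real (- A w / x)" by (simp add: \<tau>_def)
    then have "Im (\<tau> (of_real x)) = 0" by (simp only: Im_complex_of_real)
    ultimately show ?thesis by blast
  qed
  have "of_real x0 \<in> U" using real_image[of x0] lo hi x0 by auto
  then obtain \<rho> where \<rho>: "0 < \<rho>" "ball (of_real x0) \<rho> \<subseteq> U" using opU open_contains_ball by blast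
  define \<epsilon> where "\<epsilon> = Min {\<rho> / 3, x0 / 2, x0 - Phi (w0 - k), Phi (w0 + k) - x0}"
  have \<epsilon>: "0 < \<epsilon>" "\<epsilon> \<le> \<rho> / 3" "\<epsilon> \<le> x0 / 2" "\<epsilon> \<le> x0 - Phi (w0 - k)" "\<epsilon> \<le> Phi (w0 + k) - x0"
  proof -
    show "0 < \<epsilon>" using \<rho> x0 lo hi by (simp add: \<epsilon>_def)
    show "\<epsilon> \<le> \<rho> / 3" "\<epsilon> \<le> x0 / 2" "\<epsilon> \<le> x0 - Phi (w0 - k)" "\<epsilon> \<le> Phi (w0 + k) - x0"
      unfolding \<epsilon>_def by (rule Min_le; simp)+
  qed
  define Q where "Q = cbox (Complex (x0 - \<epsilon>) 0) (Complex (x0 + \<epsilon>) \<epsilon>)"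
  have Q_iff: "Complex x y \<in> Q \<longleftrightarrow> \<bar>x - x0\<bar> \<le> \<epsilon> \<and> 0 \<le> y \<and> y \<le> \<epsilon>" for x y
    by (auto simp: Q_def in_cbox_complex_iff)
  have QU: "Q \<subseteq> U"
  proof
    fix z assume "z \<in> Q"
    then have z: "\<bar>Re z - x0\<bar> \<le> \<epsilon>" "0 \<le> Im z" "Im z \<le> \<epsilon>"
      using Q_iff[of "Re z" "Im z"] by auto
    have "dist (of_real x0) z \<le> \<bar>Re z - x0\<bar> + \<bar>Im z\<bar>"
      using cmod_le[of "z - of_real x0"] by (simp add: dist_norm norm_minus_commute)
    also have "\<dots> < \<rho>" using z \<epsilon> by linarith
    finally show "z \<in> U" using \<rho> by auto
  qed
  have "uniformly_continuous_on Q \<tau>"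
    by (intro compact_uniformly_continuous continuous_on_subset[OF cont QU]) (simp add: Q_def)
  note uc = this[unfolded uniformly_continuous_on_def, rule_format]
  have "measure \<mu> {x0 - \<epsilon>..x0 + \<epsilon>} = 0"
  proof (rule measure_zero_if_Im_vanishes[OF \<epsilon>(1)])
    fix \<eta> :: real assume "0 < \<eta>"
    then obtain d where d: "0 < d" "\<And>u v. u \<in> Q \<Longrightarrow> v \<in> Q \<Longrightarrow> dist v u < d \<Longrightarrow> dist (\<tau> v) (\<tau> u) < \<eta>"
      using uc by meson
    have "Im (t (Complex x y)) \<le> \<eta>" if x: "\<bar>x - x0\<bar> \<le> \<epsilon>" and y: "0 < y" "y < min d \<epsilon>" for x y
    proof -
      have eq: "Complex x 0 = of_real x" by (simp add: complex_eq_iff)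
      have "dist (Complex x y) (Complex x 0) < d"
        using y by (simp add: dist_norm complex_diff cmod_def)
      then have "dist (\<tau> (Complex x y)) (\<tau> (Complex x 0)) < \<eta>"
        using x y \<epsilon> by (intro d(2)) (auto simp: Q_iff)
      then have "\<bar>Im (\<tau> (Complex x y) - \<tau> (Complex x 0))\<bar> < \<eta>"
        unfolding dist_norm using abs_Im_le_cmod le_less_trans by blast
      moreover have "Im (\<tau> (Complex x 0)) = 0"
        unfolding eq using real_image[of x] x \<epsilon> x0 by auto
      ultimately show ?thesis using t\<tau>[of "Complex x y"] y by simp
    qed
    then show "\<exists>\<delta>>0. \<forall>x y. \<bar>x - x0\<bar> \<le> \<epsilon> \<longrightarrow> 0 < y \<longrightarrow> y < \<delta> \<longrightarrow> Im (t (Complex x y)) \<le> \<eta>"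
      using d(1) \<epsilon>(1) by (intro exI[of _ "min d \<epsilon>"]) auto
  qed
  then have "emeasure \<mu> {x0 - \<epsilon>..x0 + \<epsilon>} = 0" by (simp add: emeasure_eq_measure)
  moreover have "ball x0 \<epsilon> \<subseteq> {x0 - \<epsilon>..x0 + \<epsilon>}"
    by (intro subsetI) (simp add: ball_eq_greaterThanLessThan)
  then have "emeasure \<mu> (ball x0 \<epsilon>) \<le> emeasure \<mu> {x0 - \<epsilon>..x0 + \<epsilon>}"
    by (intro emeasure_mono) (simp_all add: sets_\<mu>)
  ultimately have "emeasure \<mu> (ball x0 \<epsilon>) = 0" by simp
  then show ?thesis using \<epsilon>(1) by (auto simp: x0_def)
qed

text \<open>The linear rate is what later excludes a critical point: it makes the points \<open>W z\<close> approach their limit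
at least as fast as \<open>z\<close> approaches \<open>x0\<close>.\<close>

lemma t_boundary_value:
  assumes d: "0 < d" and null: "emeasure \<mu> (ball x0 d) = 0"
  obtains t0 K :: real where "\<And>y. 0 < y \<Longrightarrow> norm (t (Complex x0 y) - of_real t0) \<le> K * y" "0 \<le> K"
    "x0 = 0 \<Longrightarrow> 0 \<le> t0"
proof -
  have far: "AE x in \<mu>. d \<le> \<bar>x - x0\<bar>"
    by (rule AE_I[OF _ null]) (auto simp: sets_\<mu> dist_real_def abs_minus_commute)
  define t0 where "t0 = (\<integral>x. 1 / (x - x0) \<partial>\<mu>)"
  have int0: "integrable \<mu> (\<lambda>x. 1 / (x - x0))"
  proof (rule integrable_const_bound)
    show "AE x in \<mu>. norm (1 / (x - x0)) \<le> 1 / d"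
      using far by eventually_elim (use d in \<open>simp add: frac_le\<close>)
    show "(\<lambda>x. 1 / (x - x0)) \<in> borel_measurable \<mu>" by (rule borel_\<mu>) measurable
  qed
  have int0c: "integrable \<mu> (\<lambda>x. complex_of_real (1 / (x - x0)))"
    using int0 by (rule integrable_of_real)
  have t0: "of_real t0 = (\<integral>x. complex_of_real (1 / (x - x0)) \<partial>\<mu>)"
    unfolding t0_def by (rule integral_of_real[symmetric]) (rule int0)
  define K where "K = measure \<mu> (space \<mu>) / d\<^sup>2"
  have bound: "norm (t (Complex x0 y) - of_real t0) \<le> K * y" if y: "0 < y" for y
  proof -
    define z where "z = Complex x0 y"
    have z: "0 < Im z" using y by (simp add: z_def)
    have "norm (t z - of_real t0) = norm (\<integral>x. 1 / (complex_of_real x - z) - complex_of_real (1 / (x - x0)) \<partial>\<mu>)"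
      unfolding t_eq[OF z] t0 using integrable_kernel[OF z] int0c by simp
    also have "\<dots> \<le> (\<integral>x. norm (1 / (complex_of_real x - z) - complex_of_real (1 / (x - x0))) \<partial>\<mu>)"
      by (rule integral_norm_bound)
    also have "\<dots> \<le> (\<integral>x. y / d\<^sup>2 \<partial>\<mu>)"
    proof (rule integral_mono_AE)
      show "integrable \<mu> (\<lambda>x. norm (1 / (complex_of_real x - z) - complex_of_real (1 / (x - x0))))"
        using integrable_kernel[OF z] int0c by (intro integrable_norm Bochner_Integration.integrable_diff)
      show "integrable \<mu> (\<lambda>x. y / d\<^sup>2)" by simp
      show "AE x in \<mu>. norm (1 / (complex_of_real x - z) - complex_of_real (1 / (x - x0))) \<le> y / d\<^sup>2"
        using far
      proof eventually_elim
        case (elim x)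
        have 1: "d \<le> norm (complex_of_real x - of_real x0)"
          using elim by (metis norm_of_real of_real_diff)
        have 2: "d \<le> norm (complex_of_real x - z)"
          using elim abs_Re_le_cmod[of "complex_of_real x - z"] by (simp add: z_def)
        have nz: "complex_of_real x - of_real x0 \<noteq> 0" "complex_of_real x - z \<noteq> 0"
          using 1 2 d by auto
        have "1 / (complex_of_real x - z) - complex_of_real (1 / (x - x0))
            = (z - of_real x0) / ((complex_of_real x - z) * (complex_of_real x - of_real x0))"
          using nz by (simp add: divide_simps)
        also have "norm \<dots> = y / (norm (complex_of_real x - z) * norm (complex_of_real x - of_real x0))"
        proof -
          have "norm (z - of_real x0) = y" using y by (simp add: z_def cmod_def)
          then show ?thesis by (simp add: norm_divide norm_mult)
        qed
        also have "\<dots> \<le> y / d\<^sup>2"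
          unfolding power2_eq_square using 1 2 d y by (intro divide_left_mono mult_mono mult_pos_pos) auto
        finally show ?case .
      qed
    qed
    also have "\<dots> = K * y" by (simp add: K_def)
    finally show ?thesis by (simp add: z_def)
  qed
  have "0 \<le> t0" if "x0 = 0"
  proof -
    have "AE x in \<mu>. 0 \<le> x"
      by (rule AE_I[OF _ \<mu>_neg]) (auto simp: sets_\<mu>)
    then have "AE x in \<mu>. 0 \<le> 1 / (x - x0)"
      by eventually_elim (simp add: that)
    then show ?thesis unfolding t0_def by (rule integral_nonneg_AE)
  qed
  moreover have "0 \<le> K" by (simp add: K_def)
  ultimately show thesis using that bound by blast
qed

text \<open>The witness \<open>w0\<close> is the limit of \<open>W z\<close> as \<open>z\<close> tends to \<open>x0\<close>
vertically. It is finite and not an eigenvalue since \<open>A (W z) = - z t z\<close> converges to \<open>- x0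
t0\<close>. The closed inequality \<open>h w0 \<ge> 0\<close> passes to the limit, and \<open>h w0 = 0\<close> is
impossible: then \<open>Phi (W z) - Phi w0 = z - x0\<close> would be of smaller order than \<open>W z - w0\<close>,
against the linear rate. For \<open>x0 = 0\<close> the limit would be a negative number at which \<open>F\<close>
vanishes.\<close>

lemma boundary_preimage:
  assumes d: "0 < d" and null: "emeasure \<mu> (ball x0 d) = 0" and x0: "0 \<le> x0"
  shows "0 < x0 \<and> (\<exists>w0\<in>D. 0 < h w0 \<and> Phi w0 = x0)"
proof -
  obtain t0 K :: real where tK: "\<And>y. 0 < y \<Longrightarrow> norm (t (Complex x0 y) - of_real t0) \<le> K * y" "0 \<le> K"
    and t0_nonneg: "x0 = 0 \<Longrightarrow> 0 \<le> t0"
    using t_boundary_value[OF d null] by blast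
  define G where "G = at_right (0::real)"
  have G: "G \<noteq> bot" by (simp add: G_def)
  have ev: "\<forall>\<^sub>F y in G. 0 < y" by (simp add: G_def eventually_at_right_less)
  have idG: "((\<lambda>y. y) \<longlongrightarrow> 0) G" unfolding G_def by (rule tendsto_ident_at)
  define zz where "zz y = Complex x0 y" for y
  define ty where "ty y = t (zz y)" for y
  define Wy where "Wy y = W (zz y)" for y
  have Imz: "0 < Im (zz y)" if "0 < y" for y using that by (simp add: zz_def)
  have zz: "(zz \<longlongrightarrow> of_real x0) G"
  proof -
    have "((\<lambda>y. Complex x0 y) \<longlongrightarrow> Complex x0 0) G" by (intro tendsto_Complex tendsto_const idG)
    then show ?thesis by (simp add: zz_def[abs_def] complex_of_real_def)
  qed
  have ty: "(ty \<longlongrightarrow> of_real t0) G"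
  proof (rule LIM_zero_cancel, rule Lim_null_comparison)
    show "\<forall>\<^sub>F y in G. norm (ty y - of_real t0) \<le> K * y"
      using ev by eventually_elim (simp add: ty_def zz_def tK)
    show "((\<lambda>y. K * y) \<longlongrightarrow> 0) G" using tendsto_mult_right_zero[OF idG] by simp
  qed
  have AW: "\<forall>\<^sub>F y in G. A (Wy y) = - (zz y * ty y)"
    using ev by eventually_elim (simp add: A_W Imz Wy_def ty_def)
  have zt: "((\<lambda>y. - (zz y * ty y)) \<longlongrightarrow> - (of_real x0 * of_real t0)) G"
    by (intro tendsto_intros zz ty)
  have AW': "((\<lambda>y. A (Wy y)) \<longlongrightarrow> - (of_real x0 * of_real t0)) G"
    using tendsto_cong[OF AW] zt by simp
  have Wy: "Wy y = zz y * of_real c * ty y - 1 / (of_real c * ty y)" for y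
    by (simp add: Wy_def W_def ty_def)
  have t0: "t0 \<noteq> 0"
  proof
    assume t0: "t0 = 0"
    have "((\<lambda>y. of_real c * ty y / (zz y * (of_real c * ty y)\<^sup>2 - 1)) \<longlongrightarrow>
        of_real c * of_real t0 / (of_real x0 * (of_real c * of_real t0)\<^sup>2 - 1)) G"
      using t0 by (intro tendsto_intros zz ty) auto
    moreover have "\<forall>\<^sub>F y in G. of_real c * ty y / (zz y * (of_real c * ty y)\<^sup>2 - 1) = inverse (Wy y)"
      using ev
    proof eventually_elim
      case (elim y)
      have "of_real c * ty y \<noteq> 0" using t_nz[OF Imz[OF elim]] c_pos by (simp add: ty_def)
      then have "Wy y = (zz y * (of_real c * ty y)\<^sup>2 - 1) / (of_real c * ty y)"
        by (simp add: Wy field_simps power2_eq_square)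
      then show ?case by simp
    qed
    ultimately have inv: "((\<lambda>y. inverse (Wy y)) \<longlongrightarrow> 0) G"
      using t0 tendsto_cong by force
    \<comment> \<open>a variant without zeros, equal to \<open>Wy\<close> for all small positive \<open>y\<close>\<close>
    define V where "V y = (if Wy y = 0 then 1 else Wy y)" for y
    have VW: "\<forall>\<^sub>F y in G. V y = Wy y"
      using ev
    proof eventually_elim
      case (elim y)
      have "0 < Im (Wy y)" using Im_W[OF Imz[OF elim]] by (simp add: Wy_def)
      then show ?case by (auto simp: V_def)
    qed
    have "((\<lambda>y. inverse (V y)) \<longlongrightarrow> 0) G"
      using inv by (rule Lim_transform_eventually) (use VW in eventually_elim, simp)
    then have "((\<lambda>y. A (V y)) \<longlongrightarrow> of_real ((\<Sum>i<n. e i) / n)) G"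
      by (rule tendsto_A_at_infinity) (simp add: V_def)
    then have "((\<lambda>y. A (Wy y)) \<longlongrightarrow> of_real ((\<Sum>i<n. e i) / n)) G"
      by (rule Lim_transform_eventually) (use VW in eventually_elim, simp)
    from tendsto_unique[OF G this AW'] t0 have "(\<Sum>i<n. e i) / n = 0"
      by (metis mult_zero_right neg_equal_0_iff_equal of_real_0 of_real_eq_iff)
    moreover have "0 < (\<Sum>i<n. e i)" using n_pos e_pos by (intro sum_pos) auto
    ultimately show False using n_pos by simp
  qed
  define w0 where "w0 = x0 * c * t0 - 1 / (c * t0)"
  have W0: "(Wy \<longlongrightarrow> of_real w0) G"
  proof -
    have "((\<lambda>y. zz y * of_real c * ty y - 1 / (of_real c * ty y)) \<longlongrightarrow>
        of_real x0 * of_real c * of_real t0 - 1 / (of_real c * of_real t0)) G"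
      using t0 c_pos by (intro tendsto_intros zz ty) auto
    then show ?thesis by (simp add: Wy[abs_def] w0_def)
  qed
  have np: "w0 \<notin> poles"
  proof
    assume "w0 \<in> poles"
    from F_residue[OF this, where 'a = complex] obtain \<kappa> where \<kappa>: "0 < \<kappa>"
      "((\<lambda>w. (of_real w0 - w) * F w) \<longlongrightarrow> complex_of_real \<kappa>) (at (of_real w0))" by blast
    have "filterlim Wy (at (of_real w0)) G"
      unfolding filterlim_at using W0 ev
    proof (intro conjI)
      show "\<forall>\<^sub>F y in G. Wy y \<in> UNIV \<and> Wy y \<noteq> of_real w0"
        using ev
      proof eventually_elim
        case (elim y)
        have "0 < Im (Wy y)" using Im_W[OF Imz[OF elim]] by (simp add: Wy_def)
        then show ?case by auto
      qed
    qed
    from filterlim_compose[OF \<kappa>(2) this]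
    have "((\<lambda>y. - Wy y * ((of_real w0 - Wy y) * F (Wy y))) \<longlongrightarrow> - of_real w0 * of_real \<kappa>) G"
      by (intro tendsto_intros W0)
    moreover have "((\<lambda>y. (of_real w0 - Wy y) * A (Wy y)) \<longlongrightarrow> (of_real w0 - of_real w0) * - (of_real x0 * of_real t0)) G"
      by (intro tendsto_intros W0 AW')
    then have "((\<lambda>y. - Wy y * ((of_real w0 - Wy y) * F (Wy y))) \<longlongrightarrow> 0) G"
      by (simp add: A_def mult_ac)
    ultimately have "- of_real w0 * complex_of_real \<kappa> = 0" by (rule tendsto_unique[OF G])
    then have "w0 = 0" using \<kappa>(1) by simp
    moreover have "0 < w0" using \<open>w0 \<in> poles\<close> e_pos by (auto simp: poles_iff)
    ultimately show False by simp
  qed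
  have npc: "complex_of_real w0 \<notin> poles" using np by simp
  have A0: "A w0 = - (x0 * t0)"
  proof -
    have "A (complex_of_real w0) = - (of_real x0 * of_real t0)"
      using tendsto_unique[OF G tendsto_A[OF W0 npc] AW'] .
    then show ?thesis by (metis A_of_real of_real_eq_iff of_real_minus of_real_mult)
  qed
  have B0: "B w0 = - (1 / (c * t0))"
    unfolding B_def A0 by (simp add: w0_def)
  have Phi0: "Phi w0 = x0" using t0 c_pos by (simp add: Phi_def A0 B0)
  have "x0 \<noteq> 0"
  proof
    assume "x0 = 0"
    then have "0 < t0" using t0_nonneg t0 by simp
    then have w0: "w0 < 0" using c_pos by (simp add: w0_def \<open>x0 = 0\<close>)
    have "0 < (\<Sum>i<n. e i / (e i - w0))"
      using n_pos e_pos w0 by (intro sum_pos) (auto intro!: divide_pos_pos add_pos_pos simp: less_trans[of w0 0])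
    then have "0 < F w0" using n_pos by (simp add: F_def)
    then show False using A0 w0 \<open>x0 = 0\<close> by (simp add: A_def)
  qed
  then have x0_pos: "0 < x0" using x0 by simp
  have "0 \<le> A w0"
  proof -
    have "((\<lambda>y. Re (A (Wy y))) \<longlongrightarrow> Re (A (complex_of_real w0))) G"
      by (intro tendsto_Re tendsto_A[OF W0 npc])
    then have lim: "((\<lambda>y. Re (A (Wy y))) \<longlongrightarrow> A w0) G" by simp
    show ?thesis
    proof (rule tendsto_lowerbound[OF lim _ G])
      show "\<forall>\<^sub>F y in G. 0 \<le> Re (A (Wy y))"
        using ev by eventually_elim (simp add: Wy_def Re_A_W Imz less_imp_le)
    qed
  qed
  moreover have "A w0 \<noteq> 0" using A0 x0_pos t0 by simp
  ultimately have A_pos: "0 < A w0" by simp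
  then have "t0 < 0" using A0 x0_pos by (simp add: mult_less_0_iff)
  then have B_pos: "0 < B w0" using c_pos by (simp add: B0 mult_pos_neg)
  have D: "w0 \<in> D" using np A_pos B_pos by (simp add: D_def)
  have "0 \<le> h w0"
  proof -
    define f where "f w = norm (A w) - S w * (norm (B w) + c * norm (A w))" for w :: complex
    have lim: "((\<lambda>y. f (Wy y)) \<longlongrightarrow> f (of_real w0)) G"
      unfolding f_def by (intro tendsto_intros tendsto_A tendsto_B tendsto_S W0 npc)
    have "0 \<le> f (of_real w0)"
    proof (rule tendsto_lowerbound[OF lim _ G])
      show "\<forall>\<^sub>F y in G. 0 \<le> f (Wy y)"
        using ev
      proof eventually_elim
        case (elim y)
        then show ?case using W_in_Omega[OF Imz[OF elim]] by (simp add: f_def Omega_def Wy_def)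
      qed
    qed
    then show ?thesis using A_pos B_pos by (simp add: f_def h_def)
  qed
  moreover have "h w0 \<noteq> 0"
  proof
    assume h0: "h w0 = 0"
    \<comment> \<open>\<open>R\<close> is the difference quotient of \<open>Phi\<close>, up to the factor \<open>c\<close>; \<open>q y\<close> bounds the quotient of \<open>Wy y - w0\<close> by \<open>y\<close>\<close>
    define R where "R y = A (Wy y) - T (of_real w0) (Wy y) * (of_real c * A (Wy y) + B (of_real w0))" for y
    define q where "q y = c * (norm (zz y) * K + \<bar>t0\<bar>) + K / (c * (norm (ty y) * \<bar>t0\<bar>))" for y
    have T0: "T (complex_of_real w0) (of_real w0) = of_real (S w0)"
      using T_cnj[of "of_real w0"] by simp
    have R: "(R \<longlongrightarrow> 0) G"
    proof -
      have "(R \<longlongrightarrow> A (of_real w0) - T (of_real w0) (of_real w0) * (of_real c * A (of_real w0) + B (of_real w0))) G"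
        unfolding R_def by (intro tendsto_intros tendsto_A tendsto_T W0 npc)
      moreover have "A (of_real w0) - T (of_real w0) (of_real w0) * (of_real c * A (of_real w0) + B (of_real w0))
          = complex_of_real (h w0)"
        unfolding T0 by (simp add: h_def algebra_simps)
      ultimately show ?thesis by (simp add: h0)
    qed
    define q0 where "q0 = c * (norm (complex_of_real x0) * K + \<bar>t0\<bar>) + K / (c * (norm (complex_of_real t0) * \<bar>t0\<bar>))"
    have q: "(q \<longlongrightarrow> q0) G"
      unfolding q_def q0_def using t0 c_pos by (intro tendsto_intros zz ty) auto
    have "\<forall>\<^sub>F y in G. 1 \<le> c * q y * norm (R y)"
      using ev
    proof eventually_elim
      case (elim y)
      have ty0: "ty y \<noteq> 0" using t_nz[OF Imz[OF elim]] by (simp add: ty_def)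
      have dt: "norm (ty y - of_real t0) \<le> K * y" using tK(1)[OF elim] by (simp add: ty_def zz_def)
      have zx: "zz y - of_real x0 = \<i> * of_real y" by (simp add: zz_def complex_eq_iff)
      have "Wy y - of_real w0 = of_real c * (zz y * (ty y - of_real t0) + (zz y - of_real x0) * of_real t0)
          + (ty y - of_real t0) / (of_real c * (ty y * of_real t0))"
        using ty0 t0 c_pos by (simp add: Wy w0_def field_simps)
      also have "norm \<dots> \<le> c * (norm (zz y) * (K * y) + y * \<bar>t0\<bar>) + K * y / (c * (norm (ty y) * \<bar>t0\<bar>))"
      proof (intro order_trans[OF norm_triangle_ineq] add_mono)
        have "norm (zz y * (ty y - of_real t0) + (zz y - of_real x0) * of_real t0)
            \<le> norm (zz y) * (K * y) + y * \<bar>t0\<bar>"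
          unfolding zx using elim
          by (intro order_trans[OF norm_triangle_ineq] add_mono) (simp_all add: norm_mult dt mult_left_mono)
        then show "norm (of_real c * (zz y * (ty y - of_real t0) + (zz y - of_real x0) * of_real t0))
            \<le> c * (norm (zz y) * (K * y) + y * \<bar>t0\<bar>)"
          using c_pos by (simp only: norm_mult norm_of_real abs_of_pos mult_left_mono less_imp_le)
        show "norm ((ty y - of_real t0) / (of_real c * (ty y * of_real t0)))
            \<le> K * y / (c * (norm (ty y) * \<bar>t0\<bar>))"
          using dt c_pos by (simp add: norm_divide norm_mult divide_right_mono)
      qed
      also have "\<dots> = q y * y" by (simp add: q_def algebra_simps add_divide_distrib)
      finally have nW: "norm (Wy y - of_real w0) \<le> q y * y" .
      have npW: "Wy y \<notin> poles"
        using Im_W[OF Imz[OF elim]] by (intro Im_in_poles) (simp add: Wy_def)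
      have "zz y - of_real x0 = Phi (Wy y) - Phi (of_real w0)"
        using Phi_W[OF Imz[OF elim]] Phi0 by (simp add: Wy_def)
      also have "\<dots> = of_real c * (Wy y - of_real w0) * R y"
        unfolding R_def by (rule Phi_diff[OF npc npW])
      finally have "norm (zz y - of_real x0) = c * norm (Wy y - of_real w0) * norm (R y)"
        using c_pos by (simp add: norm_mult)
      then have "y = c * norm (Wy y - of_real w0) * norm (R y)"
        unfolding zx using elim by (simp add: norm_mult)
      also have "\<dots> \<le> c * (q y * y) * norm (R y)"
        using nW c_pos by (intro mult_right_mono mult_left_mono) auto
      finally have "1 * y \<le> (c * q y * norm (R y)) * y" by (simp add: mult_ac)
      then show ?case using elim by (rule mult_right_le_imp_le)
    qed
    moreover have "((\<lambda>y. c * q y * norm (R y)) \<longlongrightarrow>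
       c * q0 * norm (0::complex)) G"
      by (intro tendsto_intros q R)
    ultimately have "1 \<le> c * q0 * norm (0::complex)"
      using tendsto_lowerbound[OF _ _ G] by blast
    then show False by simp
  qed
  ultimately show ?thesis using x0_pos D Phi0 by force
qed

lemma measure_support_iff:
  "measure_support \<mu> = {x. 0 \<le> x \<and> x \<notin> Phi ` {w \<in> D. 0 < h w}}"
proof (intro subset_antisym subsetI)
  fix x assume x: "x \<in> measure_support \<mu>"
  have pos: "0 < emeasure \<mu> (ball x d)" if "0 < d" for d
    using x that by (simp add: measure_support_def)
  have "0 \<le> x"
  proof (rule ccontr)
    assume neg: "\<not> 0 \<le> x"
    have "emeasure \<mu> (ball x (- x)) \<le> emeasure \<mu> {..<0}"
      using neg by (intro emeasure_mono) (auto simp: sets_\<mu> dist_real_def abs_if split: if_splits)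
    then show False using pos[of "- x"] neg \<mu>_neg by simp
  qed
  moreover have "x \<notin> Phi ` {w \<in> D. 0 < h w}"
    using support_gap_from_Phi pos by fastforce
  ultimately show "x \<in> {x. 0 \<le> x \<and> x \<notin> Phi ` {w \<in> D. 0 < h w}}" by simp
next
  fix x assume x: "x \<in> {x. 0 \<le> x \<and> x \<notin> Phi ` {w \<in> D. 0 < h w}}"
  have "0 < emeasure \<mu> (ball x d)" if d: "0 < d" for d
  proof (rule ccontr)
    assume "\<not> 0 < emeasure \<mu> (ball x d)"
    then have "emeasure \<mu> (ball x d) = 0" by (simp add: not_gr_zero)
    from boundary_preimage[OF d this] x show False by auto
  qed
  then show "x \<in> measure_support \<mu>" by (simp add: measure_support_def)
qed

end

section \<open>Enumeration of the spectral gaps\<close>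

lemma sorted_wrt_concat_pairs:
  fixes f g :: "'a \<Rightarrow> real"
  assumes "\<And>j. j \<in> set js \<Longrightarrow> f j < g j" and "sorted_wrt (\<lambda>i j. g i < f j) js"
  shows "sorted_wrt (<) (concat (map (\<lambda>j. [f j, g j]) js))"
  using assms
proof (induction js)
  case (Cons k js)
  have "f k < f j" "f k < g j" "g k < f j" "g k < g j" if "j \<in> set js" for j
    using Cons.prems(1)[of k] Cons.prems(1)[of j] Cons.prems(2) that by fastforce+
  with Cons show ?case by auto
qed simp

lemma nth_concat_pairs:
  "i < length js \<Longrightarrow> concat (map (\<lambda>j. [f j, g j]) js) ! (2 * i) = f (js ! i) \<and>
     concat (map (\<lambda>j. [f j, g j]) js) ! (2 * i + 1) = g (js ! i)"
proof (induction js arbitrary: i)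
  case (Cons k js)
  then show ?case by (cases i) auto
qed simp

lemma length_concat_pairs: "length (concat (map (\<lambda>j. [f j, g j]) js)) = 2 * length js"
  by (induction js) auto

text \<open>The final bookkeeping: removing the ordered open gaps \<open>(x p, y p)\<close> from \<open>[L, U]\<close> leaves the
closed intervals between consecutive gaps.\<close>

lemma interval_minus_ordered_gaps:
  fixes x y :: "nat \<Rightarrow> real"
  assumes xy: "\<And>p. p < q \<Longrightarrow> x p < y p" and yx: "\<And>p p'. p < p' \<Longrightarrow> p' < q \<Longrightarrow> y p < x p'"
    and L: "\<And>p. p < q \<Longrightarrow> L \<le> x p" and U: "\<And>p. p < q \<Longrightarrow> y p \<le> U"
  shows "{s. L \<le> s \<and> s \<le> U \<and> (\<forall>p<q. \<not> (x p < s \<and> s < y p))} =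
    (if q = 0 then {L..U} else {L..x 0} \<union> (\<Union>p\<in>{1..<q}. {y (p - 1)..x p}) \<union> {y (q - 1)..U})"
    (is "?S = ?I")
proof (cases "q = 0")
  case False
  have ymono: "y p \<le> y p'" if "p \<le> p'" "p' < q" for p p'
    using yx[of p p'] xy[of p'] that by (cases "p = p'") auto
  have xmono: "x p \<le> x p'" if "p \<le> p'" "p' < q" for p p'
    using yx[of p p'] xy[of p] that by (cases "p = p'") auto
  have 1: "?S \<subseteq> {L..x 0} \<union> (\<Union>p\<in>{1..<q}. {y (p - 1)..x p}) \<union> {y (q - 1)..U}"
  proof
    fix s assume "s \<in> ?S"
    then have s: "L \<le> s" "s \<le> U" "\<And>p. p < q \<Longrightarrow> s \<le> x p \<or> y p \<le> s" by force+
    show "s \<in> {L..x 0} \<union> (\<Union>p\<in>{1..<q}. {y (p - 1)..x p}) \<union> {y (q - 1)..U}"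
    proof (cases "s \<le> x 0")
      case False
      define j where "j = Max {p. p < q \<and> y p \<le> s}"
      have "0 \<in> {p. p < q \<and> y p \<le> s}" using s(3)[of 0] False \<open>q \<noteq> 0\<close> by auto
      then have "j \<in> {p. p < q \<and> y p \<le> s}" unfolding j_def by (intro Max_in) auto
      then have j: "j < q" "y j \<le> s" by auto
      show ?thesis
      proof (cases "Suc j < q")
        case True
        have "\<not> y (Suc j) \<le> s"
        proof
          assume "y (Suc j) \<le> s"
          then have "Suc j \<le> j" unfolding j_def using True by (intro Max_ge) (auto simp: j_def)
          then show False by simp
        qed
        then have "s \<in> {y (Suc j - 1)..x (Suc j)}" using s(3)[OF True] j by auto
        then show ?thesis using True by force
      next
        case False
        then have "j = q - 1" using j by simp
        then show ?thesis using j s by auto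
      qed
    qed (use s in auto)
  qed
  have 2: "{L..x 0} \<subseteq> ?S"
  proof
    fix s assume s: "s \<in> {L..x 0}"
    have "s \<le> U" using s xy[of 0] U[of 0] False by auto
    moreover have "s \<le> x p" if "p < q" for p using xmono[of 0 p] that s by auto
    ultimately show "s \<in> ?S" using s by force
  qed
  have 3: "{y (p - 1)..x p} \<subseteq> ?S" if p: "p \<in> {1..<q}" for p
  proof
    fix s assume s: "s \<in> {y (p - 1)..x p}"
    have "p - 1 < q" using p by auto
    then have "L \<le> s" "s \<le> U"
      using s p L[of "p - 1"] xy[of "p - 1"] xy[of p] U[of p] by auto
    moreover have "\<not> (x p' < s \<and> s < y p')" if "p' < q" for p'
    proof (cases "p \<le> p'")
      case True
      then show ?thesis using xmono[OF True] that s by auto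
    next
      case False
      then have "y p' \<le> y (p - 1)" using p by (intro ymono) auto
      then show ?thesis using s by auto
    qed
    ultimately show "s \<in> ?S" by blast
  qed
  have 4: "{y (q - 1)..U} \<subseteq> ?S"
  proof
    fix s assume s: "s \<in> {y (q - 1)..U}"
    have "L \<le> s" using s xy[of "q - 1"] L[of "q - 1"] False by auto
    moreover have "y p \<le> s" if p: "p < q" for p
    proof -
      have "p \<le> q - 1" using p by simp
      then have "y p \<le> y (q - 1)" using p by (intro ymono) auto
      then show ?thesis using s by simp
    qed
    ultimately show "s \<in> ?S" using s by force
  qed
  show ?thesis
    unfolding if_not_P[OF False] by (intro subset_antisym Un_least UN_least 1 2 3 4)
qed auto

lemma sorted_list_position:
  fixes w :: real
  assumes X: "finite X" and w: "w \<notin> X"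
  obtains "\<And>l. l \<in> X \<Longrightarrow> w < l" | "\<And>l. l \<in> X \<Longrightarrow> l < w"
  | j where "Suc j < card X" "sorted_list_of_set X ! j < w" "w < sorted_list_of_set X ! Suc j"
proof -
  define ls where "ls = sorted_list_of_set X"
  have ls: "set ls = X" "length ls = card X" "sorted ls" using X by (auto simp: ls_def)
  have mem: "\<exists>j<card X. l = ls ! j" if "l \<in> X" for l
    using that ls(1,2) by (metis in_set_conv_nth)
  define J where "J = {j. j < card X \<and> ls ! j < w}"
  consider "J = {}" | "J \<noteq> {}" "Suc (Max J) < card X" | "J \<noteq> {}" "\<not> Suc (Max J) < card X" by blast
  then show thesis
  proof cases
    case 1
    have "w < l" if "l \<in> X" for l
      using mem[OF that] 1 that w unfolding J_def by (metis (mono_tags, lifting) empty_Collect_eq linorder_neqE)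
    then show thesis using that(1) by blast
  next
    case 2
    have "Max J \<in> J" using 2 by (intro Max_in) (auto simp: J_def)
    then have lo: "ls ! Max J < w" by (simp add: J_def)
    have "Suc (Max J) \<notin> J"
    proof
      assume "Suc (Max J) \<in> J"
      then have "Suc (Max J) \<le> Max J" by (intro Max_ge) (auto simp: J_def)
      then show False by simp
    qed
    then have "w \<le> ls ! Suc (Max J)" using 2 by (simp add: J_def)
    moreover have "ls ! Suc (Max J) \<in> X" using 2 ls nth_mem by metis
    ultimately have "w < ls ! Suc (Max J)" using w by (metis less_le)
    then show thesis using that(3)[of "Max J"] lo 2 by (simp add: ls_def)
  next
    case 3
    have "Max J \<in> J" using 3 by (intro Max_in) (auto simp: J_def)
    then have lo: "ls ! Max J < w" "Max J < card X" by (auto simp: J_def)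
    have "l < w" if l: "l \<in> X" for l
    proof -
      obtain j where j: "j < card X" "l = ls ! j" using mem[OF l] by blast
      have "j \<le> Max J" using j 3 by simp
      then have "ls ! j \<le> ls ! Max J" using lo ls by (intro sorted_nth_mono) auto
      then show ?thesis using j lo by simp
    qed
    then show thesis using that(2) by blast
  qed
qed

locale matrix_spectrum = positive_spectrum n e c for n :: nat and e :: "nat \<Rightarrow> real" and c :: real +
  fixes R :: "complex mat"
  assumes R: "R \<in> carrier_mat n n"
    and eigenvalues: "real_eigenvalues R = e ` {..<n}"
    and trace: "(\<And>i. i < n \<Longrightarrow> \<alpha> + \<beta> * of_real (e i) \<noteq> 0) \<Longrightarrow>
       mat_trace (R * mat_inv (\<alpha> \<cdot>\<^sub>m 1\<^sub>m n + \<beta> \<cdot>\<^sub>m R)) = (\<Sum>i<n. of_real (e i) / (\<alpha> + \<beta> * of_real (e i)))"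
begin

lemma real_eigenvalues_eq: "real_eigenvalues R = poles"
  by (simp add: eigenvalues poles_def)

lemma resolvent_trace_eq:
  assumes "w \<notin> poles"
  shows "resolvent_trace R w = F w"
proof -
  have eq: "R - w \<cdot>\<^sub>m 1\<^sub>m n = (- w) \<cdot>\<^sub>m 1\<^sub>m n + 1 \<cdot>\<^sub>m R"
    using R by (intro eq_matI) auto
  have "- w + 1 * of_real (e i) \<noteq> 0" if "i < n" for i
    using assms that by (auto simp: poles_iff)
  from trace[OF this] show ?thesis
    using R by (simp add: resolvent_trace_def eq F_def)
qed

lemma phi_eq:
  assumes "w \<notin> poles"
  shows "phi c R w = Phi w"
proof -
  have "complex_of_real w \<notin> poles" using assms by simp
  then have "phi_complex c R (of_real w) = Phi (complex_of_real w)"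
    by (simp add: phi_complex_def resolvent_trace_eq Phi_def A_def B_def power2_eq_square algebra_simps)
  then show ?thesis by (simp add: phi_def)
qed

lemma resolvent_roots_eq: "resolvent_roots R y = {w. w \<notin> poles \<and> F w = y}"
  unfolding resolvent_roots_def real_eigenvalues_eq
  by (auto simp: resolvent_trace_eq)

text \<open>\<open>F\<close> is strictly increasing between eigenvalues, so a root is determined by the set of eigenvalues below
it.\<close>

lemma finite_resolvent_roots: "finite (resolvent_roots R y)"
proof (rule inj_on_finite[of "\<lambda>w. {l \<in> poles. l < w}" _ "Pow poles"])
  show "inj_on (\<lambda>w. {l \<in> poles. l < w}) (resolvent_roots R y)"
  proof (rule linorder_inj_onI)
    fix v w assume vw: "v < w" and vw': "v \<in> resolvent_roots R y" "w \<in> resolvent_roots R y"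
    show "{l \<in> poles. l < v} \<noteq> {l \<in> poles. l < w}"
    proof
      assume eq: "{l \<in> poles. l < v} = {l \<in> poles. l < w}"
      have "{v..w} \<inter> poles = {}"
      proof -
        have "l \<notin> poles" if l: "v \<le> l" "l \<le> w" for l
        proof
          assume "l \<in> poles"
          moreover then have "l \<noteq> w" using vw' by (auto simp: resolvent_roots_eq)
          ultimately have "l \<in> {l \<in> poles. l < w}" using l by simp
          then have "l \<in> {l \<in> poles. l < v}" by (simp only: eq)
          then show False using l by simp
        qed
        then show ?thesis by auto
      qed
      from F_strict_mono[OF vw this] show False using vw' by (auto simp: resolvent_roots_eq)
    qed
  qed (auto simp: linorder_class.linear)
qed auto

lemma eventually_phi_eq: "w \<notin> poles \<Longrightarrow> \<forall>\<^sub>F y in nhds w. phi c R y = Phi y"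
  by (rule eventually_mono[OF eventually_nhds_in_open[of "- poles"]])
     (auto simp: phi_eq open_Compl finite_imp_closed)

lemma local_extremum_phi_iff:
  assumes "w \<notin> poles"
  shows "local_extremum (phi c R) w \<longleftrightarrow> local_extremum Phi w"
proof -
  have "(\<forall>\<^sub>F y in nhds w. phi c R y \<le> phi c R w) \<longleftrightarrow> (\<forall>\<^sub>F y in nhds w. Phi y \<le> Phi w)"
    by (rule eventually_cong[OF eventually_phi_eq[OF assms]]) (simp add: phi_eq[OF assms])
  moreover have "(\<forall>\<^sub>F y in nhds w. phi c R w \<le> phi c R y) \<longleftrightarrow> (\<forall>\<^sub>F y in nhds w. Phi w \<le> Phi y)"
    by (rule eventually_cong[OF eventually_phi_eq[OF assms]]) (simp add: phi_eq[OF assms])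
  ultimately show ?thesis by (simp add: local_extremum_def)
qed

lemma deriv_phi:
  assumes "w \<notin> poles"
  shows "deriv (phi c R) w = c * h w"
proof -
  have "deriv (phi c R) w = deriv Phi w"
    by (rule deriv_cong_ev[OF eventually_phi_eq[OF assms] refl])
  then show ?thesis using DERIV_imp_deriv[OF DERIV_Phi[OF assms]] by simp
qed

text \<open>Indices start at \<open>0\<close> and the order is increasing, so that \<open>pole (K - k)\<close> is \<open>eig R
k\<close>.\<close>

definition pole :: "nat \<Rightarrow> real" where
  "pole j = sorted_list_of_set poles ! j"

abbreviation K :: nat where "K \<equiv> card (poles :: real set)"

lemma K_pos: "0 < K"
  using n_pos by (simp add: card_gt_0_iff) (auto simp: poles_def)

lemma pole_in_poles: "j < K \<Longrightarrow> pole j \<in> poles"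
  by (metis finite_poles nth_mem pole_def sorted_list_of_set.length_sorted_key_list_of_set sorted_list_of_set.set_sorted_key_list_of_set)

lemma pole_strict_mono: "i < j \<Longrightarrow> j < K \<Longrightarrow> pole i < pole j"
  using strict_sorted_list_of_set[of "poles :: real set"]
  by (simp add: pole_def sorted_wrt_iff_nth_less)

lemma pole_mono: "i \<le> j \<Longrightarrow> j < K \<Longrightarrow> pole i \<le> pole j"
  using pole_strict_mono[of i j] by (cases "i = j") auto

lemma pole_cases:
  assumes "l \<in> poles"
  obtains j where "j < K" "l = pole j"
  using assms unfolding pole_def
  by (metis finite_poles in_set_conv_nth sorted_list_of_set.length_sorted_key_list_of_set sorted_list_of_set.set_sorted_key_list_of_set)

lemma no_pole_between:
  assumes "Suc j < K"
  shows "{pole j<..<pole (Suc j)} \<inter> poles = {}"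
proof -
  have False if l: "l \<in> poles" "pole j < l" "l < pole (Suc j)" for l
  proof -
    obtain i where i: "i < K" "l = pole i" using l(1) by (rule pole_cases)
    show False
    proof (cases "i \<le> j")
      case True
      then show False using pole_mono[of i j] i l assms by simp
    next
      case False
      then show False using pole_mono[of "Suc j" i] i l by simp
    qed
  qed
  then show ?thesis by auto
qed

lemma max_pole: "l \<in> poles \<Longrightarrow> l \<le> pole (K - 1)"
  by (erule pole_cases) (use K_pos in \<open>auto intro: pole_mono\<close>)

lemma eig_eq:
  assumes "1 \<le> k" "k \<le> K"
  shows "eig R k = pole (K - k)"
  using assms by (simp add: eig_def real_eigenvalues_eq rev_nth pole_def)

definition splits_gap :: "nat \<Rightarrow> real \<Rightarrow> bool" where
  "splits_gap j x \<longleftrightarrow> pole j < x \<and> x < pole (Suc j) \<and> F x = 0 \<and>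
     (\<forall>w. pole j < w \<longrightarrow> w < x \<longrightarrow> F w < 0) \<and> (\<forall>w. x < w \<longrightarrow> w < pole (Suc j) \<longrightarrow> 0 < F w)"

definition gap_zero :: "nat \<Rightarrow> real" where
  "gap_zero j = (SOME x. splits_gap j x)"

lemma splits_gap_gap_zero: "Suc j < K \<Longrightarrow> splits_gap j (gap_zero j)"
  unfolding gap_zero_def
  by (rule someI_ex, rule gap_root[of "pole j" "pole (Suc j)"])
     (use pole_in_poles pole_strict_mono no_pole_between in \<open>auto simp: splits_gap_def\<close>)

lemma gap_zero:
  assumes "Suc j < K"
  shows "pole j < gap_zero j" "gap_zero j < pole (Suc j)" "F (gap_zero j) = 0"
    "\<And>w. pole j < w \<Longrightarrow> w < gap_zero j \<Longrightarrow> F w < 0" "\<And>w. gap_zero j < w \<Longrightarrow> w < pole (Suc j) \<Longrightarrow> 0 < F w"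
  using splits_gap_gap_zero[OF assms] unfolding splits_gap_def by blast+

lemma gap_zero_not_pole: "Suc j < K \<Longrightarrow> gap_zero j \<notin> poles"
  using gap_zero[of j] no_pole_between[of j] by (auto simp: disjoint_iff)

lemma pole_position:
  assumes "w \<notin> poles"
  obtains "\<And>l. l \<in> poles \<Longrightarrow> w < l" | "\<And>l. l \<in> poles \<Longrightarrow> l < w"
  | j where "Suc j < K" "pole j < w" "w < pole (Suc j)"
  using sorted_list_position[OF finite_poles assms] unfolding pole_def by metis

lemma mu_root_eq:
  assumes "j < K - 1"
  shows "mu_root R (Suc j) = gap_zero j"
proof -
  have "sorted_list_of_set (resolvent_roots R 0) = map gap_zero [0..<K - 1]"
  proof (rule sorted_list_of_set_unique[THEN iffD1, rotated])
    show "finite (resolvent_roots R 0)" by (rule finite_resolvent_roots)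
    have "set (map gap_zero [0..<K - 1]) = resolvent_roots R 0"
    proof (intro subset_antisym subsetI)
      fix w assume "w \<in> set (map gap_zero [0..<K - 1])"
      then obtain j where "j < K - 1" "w = gap_zero j" by auto
      then show "w \<in> resolvent_roots R 0"
        using gap_zero(3)[of j] gap_zero_not_pole[of j] by (simp add: resolvent_roots_eq)
    next
      fix w assume "w \<in> resolvent_roots R 0"
      then have w: "w \<notin> poles" "F w = 0" by (auto simp: resolvent_roots_eq)
      from w(1) show "w \<in> set (map gap_zero [0..<K - 1])"
      proof (rule pole_position)
        assume "\<And>l. l \<in> poles \<Longrightarrow> w < l"
        from F_pos_left[OF this] w show ?thesis by simp
      next
        assume "\<And>l. l \<in> poles \<Longrightarrow> l < w"
        from F_neg_right[OF this] w show ?thesis by simp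
      next
        fix j assume j: "Suc j < K" "pole j < w" "w < pole (Suc j)"
        then have "w = gap_zero j" using gap_zero(4,5)[OF j(1), of w] w by (cases w "gap_zero j" rule: linorder_cases) auto
        then show ?thesis using j by auto
      qed
    qed
    moreover have "sorted_wrt (<) (map gap_zero [0..<K - 1])"
      unfolding sorted_wrt_iff_nth_less
    proof (intro allI impI)
      fix i j assume ij: "i < j" "j < length (map gap_zero [0..<K - 1])"
      then have "gap_zero i < pole (Suc i)" "pole (Suc i) \<le> pole j" "pole j < gap_zero j"
        using gap_zero(2)[of i] gap_zero(1)[of j] by (auto intro: pole_mono)
      then show "map gap_zero [0..<K - 1] ! i < map gap_zero [0..<K - 1] ! j" using ij by simp
    qed
    ultimately show "sorted_wrt (<) (map gap_zero [0..<K - 1]) \<and> set (map gap_zero [0..<K - 1]) = resolvent_roots R 0 \<and>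
        length (map gap_zero [0..<K - 1]) = card (resolvent_roots R 0)"
      by (metis distinct_card strict_sorted_iff)
  qed
  then show ?thesis using assms by (simp add: mu_root_def)
qed

lemma extrema_domain_eq: "extrema_domain R = (\<Union>j<K - 1. {pole j<..<gap_zero j})"
proof -
  have "{eig R (K + 1 - k)<..<mu_root R k} = {pole (k - 1)<..<gap_zero (k - 1)}" if "k \<in> {1..<K}" for k
    using that eig_eq[of "K + 1 - k"] mu_root_eq[of "k - 1"] by auto
  then have "extrema_domain R = (\<Union>k\<in>{1..<K}. {pole (k - 1)<..<gap_zero (k - 1)})"
    unfolding extrema_domain_def num_eig_def real_eigenvalues_eq by (intro SUP_cong) auto
  also have "\<dots> = (\<Union>j\<in>(\<lambda>k. k - 1) ` {1..<K}. {pole j<..<gap_zero j})" by simp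
  also have "(\<lambda>k. k - 1) ` {1..<K} = {..<K - 1}"
  proof (intro subset_antisym subsetI)
    fix j assume "j \<in> {..<K - 1}"
    then show "j \<in> (\<lambda>k. k - 1) ` {1..<K}" by (intro image_eqI[of _ _ "Suc j"]) auto
  qed auto
  finally show ?thesis .
qed

lemma gap_subset_D:
  assumes "Suc j < K"
  shows "{pole j<..<gap_zero j} \<subseteq> D"
proof
  fix w assume w: "w \<in> {pole j<..<gap_zero j}"
  have "0 < pole j" using pole_in_poles[of j] poles_pos assms by simp
  moreover have "w \<notin> poles"
    using no_pole_between[OF assms] w gap_zero(2)[OF assms] by (auto simp: disjoint_iff)
  ultimately show "w \<in> D" using D_pos_iff[of w] gap_zero(4)[OF assms, of w] w by auto
qed

lemma D_pos_cases:
  assumes "0 < w"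
  shows "w \<in> D \<longleftrightarrow> pole (K - 1) < w \<or> (\<exists>j<K - 1. w \<in> {pole j<..<gap_zero j})"
proof
  assume w: "w \<in> D"
  then have np: "w \<notin> poles" and F: "F w < 0"
    using D_pos_iff[of w] assms by (auto simp: D_def)
  from np show "pole (K - 1) < w \<or> (\<exists>j<K - 1. w \<in> {pole j<..<gap_zero j})"
  proof (rule pole_position)
    assume "\<And>l. l \<in> poles \<Longrightarrow> w < l"
    from F_pos_left[OF this] F show ?thesis by simp
  next
    assume "\<And>l. l \<in> poles \<Longrightarrow> l < w"
    then show ?thesis using pole_in_poles[of "K - 1"] K_pos by simp
  next
    fix j assume j: "Suc j < K" "pole j < w" "w < pole (Suc j)"
    then have "w < gap_zero j"
      using gap_zero(3,5)[OF j(1)] F by (cases w "gap_zero j" rule: linorder_cases) force+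
    then show ?thesis using j by auto
  qed
next
  assume "pole (K - 1) < w \<or> (\<exists>j<K - 1. w \<in> {pole j<..<gap_zero j})"
  then show "w \<in> D"
  proof
    assume "pole (K - 1) < w"
    then show "w \<in> D" using max_pole by (intro right_of_poles_in_D) force
  next
    assume "\<exists>j<K - 1. w \<in> {pole j<..<gap_zero j}"
    then show "w \<in> D" using gap_subset_D by (metis less_diff_conv subsetD add.commute plus_1_eq_Suc)
  qed
qed

text \<open>The interval with index \<open>j\<close> carries an increasing branch, from a local minimum \<open>\<alpha>\<close> to
a local maximum \<open>\<beta>\<close>.\<close>

definition bump :: "nat \<Rightarrow> real \<Rightarrow> real \<Rightarrow> bool" where
  "bump j \<alpha> \<beta> \<longleftrightarrow> pole j < \<alpha> \<and> \<alpha> < \<beta> \<and> \<beta> < gap_zero j \<and> h \<alpha> = 0 \<and> h \<beta> = 0 \<and>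
     (\<forall>w\<in>{pole j<..<gap_zero j}. (0 < h w \<longleftrightarrow> \<alpha> < w \<and> w < \<beta>) \<and>
        (local_extremum Phi w \<longleftrightarrow> w = \<alpha> \<or> w = \<beta>))"

lemma bump_or_flat:
  assumes "Suc j < K"
  shows "(\<exists>\<alpha> \<beta>. bump j \<alpha> \<beta>) \<or> (\<forall>w\<in>{pole j<..<gap_zero j}. h w \<le> 0 \<and> \<not> local_extremum Phi w)"
proof (rule gap_structure[of "pole j" "gap_zero j"])
  assume "\<And>w. pole j < w \<Longrightarrow> w < gap_zero j \<Longrightarrow> h w \<le> 0" "\<And>w. pole j < w \<Longrightarrow> w < gap_zero j \<Longrightarrow> \<not> local_extremum Phi w"
  then show ?thesis by auto
next
  fix \<alpha> \<beta> assume "pole j < \<alpha>" "\<alpha> < \<beta>" "\<beta> < gap_zero j" "h \<alpha> = 0" "h \<beta> = 0"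
      "\<And>w. pole j < w \<Longrightarrow> w < gap_zero j \<Longrightarrow> 0 < h w \<longleftrightarrow> \<alpha> < w \<and> w < \<beta>"
      "\<And>w. pole j < w \<Longrightarrow> w < gap_zero j \<Longrightarrow> local_extremum Phi w \<longleftrightarrow> w = \<alpha> \<or> w = \<beta>"
  then have "bump j \<alpha> \<beta>" unfolding bump_def by auto
  then show ?thesis by blast
qed (use assms gap_zero[OF assms] pole_in_poles[of j] gap_subset_D[OF assms] gap_zero_not_pole[OF assms] in auto)

definition gaps :: "nat list" where
  "gaps = filter (\<lambda>j. \<exists>\<alpha> \<beta>. bump j \<alpha> \<beta>) [0..<K - 1]"

definition gap_left :: "nat \<Rightarrow> real" where
  "gap_left j = fst (SOME p. bump j (fst p) (snd p))"

definition gap_right :: "nat \<Rightarrow> real" where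
  "gap_right j = snd (SOME p. bump j (fst p) (snd p))"

lemma bump_gap: "j \<in> set gaps \<Longrightarrow> Suc j < K \<and> bump j (gap_left j) (gap_right j)"
proof -
  assume "j \<in> set gaps"
  then have "j < K - 1" "\<exists>p. bump j (fst p) (snd p)" by (auto simp: gaps_def)
  then show ?thesis using someI_ex[of "\<lambda>p. bump j (fst p) (snd p)"] by (auto simp: gap_left_def gap_right_def)
qed

lemma extrema_eq: "extrema c R = (\<Union>j\<in>set gaps. {gap_left j, gap_right j})"
proof (intro subset_antisym subsetI)
  fix w assume "w \<in> extrema c R"
  then obtain j where j: "j < K - 1" "w \<in> {pole j<..<gap_zero j}" and ext: "local_extremum (phi c R) w"
    by (auto simp: extrema_def extrema_domain_eq)
  have sj: "Suc j < K" using j by simp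
  have "w \<notin> poles" using gap_subset_D[OF sj] j by (auto simp: D_def)
  then have ext': "local_extremum Phi w" using ext local_extremum_phi_iff by simp
  then have "\<exists>\<alpha> \<beta>. bump j \<alpha> \<beta>" using bump_or_flat[OF sj] j by blast
  then have "j \<in> set gaps" using j by (auto simp: gaps_def)
  moreover have "w = gap_left j \<or> w = gap_right j"
    using bump_gap[OF calculation] j ext' by (auto simp: bump_def)
  ultimately show "w \<in> (\<Union>j\<in>set gaps. {gap_left j, gap_right j})" by auto
next
  fix w assume "w \<in> (\<Union>j\<in>set gaps. {gap_left j, gap_right j})"
  then obtain j where j: "j \<in> set gaps" and w: "w = gap_left j \<or> w = gap_right j" by auto
  have b: "Suc j < K" "bump j (gap_left j) (gap_right j)" using bump_gap[OF j] by auto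
  have wI: "w \<in> {pole j<..<gap_zero j}" using b w by (auto simp: bump_def)
  then have "local_extremum Phi w" using b w by (auto simp: bump_def)
  moreover have "w \<notin> poles" using gap_subset_D[OF b(1)] wI by (auto simp: D_def)
  ultimately have "local_extremum (phi c R) w" using local_extremum_phi_iff by simp
  then show "w \<in> extrema c R" using wI b by (auto simp: extrema_def extrema_domain_eq)
qed

lemma gap_right_less_gap_left:
  assumes "i \<in> set gaps" "j \<in> set gaps" "i < j"
  shows "gap_right i < gap_left j"
proof -
  have i: "Suc i < K" "gap_right i < gap_zero i" using bump_gap[OF assms(1)] by (auto simp: bump_def)
  have j: "Suc j < K" "pole j < gap_left j" using bump_gap[OF assms(2)] by (auto simp: bump_def)
  have "gap_zero i < pole (Suc i)" "pole (Suc i) \<le> pole j"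
    using gap_zero(2)[OF i(1)] pole_mono[of "Suc i" j] assms j by auto
  then show ?thesis using i j by simp
qed

lemma gaps_strict_sorted: "sorted_wrt (<) gaps"
  unfolding gaps_def by (intro sorted_wrt_filter) simp

text \<open>Since each interval contributes its two extrema consecutively, the extrema with even index (counting from
\<open>0\<close>) are the minima and those with odd index the maxima.\<close>

lemma sorted_extrema: "sorted_list_of_set (extrema c R) = concat (map (\<lambda>j. [gap_left j, gap_right j]) gaps)"
  (is "_ = ?L")
proof (rule sorted_list_of_set_unique[THEN iffD1, rotated])
  show "finite (extrema c R)" by (simp add: extrema_eq)
  have "sorted_wrt (\<lambda>i j. gap_right i < gap_left j) gaps"
    by (rule sorted_wrt_mono_rel[OF _ gaps_strict_sorted]) (rule gap_right_less_gap_left)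
  then have "sorted_wrt (<) ?L"
    using bump_gap by (intro sorted_wrt_concat_pairs) (auto simp: bump_def)
  moreover have "set ?L = extrema c R" by (auto simp: extrema_eq)
  ultimately show "sorted_wrt (<) ?L \<and> set ?L = extrema c R \<and> length ?L = card (extrema c R)"
    by (metis distinct_card strict_sorted_iff)
qed

lemma num_gaps_eq: "num_gaps c R = length gaps"
proof -
  have "card (extrema c R) = length (sorted_list_of_set (extrema c R))" by simp
  then show ?thesis by (simp add: num_gaps_def sorted_extrema length_concat_pairs)
qed

definition gap_lower_edge :: "nat \<Rightarrow> real" where "gap_lower_edge p = Phi (gap_left (gaps ! p))"
definition gap_upper_edge :: "nat \<Rightarrow> real" where "gap_upper_edge p = Phi (gap_right (gaps ! p))"

lemma gap_ends_D:
  assumes "j \<in> set gaps"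
  shows "gap_left j \<in> D" "gap_right j \<in> D" "h (gap_left j) = 0" "h (gap_right j) = 0" "gap_left j < gap_right j"
  using bump_gap[OF assms] gap_subset_D[of j] by (auto simp: bump_def)

lemma phi_D: "w \<in> D \<Longrightarrow> phi c R w = Phi w"
  by (simp add: D_def phi_eq)

lemma x_plus_eq:
  assumes "p < length gaps"
  shows "x_plus c R (p + 1) = gap_lower_edge p"
  using nth_concat_pairs[OF assms, of gap_left gap_right] gap_ends_D[of "gaps ! p"] assms
  by (simp add: x_plus_def w_plus_def sorted_extrema phi_D gap_lower_edge_def)

lemma x_minus_eq:
  assumes "p < length gaps"
  shows "x_minus c R (p + 2) = gap_upper_edge p"
  using nth_concat_pairs[OF assms, of gap_left gap_right] gap_ends_D[of "gaps ! p"] assms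
  by (simp add: x_minus_def w_minus_def sorted_extrema phi_D gap_upper_edge_def)

lemma Phi_mono_D:
  assumes "v < w" "v \<in> D" "w \<in> D" "0 \<le> h v" "0 \<le> h w"
  shows "Phi v < Phi w"
  using assms by (intro Phi_strict_mono_on_increasing) (auto simp: D_def h_def)

text \<open>The definite description in \<open>w_right\<close> is meaningful by uniqueness of the critical point.\<close>

lemma w_right:
  "pole (K - 1) < w_right c R" "h (w_right c R) = 0"
  "\<And>w. pole (K - 1) < w \<Longrightarrow> 0 < h w \<longleftrightarrow> w_right c R < w"
proof -
  have mp: "pole (K - 1) \<in> poles" using K_pos by (simp add: pole_in_poles)
  obtain w0 where w0: "pole (K - 1) < w0" "h w0 = 0" "\<And>w. pole (K - 1) < w \<Longrightarrow> 0 < h w \<longleftrightarrow> w0 < w"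
    "\<And>w. pole (K - 1) < w \<Longrightarrow> h w = 0 \<longleftrightarrow> w = w0"
    using right_structure[OF mp max_pole] by blast
  have e1: "eig R 1 = pole (K - 1)" using eig_eq[of 1] K_pos by simp
  have np: "w \<notin> poles" if "pole (K - 1) < w" for w using max_pole that by force
  have "w_right c R = w0"
    unfolding w_right_def e1
    by (rule the_equality) (use w0 np deriv_phi c_pos in auto)
  then show "pole (K - 1) < w_right c R" "h (w_right c R) = 0"
    "\<And>w. pole (K - 1) < w \<Longrightarrow> 0 < h w \<longleftrightarrow> w_right c R < w"
    using w0 by auto
qed

lemma w_right_D: "w_right c R \<in> D"
  using w_right(1) max_pole by (intro right_of_poles_in_D) force

lemma Phi_image_right: "Phi ` {w_right c R<..} = {x_right c R<..}"
proof -
  have gap_upper_edge: "x_right c R = Phi (w_right c R)" by (simp add: x_right_def phi_D[OF w_right_D])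
  have np: "{w_right c R..b} \<inter> poles = {}" for b
    using max_pole w_right(1) by force
  have img: "Phi ` {w_right c R<..<b} = {x_right c R<..<Phi b}" if "w_right c R < b" for b
    unfolding gap_upper_edge using that np w_right by (intro Phi_image_increasing) auto
  show ?thesis
  proof (intro subset_antisym subsetI)
    fix y assume "y \<in> Phi ` {w_right c R<..}"
    then obtain w where w: "w_right c R < w" "y = Phi w" by auto
    then have "y \<in> Phi ` {w_right c R<..<w + 1}" by auto
    then show "y \<in> {x_right c R<..}" using img[of "w + 1"] w by auto
  next
    fix y assume y: "y \<in> {x_right c R<..}"
    have "\<forall>\<^sub>F w in at_top. y < Phi w"
      using Phi_at_top by (rule filterlim_at_top_dense[THEN iffD1, rule_format])
    then have "\<forall>\<^sub>F w in at_top. y < Phi w \<and> w_right c R < w"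
      using eventually_gt_at_top by (rule eventually_conj)
    then obtain b where "y < Phi b" "w_right c R < b"
      using eventually_happens'[OF trivial_limit_at_top_linorder] by blast
    then have "y \<in> Phi ` {w_right c R<..<b}" using img[of b] y by auto
    then show "y \<in> Phi ` {w_right c R<..}" by auto
  qed
qed

lemma Phi_image_gap:
  assumes "j \<in> set gaps"
  shows "Phi ` {gap_left j<..<gap_right j} = {Phi (gap_left j)<..<Phi (gap_right j)}"
proof (rule Phi_image_increasing)
  have b: "Suc j < K" "bump j (gap_left j) (gap_right j)" using bump_gap[OF assms] by auto
  show "gap_left j < gap_right j" using b by (simp add: bump_def)
  show "{gap_left j..gap_right j} \<inter> poles = {}"
  proof -
    have "{gap_left j..gap_right j} \<subseteq> D"
      by (rule subset_trans[OF _ gap_subset_D[OF b(1)]]) (use b(2) in \<open>auto simp: bump_def\<close>)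
    then show ?thesis by (auto simp: D_def)
  qed
  show "0 < h x" if "gap_left j < x" "x < gap_right j" for x
    using b(2) that by (auto simp: bump_def)
qed

text \<open>This identifies \<open>omega_min\<close>, since a root to the left of all eigenvalues is smaller than every other
root, and then the definite description in \<open>w_left\<close>.\<close>

lemma left_edge:
  assumes c: "1 < c"
  obtains om where "om < w_left c R" "w_left c R < 0" "h (w_left c R) = 0" "{om<..<0} \<subseteq> D"
    "\<And>w. w < 0 \<Longrightarrow> w \<in> D \<Longrightarrow> om < w" "\<And>w. om < w \<Longrightarrow> w < 0 \<Longrightarrow> 0 < h w \<longleftrightarrow> w < w_left c R"
    "Phi ` {om<..<w_left c R} = {0<..<x_left c R}"
proof -
  obtain om where om: "om < 0" "F om = 1 / c" "{om<..<0} \<subseteq> D" "\<And>w. w < 0 \<Longrightarrow> w \<in> D \<Longrightarrow> om < w"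
    "Phi om = 0"
    using left_root[OF c] by blast
  obtain w0 where w0: "om < w0" "w0 < 0" "h w0 = 0"
    "\<And>w. om < w \<Longrightarrow> w < 0 \<Longrightarrow> 0 < h w \<longleftrightarrow> w < w0" "\<And>w. om < w \<Longrightarrow> w < 0 \<Longrightarrow> h w = 0 \<longleftrightarrow> w = w0"
    using left_structure[OF om(1,3,5)] by blast
  have "omega_min c R = om"
    unfolding omega_min_def
  proof (rule Min_eqI)
    show "finite (resolvent_roots R (1 / c))" by (rule finite_resolvent_roots)
    show "om \<in> resolvent_roots R (1 / c)"
      using om nonpos_not_pole[of om] by (simp add: resolvent_roots_eq)
    fix y assume "y \<in> resolvent_roots R (1 / c)"
    then have y: "F y = 1 / c" by (simp add: resolvent_roots_eq)
    show "om \<le> y"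
    proof (rule ccontr)
      assume "\<not> om \<le> y"
      then have "F y < F om"
        using om(1) nonpos_not_pole by (intro F_strict_mono) auto
      then show False using y om by simp
    qed
  qed
  then have "w_left c R = w0"
    unfolding w_left_def
    by (intro the_equality) (use w0 deriv_phi nonpos_not_pole c_pos in auto)
  moreover have "Phi ` {om<..<w0} = {Phi om<..<Phi w0}"
    using w0 nonpos_not_pole by (intro Phi_image_increasing) auto
  moreover have "x_left c R = Phi w0"
    using c calculation(1) phi_eq[of w0] nonpos_not_pole[of w0] w0 by (simp add: x_left_def)
  ultimately show thesis using that[of om] w0 om by simp
qed

text \<open>For \<open>c \<le> 1\<close> the first interval is empty, in accordance with the absence of a component of
\<open>D\<close> to the left of \<open>0\<close>.\<close>

lemma increasing_branches:
  "Phi ` {w \<in> D. 0 < h w} =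
     {0<..<x_left c R} \<union> (\<Union>p<length gaps. {gap_lower_edge p<..<gap_upper_edge p}) \<union> {x_right c R<..}"
proof -
  define Neg where "Neg = {w \<in> D. 0 < h w \<and> w < 0}"
  have Neg: "Phi ` Neg = {0<..<x_left c R}"
  proof (cases "1 < c")
    case True
    obtain om where om: "om < w_left c R" "w_left c R < 0" "{om<..<0} \<subseteq> D"
      "\<And>w. w < 0 \<Longrightarrow> w \<in> D \<Longrightarrow> om < w" "\<And>w. om < w \<Longrightarrow> w < 0 \<Longrightarrow> 0 < h w \<longleftrightarrow> w < w_left c R"
      "Phi ` {om<..<w_left c R} = {0<..<x_left c R}"
      by (rule left_edge[OF True]) (rule that; assumption)
    have "Neg = {om<..<w_left c R}"
    proof (intro subset_antisym subsetI)
      fix w assume "w \<in> Neg"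
      then show "w \<in> {om<..<w_left c R}" using om(4,5)[of w] by (simp add: Neg_def)
    next
      fix w assume w: "w \<in> {om<..<w_left c R}"
      then have "w \<in> D" using om(2,3) by auto
      then show "w \<in> Neg" using w om(2) om(5)[of w] by (simp add: Neg_def)
    qed
    then show ?thesis using om by simp
  next
    case False
    then have "Neg = {}" using D_neg_empty by (auto simp: Neg_def)
    then show ?thesis using False by (simp add: x_left_def)
  qed
  have "{w \<in> D. 0 < h w} = Neg \<union> (\<Union>j\<in>set gaps. {gap_left j<..<gap_right j}) \<union> {w_right c R<..}" (is "?L = ?R")
  proof (intro subset_antisym subsetI)
    fix w assume w: "w \<in> ?L"
    show "w \<in> ?R"
    proof (cases "w < 0")
      case False
      then have w0: "0 < w" using w zero_not_D by (cases "w = 0") auto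
      with w D_pos_cases consider "pole (K - 1) < w" | j where "j < K - 1" "w \<in> {pole j<..<gap_zero j}" by blast
      then show ?thesis
      proof cases
        case 1
        then show ?thesis using w_right(3) w by auto
      next
        case 2
        then have "\<exists>\<alpha> \<beta>. bump j \<alpha> \<beta>" using bump_or_flat[of j] w by force
        then have j: "j \<in> set gaps" using 2 by (auto simp: gaps_def)
        then have "w \<in> {gap_left j<..<gap_right j}" using bump_gap[OF j] 2 w by (auto simp: bump_def)
        then show ?thesis using j by blast
      qed
    qed (use w in \<open>auto simp: Neg_def\<close>)
  next
    fix w assume "w \<in> ?R"
    then consider "w \<in> Neg" | j where "j \<in> set gaps" "w \<in> {gap_left j<..<gap_right j}" | "w_right c R < w" by auto
    then show "w \<in> ?L"
    proof cases
      case 2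
      then have b: "Suc j < K" "bump j (gap_left j) (gap_right j)" using bump_gap by auto
      then have "w \<in> {pole j<..<gap_zero j}" "0 < h w" using 2 by (auto simp: bump_def)
      then show ?thesis using gap_subset_D[OF b(1)] by auto
    next
      case 3
      then have "pole (K - 1) < w" using w_right(1) by simp
      moreover then have "w \<in> D" using max_pole by (intro right_of_poles_in_D) force
      ultimately show ?thesis using w_right(3) 3 by auto
    qed (simp add: Neg_def)
  qed
  then have "Phi ` {w \<in> D. 0 < h w} = Phi ` Neg \<union> (\<Union>j\<in>set gaps. Phi ` {gap_left j<..<gap_right j}) \<union> Phi ` {w_right c R<..}"
    by (simp add: image_Un image_UN)
  also have "(\<Union>j\<in>set gaps. Phi ` {gap_left j<..<gap_right j}) = (\<Union>j\<in>set gaps. {Phi (gap_left j)<..<Phi (gap_right j)})"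
    by (intro SUP_cong refl Phi_image_gap)
  also have "\<dots> = (\<Union>p<length gaps. {gap_lower_edge p<..<gap_upper_edge p})"
  proof -
    have "set gaps = (!) gaps ` {..<length gaps}" by (auto simp: in_set_conv_nth)
    then show ?thesis by (simp add: gap_lower_edge_def gap_upper_edge_def)
  qed
  finally show ?thesis by (simp add: Neg Phi_image_right)
qed

lemma x_left_less:
  assumes "w \<in> D" "0 < w" "h w = 0"
  shows "x_left c R < Phi w"
proof (cases "1 < c")
  case True
  obtain om where om: "om < w_left c R" "w_left c R < 0" "h (w_left c R) = 0" "{om<..<0} \<subseteq> D"
    by (rule left_edge[OF True]) (rule that; assumption)
  have "w_left c R \<in> D" using om by auto
  then show ?thesis
    using Phi_mono_D[of "w_left c R" w] om assms True phi_D[of "w_left c R"] by (simp add: x_left_def)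
next
  case False
  then show ?thesis using Phi_pos[OF assms(1)] by (simp add: x_left_def)
qed

lemma x_left_pos_iff: "0 < x_left c R \<longleftrightarrow> 1 < c"
proof
  assume c: "1 < c"
  obtain om where om: "om < w_left c R" "w_left c R < 0" "{om<..<0} \<subseteq> D"
    by (rule left_edge[OF c]) (rule that; assumption)
  then have D: "w_left c R \<in> D" by auto
  show "0 < x_left c R" using \<open>1 < c\<close> Phi_pos[OF D] phi_D[OF D] by (simp add: x_left_def)
qed (simp add: x_left_def split: if_splits)

lemma x_left_nonneg: "0 \<le> x_left c R"
  using x_left_pos_iff by (cases "1 < c") (auto simp: x_left_def)

lemma gap_left_pos: "j \<in> set gaps \<Longrightarrow> 0 < gap_left j"
  using bump_gap[of j] poles_pos[OF pole_in_poles[of j]] by (auto simp: bump_def)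

lemma complement_of_branches:
  "{x. 0 \<le> x \<and> x \<notin> Phi ` {w \<in> D. 0 < h w}} =
    (let q = num_gaps c R in
       (if c > 1 then {0} else {}) \<union>
       (if q = 0 then {x_left c R..x_right c R}
        else {x_left c R..x_plus c R 1}
             \<union> (\<Union>p\<in>{2..q}. {x_minus c R p..x_plus c R p})
             \<union> {x_minus c R (q + 1)..x_right c R}))"
proof -
  define q where "q = length gaps"
  have mem: "gaps ! p \<in> set gaps" if "p < q" for p using that by (simp add: q_def)
  have right0: "0 < w_right c R"
    using poles_pos[OF pole_in_poles[of "K - 1"]] w_right(1) K_pos by simp
  have xr_eq: "x_right c R = Phi (w_right c R)" by (simp add: x_right_def phi_D[OF w_right_D])
  have gap_lt_right: "gap_right j < w_right c R" if "j \<in> set gaps" for j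
  proof -
    have "Suc j < K" "gap_right j < gap_zero j" using bump_gap[OF that] by (auto simp: bump_def)
    moreover then have "pole (Suc j) \<le> pole (K - 1)" by (intro pole_mono) auto
    ultimately show ?thesis using gap_zero(2)[of j] w_right(1) by simp
  qed
  have xlxr: "gap_lower_edge p < gap_upper_edge p" if "p < q" for p
    using gap_ends_D[OF mem[OF that]] by (auto simp: gap_lower_edge_def gap_upper_edge_def intro!: Phi_mono_D)
  have xrxl: "gap_upper_edge p < gap_lower_edge p'" if "p < p'" "p' < q" for p p'
  proof -
    have p: "p < q" using that by simp
    have "gaps ! p < gaps ! p'"
      using gaps_strict_sorted that by (simp add: sorted_wrt_iff_nth_less q_def)
    then have "gap_right (gaps ! p) < gap_left (gaps ! p')"
      using gap_right_less_gap_left mem p that by blast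
    then show ?thesis
      using gap_ends_D[OF mem[OF p]] gap_ends_D[OF mem[OF that(2)]]
      by (auto simp: gap_lower_edge_def gap_upper_edge_def intro!: Phi_mono_D)
  qed
  have Lx: "x_left c R \<le> gap_lower_edge p" if "p < q" for p
    using gap_ends_D[OF mem[OF that]] gap_left_pos[OF mem[OF that]] x_left_less by (simp add: gap_lower_edge_def less_imp_le)
  have xU: "gap_upper_edge p \<le> x_right c R" if "p < q" for p
  proof -
    note ends = gap_ends_D[OF mem[OF that]]
    have "Phi (gap_right (gaps ! p)) < Phi (w_right c R)"
      by (rule Phi_mono_D[OF gap_lt_right[OF mem[OF that]] ends(2) w_right_D])
         (simp_all add: ends w_right(2))
    then show ?thesis by (simp add: xr_eq gap_upper_edge_def)
  qed
  have LU: "x_left c R \<le> x_right c R"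
    unfolding xr_eq using x_left_less[OF w_right_D right0 w_right(2)] by simp
  have "{x. 0 \<le> x \<and> x \<notin> Phi ` {w \<in> D. 0 < h w}} =
      (if c > 1 then {0} else {}) \<union>
      {s. x_left c R \<le> s \<and> s \<le> x_right c R \<and> (\<forall>p<q. \<not> (gap_lower_edge p < s \<and> s < gap_upper_edge p))}" (is "?X = ?Y")
  proof (intro subset_antisym subsetI)
    fix x assume "x \<in> ?X"
    then show "x \<in> ?Y"
      using x_left_pos_iff x_left_nonneg by (auto simp: increasing_branches q_def[symmetric] not_less)
  next
    fix x assume x: "x \<in> ?Y"
    show "x \<in> ?X"
    proof (cases "x_left c R \<le> x")
      case True
      have x_ge: "x \<in> {s. x_left c R \<le> s \<and> s \<le> x_right c R \<and> (\<forall>p<q. \<not> (gap_lower_edge p < s \<and> s < gap_upper_edge p))}"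
      proof (cases "1 < c \<and> x = 0")
        case True
        then show ?thesis using \<open>x_left c R \<le> x\<close> x_left_pos_iff by simp
      qed (use x in \<open>auto split: if_splits\<close>)
      then show ?thesis using x_left_nonneg by (auto simp: increasing_branches q_def[symmetric])
    next
      case False
      then have "x = 0" using x by (auto split: if_splits)
      moreover have "gap_lower_edge p \<ge> 0" if "p < q" for p using Lx[OF that] x_left_nonneg by simp
      moreover have "0 \<le> x_right c R" using LU x_left_nonneg by simp
      ultimately show ?thesis by (force simp: increasing_branches q_def[symmetric])
    qed
  qed
  also have "{s. x_left c R \<le> s \<and> s \<le> x_right c R \<and> (\<forall>p<q. \<not> (gap_lower_edge p < s \<and> s < gap_upper_edge p))} =
      (if q = 0 then {x_left c R..x_right c R} else {x_left c R..gap_lower_edge 0} \<union>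
        (\<Union>p\<in>{1..<q}. {gap_upper_edge (p - 1)..gap_lower_edge p}) \<union> {gap_upper_edge (q - 1)..x_right c R})"
    by (rule interval_minus_ordered_gaps) (use xlxr xrxl Lx xU in auto)
  also have "\<dots> = (if q = 0 then {x_left c R..x_right c R}
        else {x_left c R..x_plus c R 1}
             \<union> (\<Union>p\<in>{2..q}. {x_minus c R p..x_plus c R p})
             \<union> {x_minus c R (q + 1)..x_right c R})"
  proof (cases "q = 0")
    case False
    have "(\<Union>p\<in>{2..q}. {x_minus c R p..x_plus c R p}) = (\<Union>p\<in>Suc ` {1..<q}. {x_minus c R p..x_plus c R p})"
      unfolding image_Suc_atLeastLessThan by (rule arg_cong[where f = "\<lambda>I. \<Union>p\<in>I. {x_minus c R p..x_plus c R p}"]) auto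
    also have "\<dots> = (\<Union>p\<in>{1..<q}. {x_minus c R (Suc p)..x_plus c R (Suc p)})" by blast
    also have "\<dots> = (\<Union>p\<in>{1..<q}. {gap_upper_edge (p - 1)..gap_lower_edge p})"
    proof (intro SUP_cong refl)
      fix p assume "p \<in> {1..<q}"
      then have "p - 1 < length gaps" "p - 1 + 2 = Suc p" "p < length gaps" by (auto simp: q_def)
      then show "{x_minus c R (Suc p)..x_plus c R (Suc p)} = {gap_upper_edge (p - 1)..gap_lower_edge p}"
        using x_minus_eq[of "p - 1"] x_plus_eq[of p] by simp
    qed
    finally have mid: "(\<Union>p\<in>{2..q}. {x_minus c R p..x_plus c R p}) = (\<Union>p\<in>{1..<q}. {gap_upper_edge (p - 1)..gap_lower_edge p})" .
    have "x_minus c R (q + 1) = gap_upper_edge (q - 1)" using x_minus_eq[of "q - 1"] False by (simp add: q_def)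
    moreover have "x_plus c R 1 = gap_lower_edge 0" using x_plus_eq[of 0] False by (simp add: q_def)
    ultimately show ?thesis using False mid by simp
  qed simp
  finally show ?thesis by (simp add: Let_def num_gaps_eq q_def)
qed

text \<open>With \<open>w = z c s - 1 / (c s)\<close>, the denominator \<open>1 - z c\<^sup>2 s\<^sup>2\<close> equals \<open>- w
c s\<close>, and the matrix to be inverted is \<open>z / w\<close> times \<open>R - w\<close>. Since \<open>w\<close>
has positive imaginary part, nothing degenerates.\<close>

lemma canonical_equation:
  assumes z: "0 < Im z" and s: "0 < Im s" "0 < Im (z * s)" and eq: "solves_t_equation c R z s"
  shows "z * s = (z * of_real c * s - 1 / (of_real c * s)) * F (z * of_real c * s - 1 / (of_real c * s))"
proof -
  define w where "w = z * of_real c * s - 1 / (of_real c * s)"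
  define \<kappa> where "\<kappa> = (z * of_real c * s) / (1 - z * (of_real c)\<^sup>2 * s\<^sup>2)"
  have s0: "s \<noteq> 0" and z0: "z \<noteq> 0" using s z by auto
  have c0: "complex_of_real c \<noteq> 0" using c_pos by simp
  have "0 < Im (- (1 / (of_real c * s)))"
  proof -
    have "0 < (Re s)\<^sup>2 + (Im s)\<^sup>2" using s by (simp add: add_nonneg_pos)
    then show ?thesis using s c_pos s0
      by (simp add: Im_divide power_mult_distrib flip: distrib_left)
  qed
  moreover have "0 < Im (of_real c * (z * s))" using s c_pos by simp
  ultimately have "0 < Im (of_real c * (z * s) + - (1 / (of_real c * s)))"
    by (simp only: plus_complex.sel add_pos_pos)
  then have Imw: "0 < Im w" by (simp add: w_def mult_ac)
  then have w0: "w \<noteq> 0" and np: "w \<notin> poles" by (auto intro!: Im_in_poles)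
  have den: "1 - z * (of_real c)\<^sup>2 * s\<^sup>2 = - (w * of_real c * s)"
    using s0 c0 by (simp add: w_def field_simps power2_eq_square)
  have \<kappa>: "\<kappa> = - (z / w)"
    unfolding \<kappa>_def den using s0 c0 w0 by (simp add: field_simps)
  have fac: "- z + (- \<kappa>) * of_real (e i) = (z / w) * (of_real (e i) - w)" for i
    using w0 by (simp add: \<kappa> field_simps)
  have nz: "of_real (e i) - w \<noteq> 0" if "i < n" for i using np that by (auto simp: poles_iff)
  have X: "(- z) \<cdot>\<^sub>m 1\<^sub>m n - \<kappa> \<cdot>\<^sub>m R = (- z) \<cdot>\<^sub>m 1\<^sub>m n + (- \<kappa>) \<cdot>\<^sub>m R"
    using R by (intro eq_matI) auto
  have "s = (1 / of_nat n) * mat_trace (R * mat_inv ((- z) \<cdot>\<^sub>m 1\<^sub>m n - \<kappa> \<cdot>\<^sub>m R))"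
    using eq R unfolding solves_t_equation_def \<kappa>_def by simp
  also have "mat_trace (R * mat_inv ((- z) \<cdot>\<^sub>m 1\<^sub>m n - \<kappa> \<cdot>\<^sub>m R))
      = (\<Sum>i<n. of_real (e i) / (- z + (- \<kappa>) * of_real (e i)))"
    unfolding X by (rule trace) (use nz z0 w0 fac in auto)
  also have "\<dots> = (\<Sum>i<n. (w / z) * (of_real (e i) / (of_real (e i) - w)))"
    unfolding fac using nz z0 w0 by (intro sum.cong) (auto simp: field_simps)
  finally have "s = (1 / of_nat n) * ((w / z) * (\<Sum>i<n. of_real (e i) / (of_real (e i) - w)))"
    by (simp only: sum_distrib_left)
  then have "s = (w / z) * F w" by (simp add: F_def)
  then have "z * s = w * F w" using z0 by simp
  then show ?thesis by (simp add: w_def)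
qed

end

theorem theorem2:
  fixes M N L :: nat and a b :: real and R :: "complex mat"
    and t :: "complex \<Rightarrow> complex" and \<mu> :: "real measure"
  assumes "M \<ge> 1" and "N \<ge> 1" and "L \<ge> 1"
    and "0 < a" and "a < b"
    and "R \<in> carrier_mat M M" and "hermitian_mat R"
    and "pos_semidef_mat (R - complex_of_real a \<cdot>\<^sub>m 1\<^sub>m M)"
    and "pos_def_mat (complex_of_real b \<cdot>\<^sub>m 1\<^sub>m M - R)"
    and "is_t_solution (ratio_c M N L) R t"
    and "finite_measure \<mu>" and "sets \<mu> = sets borel" and "emeasure \<mu> {..<0} = 0"
    and "is_stieltjes_transform \<mu> t"
  shows "measure_support \<mu> =
    (let c = ratio_c M N L; q = num_gaps c R in
       (if c > 1 then {0} else {}) \<union>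
       (if q = 0 then {x_left c R..x_right c R}
        else {x_left c R..x_plus c R 1}
             \<union> (\<Union>p\<in>{2..q}. {x_minus c R p..x_plus c R p})
             \<union> {x_minus c R (q + 1)..x_right c R}))"
proof -
  define c where "c = ratio_c M N L"
  have c: "0 < c" using assms(1-3) by (simp add: c_def ratio_c_def)
  obtain e :: "nat \<Rightarrow> real" where e: "\<And>i. i < M \<Longrightarrow> a \<le> e i" "real_eigenvalues R = e ` {..<M}"
    and tr: "\<And>\<alpha> \<beta>. (\<And>i. i < M \<Longrightarrow> \<alpha> + \<beta> * of_real (e i) \<noteq> 0) \<Longrightarrow>
       mat_trace (R * mat_inv (\<alpha> \<cdot>\<^sub>m 1\<^sub>m M + \<beta> \<cdot>\<^sub>m R)) = (\<Sum>i<M. of_real (e i) / (\<alpha> + \<beta> * of_real (e i)))"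
    using hermitian_spectral_data[OF assms(6-8)] by blast
  interpret matrix_spectrum M e c R
  proof
    show "0 < e i" if "i < M" for i using e(1)[OF that] assms(4) by simp
  qed (use assms(1,6) c e(2) tr in auto)
  have sol: "0 < Im (t z)" "0 < Im (z * t z)" "solves_t_equation c R z (t z)" if "0 < Im z" for z
    using assms(10) that by (auto simp: is_t_solution_def c_def)
  interpret finite_measure \<mu> by fact
  interpret stieltjes_solution M e c \<mu> t
  proof
    show "sets \<mu> = sets borel" "emeasure \<mu> {..<0} = 0" "is_stieltjes_transform \<mu> t" by fact+
    fix z :: complex assume z: "0 < Im z"
    show "0 < Im (t z)" "0 < Im (z * t z)" by (rule sol[OF z])+
    show "z * t z = (z * of_real c * t z - 1 / (of_real c * t z)) * F (z * of_real c * t z - 1 / (of_real c * t z))"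
      by (rule canonical_equation[OF z sol[OF z]])
  qed
  show ?thesis
    using measure_support_iff complement_of_branches by (simp add: c_def Let_def)
qed

end
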